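(* Let $\Theta=(a,b)$ with $-\infty\le a<b\le\infty$, and let $X_1,\ldots,X_n$ be i.i.d. random variables with probability density (or mass) function $f(\cdot|\theta_0)$, $\theta_0\in\Theta$, belonging to a one-parameter exponential family $$f(x|\theta)=\exp\{k(\theta)T(x)-A(\theta)+S(x)\}\,\mathbf{1}_{\{x\in B\}},\qquad \theta\in\Theta,$$ where $B=\{x:f(x|\theta)>0\}$ does not depend on $\theta$. Put $D(\theta)=\frac{A'(\theta)}{k'(\theta)}$. Assume that (A1)-(A3) and (R1)-(R4), as listed in the context, are satisfied, so that the maximum likelihood estimator $\hat\theta_n(\boldsymbol{X})$, $\boldsymbol{X}=(X_1,\ldots,X_n)$, exists and is unique. Let $Z\sim\mathcal{N}(0,1)$, let $h:\mathbb{R}\to\mathbb{R}$ be absolutely continuous and bounded, and let $\epsilon=\epsilon(\theta_0)>0$ be as in (R3) with $(\theta_0-\epsilon,\theta_0+\epsilon)\subset\Theta$. Then $$\begin{aligned} &\left|\mathrm{E}\left[h\left(\sqrt{n\,i(\theta_0)}\left(\hat\theta_n(\boldsymbol{X})-\theta_0\right)\right)\right]-\mathrm{E}[h(Z)]\right|\\ &\le\frac{\|h'\|}{\sqrt n}\left(2+\frac{|k'(\theta_0)|^3\,\mathrm{E}\left[|T(X_1)-D(\theta_0)|^3\right]}{|A''(\theta_0)-k''(\theta_0)D(\theta_0)|^{3/2}}\right)\\ &\quad+\mathrm{E}\left[\left(\hat\theta_n(\boldsymbol{X})-\theta_0\right)^2\right]\left(2\frac{\|h\|}{\epsilon^2}\,\mathbf{1}\{\exists\,\theta\in\Theta:\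 D(\theta)\ne\theta\}+\frac{\|h'\|\sqrt n\,|k'(\theta_0)|}{2\sqrt{|A''(\theta_0)-k''(\theta_0)D(\theta_0)|}}\sup_{\theta:|\theta-\theta_0|\le\epsilon}|D''(\theta)|\right). \end{aligned}$$
   Context: Here $k$ and $A$ are functions of the parameter only and $T$ and $S$ are functions of the data only. It is understood that $k'(\theta)\ne0$ on $\Theta$ (regarded in the paper as a consequence of the identifiability condition (R1)). Notation. For data $\boldsymbol{x}=(x_1,\ldots,x_n)$, the log-likelihood is $l(\theta;\boldsymbol{x})=\sum_{i=1}^n\log f(x_i|\theta)$; $l',l''$ denote derivatives with respect to $\theta$. $\hat\theta_n(\boldsymbol{x})$ is the maximizer of $\theta\mapsto l(\theta;\boldsymbol{x})$ over $\Theta$ (the MLE). $i(\theta)=\mathrm{E}_\theta\left[\left(\frac{\mathrm{d}}{\mathrm{d}\theta}\log f(X_1|\theta)\right)^2\right]$ is the expected Fisher information of one observation. $\mathbb{X}$ denotes the support of $f(\cdot|\theta)$ (here $\mathbb{X}=B$). $\mathrm{E}$ is expectation under $\theta_0$. $\|\cdot\|$ is the (essential) supremum norm; $h'$ is the a.e. derivative of $h$. The right-hand side may be $+\infty$. Suprema over $\{\theta:|\theta-\theta_0|\le\epsilon\}$ are over $\theta\in\Theta$. $\mathbf{1}\{\cdot\}$ is the indicator (1 if the condition holds, 0 otherwise). Conditions on the log-likelihood (for every data vector $\boldsymbol{x}\in\mathbb{X}^n$): (A1) $l(\theta;\boldsymbol{x})$ is twice continuously differentiable in $\theta$, and $\theta$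 varies in the open interval $(a,b)$, $a,b\in\mathbb{R}\cup\{-\infty,\infty\}$, $a<b$; (A2) $\lim_{\theta\to a}l(\theta;\boldsymbol{x})=\lim_{\theta\to b}l(\theta;\boldsymbol{x})=-\infty$; (A3) $l''(\theta;\boldsymbol{x})<0$ at every $\theta\in(a,b)$ with $l'(\theta;\boldsymbol{x})=0$. Regularity conditions: (R1) the parameter is identifiable: if $\theta\ne\theta'$ then there is $x$ with $f(x|\theta)\ne f(x|\theta')$; (R2) $f(x|\theta)$ is three times differentiable in $\theta$, the third derivative is continuous in $\theta$, and $\int f(x|\theta)\,\mathrm{d}x$ (a sum in the discrete case) can be differentiated three times under the integral sign; (R3) for any $\theta_0\in\Theta$ there exist $\epsilon>0$ and a function $M(x)$ (both possibly depending on $\theta_0$) such that $\left|\frac{\mathrm{d}^3}{\mathrm{d}\theta^3}\log f(x|\theta)\right|\le M(x)$ for all $x\in\mathbb{X}$ and $\theta_0-\epsilon<\theta<\theta_0+\epsilon$, with $\mathrm{E}_{\theta_0}[M(X_1)]<\infty$; (R4) $i(\theta)>0$ for all $\theta\in\Theta$. *)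

theory Defs
  imports "HOL-Probability.Probability"
begin

section \<open>Real functions\<close>

text \<open>To be used for open \<open>U\<close>: \<open>g\<close> is \<open>m\<close> times continuously differentiable on \<open>U\<close>.\<close>

definition Ck_on :: "nat \<Rightarrow> real set \<Rightarrow> (real \<Rightarrow> real) \<Rightarrow> bool" where
  "Ck_on m U g \<longleftrightarrow>
     (\<forall>j<m. \<forall>t\<in>U. (deriv ^^ j) g field_differentiable (at t)) \<and>
     continuous_on U ((deriv ^^ m) g)"

definition abs_cont_on_Icc :: "real \<Rightarrow> real \<Rightarrow> (real \<Rightarrow> real) \<Rightarrow> bool" where
  "abs_cont_on_Icc u v h \<longleftrightarrow>
     (\<forall>e>0. \<exists>d>0. \<forall>I :: (real \<times> real) set.
        finite I \<and> (\<forall>(s, t)\<in>I. u \<le> s \<and> s \<le> t \<and> t \<le> v) \<and>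
        disjoint_family_on (\<lambda>(s, t). {s<..<t}) I \<and>
        (\<Sum>(s, t)\<in>I. t - s) < d
        \<longrightarrow> (\<Sum>(s, t)\<in>I. \<bar>h t - h s\<bar>) < e)"

text \<open>Absolute continuity on the real line is understood in the usual sense: absolute continuity
  on every compact interval.\<close>

definition abs_cont :: "(real \<Rightarrow> real) \<Rightarrow> bool" where
  "abs_cont h \<longleftrightarrow> (\<forall>u v. abs_cont_on_Icc u v h)"

text \<open>The essential supremum norm with respect to Lebesgue measure, possibly infinite. At the
  (negligibly many) points where \<open>h\<close> is not differentiable, \<open>deriv h\<close> has an unspecified value,
  which does not affect \<open>ess_norm (deriv h)\<close>. For continuous \<open>h\<close>, \<open>ess_norm h\<close> is the supremum
  of \<open>\<bar>h\<bar>\<close>.\<close>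

definition ess_norm :: "(real \<Rightarrow> real) \<Rightarrow> ennreal" where
  "ess_norm g = esssup lebesgue (\<lambda>x. ennreal \<bar>g x\<bar>)"

section \<open>Parametric families\<close>

text \<open>A parametric family is a function \<open>f\<close> such that \<open>f \<theta> x\<close> is the density at \<open>x\<close>, for the
  parameter \<open>\<theta>\<close>, with respect to a dominating measure \<open>\<mu>\<close>: Lebesgue measure for densities, and
  counting measure on a countable set of reals for mass functions.\<close>

definition dominating :: "real measure \<Rightarrow> bool" where
  "dominating \<mu> \<longleftrightarrow> \<mu> = lborel \<or> (\<exists>C. countable C \<and> \<mu> = count_space C)"

definition pdf_family :: "real measure \<Rightarrow> real set \<Rightarrow> (real \<Rightarrow> real \<Rightarrow> real) \<Rightarrow> bool" where
  "pdf_family \<mu> \<Theta> f \<longleftrightarrow>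
     (\<forall>\<theta>\<in>\<Theta>. f \<theta> \<in> borel_measurable \<mu> \<and> (\<forall>x. 0 \<le> f \<theta> x) \<and> (\<integral>\<^sup>+x. ennreal (f \<theta> x) \<partial>\<mu>) = 1)"

definition exp_family ::
  "(real \<Rightarrow> real) \<Rightarrow> (real \<Rightarrow> real) \<Rightarrow> (real \<Rightarrow> real) \<Rightarrow> (real \<Rightarrow> real) \<Rightarrow> real set \<Rightarrow> real \<Rightarrow> real \<Rightarrow> real"
where
  "exp_family k A T S B \<theta> x = exp (k \<theta> * T x - A \<theta> + S x) * indicator B x"

text \<open>A data vector \<open>(x\<^sub>1, \<dots>, x\<^sub>n)\<close> is represented by \<open>x 0, \<dots>, x (n - 1)\<close>. Observations outside the
  support, which occur with probability zero, contribute \<open>ln 0 = 0\<close>.\<close>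

definition loglik :: "(real \<Rightarrow> real \<Rightarrow> real) \<Rightarrow> nat \<Rightarrow> (nat \<Rightarrow> real) \<Rightarrow> real \<Rightarrow> real" where
  "loglik f n x \<theta> = (\<Sum>i<n. ln (f \<theta> (x i)))"

definition mle :: "(real \<Rightarrow> real \<Rightarrow> real) \<Rightarrow> real set \<Rightarrow> nat \<Rightarrow> (nat \<Rightarrow> real) \<Rightarrow> real" where
  "mle f \<Theta> n x = arg_max_on (loglik f n x) \<Theta>"

definition fisher_info :: "real measure \<Rightarrow> (real \<Rightarrow> real \<Rightarrow> real) \<Rightarrow> real \<Rightarrow> real" where
  "fisher_info \<mu> f \<theta> = (\<integral>x. (deriv (\<lambda>t. ln (f t x)) \<theta>)\<^sup>2 \<partial>density \<mu> (f \<theta>))"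

section \<open>Conditions on the log-likelihood\<close>

definition cond_A1 :: "(real \<Rightarrow> real \<Rightarrow> real) \<Rightarrow> real set \<Rightarrow> nat \<Rightarrow> ereal \<Rightarrow> ereal \<Rightarrow> bool" where
  "cond_A1 f B n a b \<longleftrightarrow> a < b \<and>
     (\<forall>x. (\<forall>i<n. x i \<in> B) \<longrightarrow> Ck_on 2 (einterval a b) (loglik f n x))"

definition cond_A2 :: "(real \<Rightarrow> real \<Rightarrow> real) \<Rightarrow> real set \<Rightarrow> nat \<Rightarrow> ereal \<Rightarrow> ereal \<Rightarrow> bool" where
  "cond_A2 f B n a b \<longleftrightarrow>
     (\<forall>x. (\<forall>i<n. x i \<in> B) \<longrightarrow>
        filterlim (\<lambda>\<theta>. loglik f n x (real_of_ereal \<theta>)) at_bot (at_right a) \<and>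
        filterlim (\<lambda>\<theta>. loglik f n x (real_of_ereal \<theta>)) at_bot (at_left b))"

definition cond_A3 :: "(real \<Rightarrow> real \<Rightarrow> real) \<Rightarrow> real set \<Rightarrow> nat \<Rightarrow> ereal \<Rightarrow> ereal \<Rightarrow> bool" where
  "cond_A3 f B n a b \<longleftrightarrow>
     (\<forall>x. (\<forall>i<n. x i \<in> B) \<longrightarrow>
        (\<forall>\<theta>\<in>einterval a b. deriv (loglik f n x) \<theta> = 0 \<longrightarrow> (deriv ^^ 2) (loglik f n x) \<theta> < 0))"

section \<open>Regularity conditions\<close>

definition cond_R1 :: "(real \<Rightarrow> real \<Rightarrow> real) \<Rightarrow> real set \<Rightarrow> bool" where
  "cond_R1 f \<Theta> \<longleftrightarrow> (\<forall>\<theta>\<in>\<Theta>. \<forall>\<theta>'\<in>\<Theta>. \<theta> \<noteq> \<theta>' \<longrightarrow> (\<exists>x. f \<theta> x \<noteq> f \<theta>' x))"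

definition cond_R2 :: "real measure \<Rightarrow> (real \<Rightarrow> real \<Rightarrow> real) \<Rightarrow> real set \<Rightarrow> bool" where
  "cond_R2 \<mu> f \<Theta> \<longleftrightarrow>
     (\<forall>x. Ck_on 3 \<Theta> (\<lambda>t. f t x)) \<and>
     (\<forall>j\<le>3. \<forall>\<theta>\<in>\<Theta>. integrable \<mu> (\<lambda>x. (deriv ^^ j) (\<lambda>t. f t x) \<theta>)) \<and>
     (\<forall>j<3. \<forall>\<theta>\<in>\<Theta>.
        ((\<lambda>s. \<integral>x. (deriv ^^ j) (\<lambda>t. f t x) s \<partial>\<mu>) has_field_derivative
         (\<integral>x. (deriv ^^ Suc j) (\<lambda>t. f t x) \<theta> \<partial>\<mu>)) (at \<theta>))"

text \<open>The bound on the third derivative at the parameter \<open>\<theta>\<^sub>0\<close>, for a given radius \<open>\<epsilon>\<close>.\<close>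

definition R3_radius ::
  "real measure \<Rightarrow> (real \<Rightarrow> real \<Rightarrow> real) \<Rightarrow> real set \<Rightarrow> real set \<Rightarrow> real \<Rightarrow> real \<Rightarrow> bool"
where
  "R3_radius \<mu> f B \<Theta> \<theta>\<^sub>0 \<epsilon> \<longleftrightarrow> \<epsilon> > 0 \<and>
     (\<exists>M :: real \<Rightarrow> real.
        (\<forall>x\<in>B. \<forall>\<theta>\<in>\<Theta>. \<theta>\<^sub>0 - \<epsilon> < \<theta> \<and> \<theta> < \<theta>\<^sub>0 + \<epsilon> \<longrightarrow> \<bar>(deriv ^^ 3) (\<lambda>t. ln (f t x)) \<theta>\<bar> \<le> M x) \<and>
        integrable (density \<mu> (f \<theta>\<^sub>0)) M)"

definition cond_R3 ::
  "real measure \<Rightarrow> (real \<Rightarrow> real \<Rightarrow> real) \<Rightarrow> real set \<Rightarrow> real set \<Rightarrow> bool"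
where
  "cond_R3 \<mu> f B \<Theta> \<longleftrightarrow> (\<forall>\<theta>\<in>\<Theta>. \<exists>\<epsilon>. R3_radius \<mu> f B \<Theta> \<theta> \<epsilon>)"

definition cond_R4 :: "real measure \<Rightarrow> (real \<Rightarrow> real \<Rightarrow> real) \<Rightarrow> real set \<Rightarrow> bool" where
  "cond_R4 \<mu> f \<Theta> \<longleftrightarrow> (\<forall>\<theta>\<in>\<Theta>. fisher_info \<mu> f \<theta> > 0)"

end

theory Submission
  imports Defs
begin

text \<open>For data \<open>x\<close> in the support the likelihood equation
\<open>k' \<theta> * (\<Sum>i<n. T (x i)) = n * A' \<theta>\<close> says that the maximum likelihood estimator satisfies
\<open>D \<theta>\<^sub>n = (\<Sum>i<n. T (x i)) / n\<close> for \<open>D = A' / k'\<close>: the estimator is the inverse of \<open>D\<close> applied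
to a sample mean, and the theorem is a quantitative delta method.
Differentiating \<open>\<integral> f = 1\<close> twice under the integral sign gives \<open>E T = D\<close> and
\<open>i = A'' - k'' D = k' D'\<close> for the Fisher information \<open>i\<close> (\<open>integral_T0_f\<close>, \<open>fisher_info_eq\<close>,
\<open>fisher_info_eq_D1\<close>). In particular \<open>D'\<close> has no zero, and
\<open>\<xi>\<^sub>i = k' \<theta>\<^sub>0 (T (X\<^sub>i) - D \<theta>\<^sub>0) / \<surd>i\<close> are independent and standardized.

With \<open>W = (\<Sum>i<n. \<xi>\<^sub>i) / \<surd>n\<close>, the left-hand side is at most the sum of two errors.
Expanding \<open>D\<close> to second order about \<open>\<theta>\<^sub>0\<close> shows that \<open>W\<close> differs from
\<open>\<surd>(n i) (\<theta>\<^sub>n - \<theta>\<^sub>0)\<close> by the quadratic remainder of \<open>D\<close> only. A Lipschitz bound for \<open>h\<close> where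
\<open>\<bar>\<theta>\<^sub>n - \<theta>\<^sub>0\<bar> \<le> \<epsilon>\<close>, and the trivial bound \<open>2 \<parallel>h\<parallel> (\<theta>\<^sub>n - \<theta>\<^sub>0)\<^sup>2 / \<epsilon>\<^sup>2\<close> elsewhere, turn this into the
summand with the mean squared error (\<open>linearization_error\<close>, \<open>linearized_mle_bound\<close>); if \<open>D\<close> is the
identity, there is no remainder at all.

The distance of \<open>W\<close> from the normal law is bounded by Stein's method (\<open>Stein_bound\<close>): \<open>h\<close> centred
is written as \<open>F' x - x F x\<close>, where \<open>F'\<close> has Lipschitz constant \<open>2 \<parallel>h'\<parallel>\<close> (\<open>Stein_solution\<close>), and
\<open>E (F' W - W F W)\<close> is estimated by removing one summand of \<open>W\<close> at a time. That constant comes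
from a comparison principle instead of explicit kernels: the map sending \<open>h\<close> to \<open>F\<close> and the map
sending \<open>h\<close> to \<open>(x F)'\<close> both take nondecreasing functions to nonpositive ones (\<open>Stein_operator_mono\<close>),
so it suffices to know them for \<open>h x = x\<close>.

Both estimates need \<open>h\<close> to be Lipschitz with constant \<open>\<parallel>h'\<parallel>\<close> (\<open>abs_cont_imp_lipschitz\<close>). At
points where \<open>h\<close> is not differentiable, \<open>deriv h\<close> carries no information, so this rests on
the almost everywhere differentiability of absolutely continuous functions, which is obtained
from Vitali's covering theorem.\<close>

section \<open>Absolute continuity and Vitali coverings by intervals\<close>

lemma abs_contD:
  assumes "abs_cont h" "e > 0"
  obtains d where "d > 0"
    "\<And>I. finite I \<Longrightarrow> (\<And>s t. (s, t) \<in> I \<Longrightarrow> u \<le> s \<and> s \<le> t \<and> t \<le> v) \<Longrightarrow>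
       disjoint_family_on (\<lambda>(s, t). {s<..<t}) I \<Longrightarrow> (\<Sum>(s, t)\<in>I. t - s) < d \<Longrightarrow>
       (\<Sum>(s, t)\<in>I. \<bar>h t - h s\<bar>) < e"
proof -
  have "abs_cont_on_Icc u v h" using assms(1) by (simp add: abs_cont_def)
  then obtain d where "d > 0" and d: "\<forall>I :: (real \<times> real) set.
        finite I \<and> (\<forall>(s, t)\<in>I. u \<le> s \<and> s \<le> t \<and> t \<le> v) \<and>
        disjoint_family_on (\<lambda>(s, t). {s<..<t}) I \<and>
        (\<Sum>(s, t)\<in>I. t - s) < d
        \<longrightarrow> (\<Sum>(s, t)\<in>I. \<bar>h t - h s\<bar>) < e"
    using assms(2) unfolding abs_cont_on_Icc_def by blast
  show thesis
    by (rule that[OF \<open>d > 0\<close>], rule d[rule_format]) auto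
qed

lemma abs_cont_imp_isCont:
  assumes "abs_cont h" shows "isCont h x"
proof -
  have "\<exists>d>0. \<forall>y. \<bar>y - x\<bar> < d \<longrightarrow> \<bar>h y - h x\<bar> < e" if "e > 0" for e
  proof -
    obtain d where "d > 0" and d: "\<And>I. finite I \<Longrightarrow>
       (\<And>s t. (s, t) \<in> I \<Longrightarrow> x - 1 \<le> s \<and> s \<le> t \<and> t \<le> x + 1) \<Longrightarrow>
       disjoint_family_on (\<lambda>(s, t). {s<..<t}) I \<Longrightarrow> (\<Sum>(s, t)\<in>I. t - s) < d \<Longrightarrow>
       (\<Sum>(s, t)\<in>I. \<bar>h t - h s\<bar>) < e"
      using abs_contD[OF assms \<open>e > 0\<close>] by blast
    have "\<bar>h y - h x\<bar> < e" if y: "\<bar>y - x\<bar> < min d 1" for y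
    proof -
      have "(\<Sum>(s, t)\<in>{(min x y, max x y)}. \<bar>h t - h s\<bar>) < e"
        using y by (intro d) (auto simp: disjoint_family_on_def)
      then show ?thesis by (cases "x \<le> y") (auto simp: min_def max_def)
    qed
    then show ?thesis using \<open>d > 0\<close> by (intro exI[of _ "min d 1"]) auto
  qed
  then show ?thesis by (auto simp: continuous_at_eps_delta dist_real_def)
qed

lemma abs_cont_uminus: "abs_cont h \<Longrightarrow> abs_cont (\<lambda>x. - h x)"
proof -
  have "\<bar>- a - - b\<bar> = \<bar>a - b\<bar>" for a b :: real by simp
  then show "abs_cont h \<Longrightarrow> abs_cont (\<lambda>x. - h x)" unfolding abs_cont_def abs_cont_on_Icc_def by simp
qed

text \<open>Intervals are represented by pairs of endpoints, as in the definition of absolute continuity.\<close>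

definition disjoint_intervals :: "(real \<times> real) set \<Rightarrow> bool" where
  "disjoint_intervals I \<longleftrightarrow> finite I \<and> (\<forall>(s, t)\<in>I. s < t) \<and> disjoint_family_on (\<lambda>(s, t). {s..t}) I"

lemma measure_disjoint_intervals:
  assumes "disjoint_intervals I"
  shows "measure lborel (\<Union>(s, t)\<in>I. {s..t}) = (\<Sum>(s, t)\<in>I. t - s)"
proof -
  have "measure lborel (\<Union>p\<in>I. (\<lambda>(s, t). {s..t}) p) = (\<Sum>p\<in>I. measure lborel ((\<lambda>(s, t). {s..t}) p))"
    using assms unfolding disjoint_intervals_def
    by (intro measure_finite_Union) (auto simp: split_beta')
  also have "\<dots> = (\<Sum>(s, t)\<in>I. t - s)"
    using assms by (intro sum.cong) (auto simp: disjoint_intervals_def)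
  finally show ?thesis by simp
qed

text \<open>Vitali's theorem covers almost all of \<open>E\<close> by countably many disjoint intervals of \<open>K\<close>; as \<open>E\<close> has
finite measure, finitely many of them cover it up to measure \<open>\<eta>\<close>. Finite families are what
absolute continuity speaks about.\<close>

lemma Vitali_finite:
  assumes E: "E \<in> sets lborel" "emeasure lborel E < \<infinity>" and "\<eta> > 0"
    and K: "\<And>s t. (s, t) \<in> K \<Longrightarrow> s < t"
    and fine: "\<And>x d. x \<in> E \<Longrightarrow> d > 0 \<Longrightarrow> \<exists>(s, t)\<in>K. s \<le> x \<and> x \<le> t \<and> t - s < d"
  obtains I where "I \<subseteq> K" "disjoint_intervals I" "measure lborel (E - (\<Union>(s, t)\<in>I. {s..t})) < \<eta>"
proof -
  define m where "m = (\<lambda>p :: real \<times> real. (fst p + snd p) / 2)"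
  define r where "r = (\<lambda>p :: real \<times> real. (snd p - fst p) / 2)"
  have cb: "cball (m p) (r p) = {fst p..snd p}" for p
    by (auto simp: m_def r_def cball_def dist_real_def abs_if field_simps split: if_splits)
  have pos: "0 < r p" if "p \<in> K" for p
    using K[of "fst p" "snd p"] that by (simp add: r_def)
  have cover: "\<exists>p. p \<in> K \<and> x \<in> cball (m p) (r p) \<and> r p < d" if xd: "x \<in> E" "d > 0" for x d
  proof -
    obtain s t where "(s, t) \<in> K" "s \<le> x" "x \<le> t" "t - s < d" using fine[OF xd] by auto
    then show ?thesis using K[of s t] unfolding cb by (intro exI[of _ "(s, t)"]) (auto simp: r_def field_simps)
  qed
  then obtain C where C: "countable C" "C \<subseteq> K"
     "pairwise (\<lambda>i j. disjnt (cball (m i) (r i)) (cball (m j) (r j))) C"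
     "negligible (E - (\<Union>i \<in> C. cball (m i) (r i)))"
    using Vitali_covering_theorem_cballs[of K r E m, OF pos cover] by blast
  define J where "J = (\<lambda>p :: real \<times> real. {fst p..snd p})"
  have null: "E - (\<Union>i\<in>C. J i) \<in> null_sets lborel"
  proof -
    have "E - (\<Union>i\<in>C. J i) \<in> sets lborel" using E C(1) by (auto simp: J_def intro!: sets.Diff sets.countable_UN')
    moreover have "E - (\<Union>i\<in>C. J i) \<in> null_sets lebesgue"
      using C(4) unfolding cb J_def negligible_iff_null_sets .
    ultimately show ?thesis by (simp add: null_sets_def)
  qed
  have dis: "disjoint_family_on J C"
    using C(3) unfolding cb disjoint_family_on_def pairwise_def disjnt_def J_def by blast
  define I where "I = (\<lambda>n. C \<inter> (to_nat_on C) -` {..<n})"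
  have fin: "finite (I n)" for n
  proof -
    have "inj_on (to_nat_on C) (I n)" using inj_on_to_nat_on[OF C(1)] by (rule inj_on_subset) (auto simp: I_def)
    moreover have "finite (to_nat_on C ` I n)" by (rule finite_subset[of _ "{..<n}"]) (auto simp: I_def)
    ultimately show ?thesis using finite_imageD by blast
  qed
  define A where "A = (\<lambda>n. E - (\<Union>i\<in>I n. J i))"
  have "(\<lambda>n. measure lborel (A n)) \<longlonglongrightarrow> measure lborel (\<Inter>n. A n)"
  proof (rule Lim_measure_decseq)
    show "range A \<subseteq> sets lborel" using E fin by (auto simp: A_def J_def intro!: sets.Diff sets.finite_UN)
    show "decseq A" by (intro decseq_SucI) (auto simp: A_def I_def)
    fix i have "emeasure lborel (A i) \<le> emeasure lborel E" using E by (intro emeasure_mono) (auto simp: A_def)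
    then show "emeasure lborel (A i) \<noteq> \<infinity>" using E by (auto simp: top_unique)
  qed
  moreover have "(\<Inter>n. A n) = E - (\<Union>i\<in>C. J i)" by (auto simp: A_def I_def) 
  ultimately have "(\<lambda>n. measure lborel (A n)) \<longlonglongrightarrow> 0" using null by (simp add: measure_def null_setsD1)
  then have "eventually (\<lambda>n. measure lborel (A n) < \<eta>) sequentially" using \<open>\<eta> > 0\<close> by (rule order_tendstoD)
  then obtain n where n: "measure lborel (A n) < \<eta>" by (auto simp: eventually_sequentially)
  show thesis
  proof
    show "I n \<subseteq> K" using C(2) by (auto simp: I_def)
    then show "disjoint_intervals (I n)"
      using fin K disjoint_family_on_mono[OF _ dis, of "I n"]
      unfolding disjoint_intervals_def by (auto simp: I_def J_def split_beta')
    show "measure lborel (E - (\<Union>(s, t)\<in>I n. {s..t})) < \<eta>"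
      using n by (simp add: A_def J_def split_beta')
  qed
qed

lemma disjoint_family_on_UnI:
  assumes "disjoint_family_on f A" "disjoint_family_on f B" "\<And>a b. a \<in> A \<Longrightarrow> b \<in> B \<Longrightarrow> f a \<inter> f b = {}"
  shows "disjoint_family_on f (A \<union> B)"
  using assms unfolding disjoint_family_on_def by (metis Un_iff Int_commute)

text \<open>The gaps left in an interval by finitely many disjoint subintervals are again finitely many
disjoint intervals, and increments are additive. Quantifying over \<open>\<phi>\<close> gives both the
total length of the gaps (\<open>\<phi> x = x\<close>) and the increments of a function from the same family.
The proof splits at one of the subintervals and recurses to its left and to its right.\<close>

lemma interval_gaps:
  assumes "disjoint_intervals J" "u \<le> v" "\<And>s t. (s, t) \<in> J \<Longrightarrow> u \<le> s \<and> t \<le> v"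
  shows "\<exists>G. finite G \<and> (\<forall>(s, t)\<in>G. u \<le> s \<and> s \<le> t \<and> t \<le> v) \<and>
    disjoint_family_on (\<lambda>(s, t). {s<..<t}) G \<and>
    (\<forall>\<phi> :: real \<Rightarrow> real. (\<Sum>(s, t)\<in>J. \<phi> t - \<phi> s) + (\<Sum>(s, t)\<in>G. \<phi> t - \<phi> s) = \<phi> v - \<phi> u)"
  using assms
proof (induction "card J" arbitrary: J u v rule: less_induct)
  case less
  note J = less.prems
  have fin: "finite J" and lt: "\<And>s t. (s, t) \<in> J \<Longrightarrow> s < t"
    and dis: "disjoint_family_on (\<lambda>(s, t). {s..t}) J" using J(1) by (auto simp: disjoint_intervals_def)
  show ?case
  proof (cases "J = {}")
    case True
    then show ?thesis using J by (intro exI[of _ "{(u, v)}"]) (auto simp: disjoint_family_on_def)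
  next
    case False
    then obtain s t where st: "(s, t) \<in> J" by auto
    define L where "L = {p\<in>J. snd p < s}"
    define R where "R = {p\<in>J. t < fst p}"
    have sub: "disjoint_intervals L" "disjoint_intervals R"
      using J(1) unfolding disjoint_intervals_def L_def R_def
      by (auto intro: disjoint_family_on_mono[OF _ dis])
    have eq: "J = insert (s, t) (L \<union> R)" 
    proof -
      have "p = (s, t) \<or> snd p < s \<or> t < fst p" if "p \<in> J" for p
      proof (rule ccontr)
        assume *: "\<not> ?thesis"
        obtain s' t' where p: "p = (s', t')" by (cases p)
        have "{s..t} \<inter> {s'..t'} = {}"
          using disjoint_family_onD[OF dis that st] * by (auto simp: p Int_commute)
        moreover have "max s s' \<in> {s..t} \<inter> {s'..t'}" using * lt[of s t] lt[of s' t'] that st p by auto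
        ultimately show False by blast
      qed
      then show ?thesis using st by (auto simp: L_def R_def)
    qed
    have nin: "(s, t) \<notin> L \<union> R" "L \<inter> R = {}"
      using lt[OF st] lt by (force simp: L_def R_def)+
    have "L \<subseteq> J" "R \<subseteq> J" by (auto simp: L_def R_def)
    then have "L \<subset> J" "R \<subset> J" using nin(1) st by blast+
    then have card: "card L < card J" "card R < card J"
      by (auto intro: psubset_card_mono[OF fin])
    have uv: "u \<le> s" "t \<le> v" using J(3)[OF st] by auto
    have "\<And>s' t'. (s', t') \<in> L \<Longrightarrow> u \<le> s' \<and> t' \<le> s" using J(3) by (auto simp: L_def)
    from less.hyps[OF card(1) sub(1) uv(1) this]
    obtain G1 where G1: "finite G1" "\<forall>(s', t')\<in>G1. u \<le> s' \<and> s' \<le> t' \<and> t' \<le> s"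
        "disjoint_family_on (\<lambda>(s, t). {s<..<t}) G1"
        "\<And>\<phi>. (\<Sum>(s, t)\<in>L. \<phi> t - \<phi> s) + (\<Sum>(s, t)\<in>G1. \<phi> t - \<phi> s) = \<phi> s - (\<phi> u :: real)"
      by blast
    have "\<And>s' t'. (s', t') \<in> R \<Longrightarrow> t \<le> s' \<and> t' \<le> v" using J(3) by (auto simp: R_def)
    from less.hyps[OF card(2) sub(2) uv(2) this]
    obtain G2 where G2: "finite G2" "\<forall>(s', t')\<in>G2. t \<le> s' \<and> s' \<le> t' \<and> t' \<le> v"
        "disjoint_family_on (\<lambda>(s, t). {s<..<t}) G2"
        "\<And>\<phi>. (\<Sum>(s, t)\<in>R. \<phi> t - \<phi> s) + (\<Sum>(s, t)\<in>G2. \<phi> t - \<phi> s) = \<phi> v - (\<phi> t :: real)"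
      by blast
    have "s < t" using lt[OF st] .
    have dG: "G1 \<inter> G2 = {}" using G1(2) G2(2) \<open>s < t\<close> by force
    show ?thesis
    proof (intro exI[of _ "G1 \<union> G2"] conjI allI)
      show "finite (G1 \<union> G2)" using G1 G2 by auto
      show "\<forall>(s, t)\<in>G1 \<union> G2. u \<le> s \<and> s \<le> t \<and> t \<le> v" using G1(2) G2(2) uv \<open>s < t\<close> by fastforce
      have cross: "{a<..<b} \<inter> {c<..<d} = {}" if "(a, b) \<in> G1" "(c, d) \<in> G2" for a b c d :: real
        using G1(2) G2(2) \<open>s < t\<close> that by fastforce
      show "disjoint_family_on (\<lambda>(s, t). {s<..<t}) (G1 \<union> G2)"
      proof (rule disjoint_family_on_UnI[OF G1(3) G2(3)])
        fix p p' assume "p \<in> G1" "p' \<in> G2"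
        then show "(case p of (s, t) \<Rightarrow> {s<..<t}) \<inter> (case p' of (s, t) \<Rightarrow> {s<..<t}) = {}"
          using cross[of "fst p" "snd p" "fst p'" "snd p'"] by (simp add: split_beta)
      qed
      fix \<phi> :: "real \<Rightarrow> real"
      have "finite L" "finite R" using fin by (auto simp: L_def R_def)
      then have "(\<Sum>(s, t)\<in>J. \<phi> t - \<phi> s) = \<phi> t - \<phi> s + (\<Sum>(s, t)\<in>L. \<phi> t - \<phi> s) + (\<Sum>(s, t)\<in>R. \<phi> t - \<phi> s)"
        unfolding eq using nin by (simp add: sum.union_disjoint)
      moreover have "(\<Sum>(s, t)\<in>G1 \<union> G2. \<phi> t - \<phi> s) = (\<Sum>(s, t)\<in>G1. \<phi> t - \<phi> s) + (\<Sum>(s, t)\<in>G2. \<phi> t - \<phi> s)"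
        using G1(1) G2(1) dG by (simp add: sum.union_disjoint)
      ultimately show "(\<Sum>(s, t)\<in>J. \<phi> t - \<phi> s) + (\<Sum>(s, t)\<in>G1 \<union> G2. \<phi> t - \<phi> s) = \<phi> v - \<phi> u"
        using G1(4)[of \<phi>] G2(4)[of \<phi>] by simp
    qed
  qed
qed

section \<open>Differentiability of absolutely continuous functions\<close>

definition slope :: "(real \<Rightarrow> real) \<Rightarrow> real \<Rightarrow> real \<Rightarrow> real" where
  "slope h x y = (h y - h x) / (y - x)"

lemma slope_uminus: "slope (\<lambda>x. - h x) x y = - slope h x y"
  unfolding slope_def by (metis minus_diff_eq minus_divide_left uminus_add_conv_diff diff_minus_eq_add)

text \<open>For a fixed endpoint and a fixed radius the condition is open in \<open>x\<close>, so the set is a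
countable intersection of open sets.\<close>

lemma borel_frequently_slope_less:
  assumes "\<And>x. isCont h x"
  shows "{x. \<exists>\<^sub>F y in at x. slope h x y < p} \<in> sets borel"
proof -
  have cont: "continuous_on UNIV h" using assms continuous_at_imp_continuous_on by blast
  define A where "A = (\<lambda>d. \<Union>y. {x. x < y \<and> y - x < d \<and> h y - h x < p * (y - x)} \<union>
                              {x. y < x \<and> x - y < d \<and> h x - h y < p * (x - y)})"
  have "open (A d)" for d
    unfolding A_def
    by (intro open_UN open_Un ballI open_Collect_conj open_Collect_less continuous_intros cont)
  moreover have A: "x \<in> A d \<longleftrightarrow> (\<exists>y. y \<noteq> x \<and> dist y x < d \<and> slope h x y < p)" for x d
  proof -
    have "(y \<noteq> x \<and> dist y x < d \<and> slope h x y < p) \<longleftrightarrow>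
       (x < y \<and> y - x < d \<and> h y - h x < p * (y - x)) \<or> (y < x \<and> x - y < d \<and> h x - h y < p * (x - y))" for y
      by (cases "x < y"; cases "y < x") (auto simp: slope_def dist_real_def divide_less_eq algebra_simps)
    then show ?thesis by (auto simp: A_def)
  qed
  moreover have "{x. \<exists>\<^sub>F y in at x. slope h x y < p} = (\<Inter>n. A (1 / real (Suc n)))"
  proof (intro set_eqI iffI)
    fix x assume "x \<in> (\<Inter>n. A (1 / real (Suc n)))"
    then have *: "x \<in> A (1 / real (Suc n))" for n by auto
    have "\<exists>y. y \<noteq> x \<and> dist y x < d \<and> slope h x y < p" if d: "d > 0" for d
    proof -
      obtain n where "1 / real (Suc n) < d" using nat_approx_posE[OF d] by auto
      then show ?thesis using *[of n] A less_trans by blast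
    qed
    then show "x \<in> {x. \<exists>\<^sub>F y in at x. slope h x y < p}" by (auto simp: frequently_at)
  next
    fix x assume "x \<in> {x. \<exists>\<^sub>F y in at x. slope h x y < p}"
    then show "x \<in> (\<Inter>n. A (1 / real (Suc n)))" unfolding INT_iff A by (auto simp: frequently_at)
  qed
  ultimately show ?thesis by (auto intro!: sets.countable_INT borel_open)
qed

lemma borel_frequently_slope_greater:
  assumes "\<And>x. isCont h x"
  shows "{x. \<exists>\<^sub>F y in at x. q < slope h x y} \<in> sets borel"
  using borel_frequently_slope_less[of "\<lambda>x. - h x" "- q"] assms by (simp add: slope_uminus)

lemma short_interval_slope_less:
  assumes "\<exists>\<^sub>F y in at x. slope h x y < p" "open U" "x \<in> U" "d > 0"
  obtains s t where "s < t" "s \<le> x" "x \<le> t" "t - s < d" "{s..t} \<subseteq> U" "h t - h s < p * (t - s)"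
proof -
  obtain e where e: "e > 0" "ball x e \<subseteq> U" using assms openE by blast
  then obtain y where y: "y \<noteq> x" "dist y x < min d e" "slope h x y < p"
    using assms(1,4) unfolding frequently_at by (metis min_less_iff_conj)
  have "{min x y..max x y} \<subseteq> ball x e" using y(2) by (auto simp: dist_real_def)
  then show thesis
    using that[of "min x y" "max x y"] y e
    by (cases "x < y") (auto simp: slope_def dist_real_def divide_less_eq algebra_simps)
qed

lemma short_interval_slope_greater:
  assumes "\<exists>\<^sub>F y in at x. q < slope h x y" "open U" "x \<in> U" "d > 0"
  obtains s t where "s < t" "s \<le> x" "x \<le> t" "t - s < d" "{s..t} \<subseteq> U" "q * (t - s) < h t - h s"
proof -
  have "\<exists>\<^sub>F y in at x. slope (\<lambda>x. - h x) x y < - q" using assms(1) by (simp add: slope_uminus)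
  then obtain s t where "s < t" "s \<le> x" "x \<le> t" "t - s < d" "{s..t} \<subseteq> U" "- h t - - h s < - q * (t - s)"
    using short_interval_slope_less[of "\<lambda>x. - h x" x "- q" U d] assms(2-4) by metis
  then show thesis using that[of s t] by auto
qed

lemma fmeasurable_lborel_bounded:
  fixes A :: "real set"
  assumes "bounded A" "A \<in> sets borel" shows "A \<in> fmeasurable lborel"
  using assms emeasure_bounded_finite[of A] by (intro fmeasurableI) auto

lemma measure_Union_intervals_le:
  assumes "disjoint_intervals I" "\<And>s t. (s, t) \<in> I \<Longrightarrow> {s..t} \<subseteq> U" "U \<in> fmeasurable lborel"
  shows "(\<Sum>(s, t)\<in>I. t - s) \<le> measure lborel U"
  unfolding measure_disjoint_intervals[OF assms(1), symmetric]
  using assms by (intro measure_mono_fmeasurable) (auto simp: disjoint_intervals_def intro!: sets.finite_UN)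

lemma fmeasurable_Union_intervals:
  assumes "disjoint_intervals I" shows "(\<Union>(s, t)\<in>I. {s..t}) \<in> fmeasurable lborel"
  using assms by (intro fmeasurable.finite_UN) (auto simp: disjoint_intervals_def fmeasurable_lborel_bounded)

text \<open>Let \<open>m > 0\<close> be the measure of the set. It is covered, up to small measure and with little
waste, by disjoint intervals \<open>I\<close> of slope below \<open>p\<close>, and inside these by disjoint intervals
\<open>J\<close> of slope above \<open>q\<close>. Both families have total length close to \<open>m\<close>, so the gaps between
them are short, and absolute continuity makes the increment of \<open>h\<close> over the gaps small. But that
increment is the difference of the increments over \<open>I\<close> and over \<open>J\<close>, which is at most about
\<open>p * m - q * m < 0\<close>, a contradiction.\<close>

lemma abs_cont_slopes_agree:
  assumes ac: "abs_cont h" and "p < q"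
  shows "{u<..<v} \<inter> {x. \<exists>\<^sub>F y in at x. slope h x y < p} \<inter> {x. \<exists>\<^sub>F y in at x. q < slope h x y} \<in> null_sets lborel"
    (is "?E \<in> _")
proof (rule ccontr)
  assume nonnull: "?E \<notin> null_sets lborel"
  define E where "E = ?E"
  define m where "m = measure lborel E"
  have E[measurable]: "E \<in> sets borel" unfolding E_def
    by (intro sets.Int borel_frequently_slope_less borel_frequently_slope_greater abs_cont_imp_isCont[OF ac]) auto
  have E': "E \<in> fmeasurable lborel"
    by (rule fmeasurable_lborel_bounded[OF _ E]) (auto simp: E_def intro: bounded_subset[of "{u<..<v}"])
  then have fE: "emeasure lborel E < \<infinity>" by (simp add: fmeasurable_def)
  have "emeasure lborel E \<noteq> 0" using nonnull by (simp add: null_sets_def E_def[symmetric])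
  then have m: "m > 0" unfolding m_def using emeasure_eq_measure2[OF E'] by (auto simp: zero_less_measure_iff)
  \<comment> \<open>The two increments differ by at least about \<open>(q - p) * m\<close>; a quarter of it is allowed for the gaps.\<close>
  define e where "e = (q - p) * m / 4"
  have "e > 0" using m \<open>p < q\<close> by (simp add: e_def)
  obtain d where "d > 0" and d: "\<And>I. finite I \<Longrightarrow> (\<And>s t. (s, t) \<in> I \<Longrightarrow> u \<le> s \<and> s \<le> t \<and> t \<le> v) \<Longrightarrow>
       disjoint_family_on (\<lambda>(s, t). {s<..<t}) I \<Longrightarrow> (\<Sum>(s, t)\<in>I. t - s) < d \<Longrightarrow>
       (\<Sum>(s, t)\<in>I. \<bar>h t - h s\<bar>) < e"
    using abs_contD[OF ac \<open>e > 0\<close>] by blast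
  \<comment> \<open>The gaps have total length below \<open>3 * \<epsilon>\<close>, which must be less than \<open>d\<close>; the other two bounds
absorb the discrepancy between the lengths of \<open>I\<close>, \<open>J\<close> and \<open>m\<close>.\<close>
  define \<epsilon> where "\<epsilon> = min (d / 4) (min (m / 8) ((q - p) * m / (12 * (\<bar>p\<bar> + 1))))"
  have "\<epsilon> \<le> d / 4" "\<epsilon> \<le> m / 8" "\<epsilon> \<le> (q - p) * m / (12 * (\<bar>p\<bar> + 1))" unfolding \<epsilon>_def by linarith+
  moreover have "\<epsilon> > 0" unfolding \<epsilon>_def using \<open>d > 0\<close> m \<open>p < q\<close>
    by (intro min_less_iff_conj[THEN iffD2] conjI divide_pos_pos mult_pos_pos) auto
  ultimately have \<epsilon>: "\<epsilon> > 0" "3 * \<epsilon> < d" "\<epsilon> \<le> m / 8" "\<epsilon> \<le> (q - p) * m / (12 * (\<bar>p\<bar> + 1))" by linarith+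
  then have \<epsilon>4: "3 * \<epsilon> * \<bar>p\<bar> \<le> (q - p) * m / 4"
  proof -
    have "\<epsilon> * (12 * (\<bar>p\<bar> + 1)) \<le> (q - p) * m" using \<epsilon>(4) by (simp add: pos_le_divide_eq)
    then show ?thesis using \<epsilon>(1) by (simp add: algebra_simps)
  qed
  obtain U where U: "open U" "E \<subseteq> U" "U \<subseteq> {u<..<v}" "measure lborel U < m + \<epsilon>"
  proof -
    obtain U where U: "open U" "E \<subseteq> U" "emeasure lborel (U - E) < ennreal \<epsilon>"
      using outer_regular_lborel[OF E \<epsilon>(1)] by blast
    define V where "V = U \<inter> {u<..<v}"
    have fV: "V - E \<in> fmeasurable lborel" 
      by (rule fmeasurable_lborel_bounded) (use U(1) in \<open>auto simp: V_def intro: bounded_subset[of "{u<..<v}"]\<close>)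
    have "emeasure lborel (V - E) \<le> emeasure lborel (U - E)" 
      using U(1) by (intro emeasure_mono) (auto simp: V_def)
    then have "emeasure lborel (V - E) < ennreal \<epsilon>" using U(3) by (rule le_less_trans)
    then have "measure lborel (V - E) < \<epsilon>" using fV \<epsilon>(1)
      by (simp add: emeasure_eq_measure2 ennreal_less_iff)
    moreover have "measure lborel V \<le> measure lborel (V - E) + m"
    proof -
      have "V = (V - E) \<union> E" using U(2) by (auto simp: V_def E_def)
      then show ?thesis using measure_Un_le[of "V - E" lborel E] fV E unfolding m_def by auto
    qed
    ultimately show thesis using U by (intro that[of V]) (auto simp: V_def E_def)
  qed
  have fU: "U \<in> fmeasurable lborel"
    by (rule fmeasurable_lborel_bounded) (use U in \<open>auto intro: bounded_subset[of "{u<..<v}"]\<close>)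
  define K1 where "K1 = {(s, t). s < t \<and> {s..t} \<subseteq> U \<and> h t - h s < p * (t - s)}"
  have coverK1: "\<exists>(s, t)\<in>K1. s \<le> x \<and> x \<le> t \<and> t - s < \<delta>" if "x \<in> E" "\<delta> > 0" for x \<delta>
  proof -
    have "\<exists>\<^sub>F y in at x. slope h x y < p" "x \<in> U" using \<open>x \<in> E\<close> U(2) by (auto simp: E_def)
    from short_interval_slope_less[OF this(1) U(1) this(2) \<open>\<delta> > 0\<close>]
    obtain s t where st: "s < t" "s \<le> x" "x \<le> t" "t - s < \<delta>" "{s..t} \<subseteq> U" "h t - h s < p * (t - s)"
      by blast
    then have "(s, t) \<in> K1" by (simp add: K1_def)
    then show ?thesis using st by blast
  qed
  have "E \<in> sets lborel" "\<And>s t. (s, t) \<in> K1 \<Longrightarrow> s < t" using E by (auto simp: K1_def)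
  from Vitali_finite[OF this(1) fE \<epsilon>(1) this(2) coverK1]
  obtain I where I: "I \<subseteq> K1" "disjoint_intervals I"
      "measure lborel (E - (\<Union>(s, t)\<in>I. {s..t})) < \<epsilon>" by blast
  have finI: "finite I" and disI: "disjoint_family_on (\<lambda>(s, t). {s..t}) I" 
    and ltI: "\<And>s t. (s, t) \<in> I \<Longrightarrow> s < t" 
    and IU: "\<And>s t. (s, t) \<in> I \<Longrightarrow> {s..t} \<subseteq> U"
    and slopeI: "\<And>s t. (s, t) \<in> I \<Longrightarrow> h t - h s < p * (t - s)"
    using I(1,2) by (auto simp: disjoint_intervals_def K1_def)
  define V where "V = (\<Union>(s, t)\<in>I. {s<..<t})"
  have V: "open V" by (auto simp: V_def)
  have EV: "measure lborel (E - V) < \<epsilon>"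
  proof -
    define N where "N = fst ` I \<union> snd ` I"
    have N: "N \<in> null_sets lborel" using finI by (auto simp: N_def intro: finite_imp_null_set_lborel)
    have "E - V \<subseteq> (E - (\<Union>(s, t)\<in>I. {s..t})) \<union> N"
      by (force simp: V_def N_def)
    then have "measure lborel (E - V) \<le> measure lborel ((E - (\<Union>(s, t)\<in>I. {s..t})) \<union> N)"
      using V N E' fmeasurable_Union_intervals[OF I(2)]
      by (intro measure_mono_fmeasurable fmeasurable.Un fmeasurable.Diff) (auto simp: fmeasurable_def)
    also have "\<dots> = measure lborel (E - (\<Union>(s, t)\<in>I. {s..t}))"
      using N E fmeasurable_Union_intervals[OF I(2)] by (intro measure_Un_null_set) (auto simp: fmeasurable_def)
    finally show ?thesis using I(3) by simp
  qed
  define K2 where "K2 = {(s, t). s < t \<and> (\<exists>(a, b)\<in>I. a < s \<and> t < b) \<and> q * (t - s) < h t - h s}"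
  have coverK2: "\<exists>(s, t)\<in>K2. s \<le> x \<and> x \<le> t \<and> t - s < \<delta>" if x: "x \<in> E \<inter> V" "\<delta> > 0" for x \<delta>
  proof -
    have "\<exists>\<^sub>F y in at x. q < slope h x y" using x by (auto simp: E_def)
    moreover obtain a b where ab: "(a, b) \<in> I" "x \<in> {a<..<b}" using x by (auto simp: V_def)
    ultimately obtain s t where st: "s < t" "s \<le> x" "x \<le> t" "t - s < \<delta>" "{s..t} \<subseteq> {a<..<b}" "q * (t - s) < h t - h s"
      using short_interval_slope_greater[of q h x "{a<..<b}" \<delta>] x(2) by auto
    then have "s \<in> {a<..<b}" "t \<in> {a<..<b}" by (meson atLeastAtMost_iff less_imp_le order_refl subsetD)+
    then have "a < s \<and> t < b" by auto
    then have "(s, t) \<in> K2" using ab(1) st unfolding K2_def by blast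
    then show ?thesis using st by blast
  qed
  have "E \<inter> V \<in> sets lborel" using E V by simp
  moreover have "emeasure lborel (E \<inter> V) < \<infinity>" 
    using emeasure_mono[of "E \<inter> V" E lborel] fE E by (auto intro: le_less_trans)
  moreover have "\<And>s t. (s, t) \<in> K2 \<Longrightarrow> s < t" by (auto simp: K2_def)
  ultimately obtain J where J: "J \<subseteq> K2" "disjoint_intervals J"
      "measure lborel (E \<inter> V - (\<Union>(s, t)\<in>J. {s..t})) < \<epsilon>"
    using Vitali_finite[OF _ _ \<epsilon>(1) _ coverK2] by blast
  have finJ: "finite J" and disJ: "disjoint_family_on (\<lambda>(s, t). {s..t}) J" 
    and ltJ: "\<And>s t. (s, t) \<in> J \<Longrightarrow> s < t" 
    and JI: "\<And>s t. (s, t) \<in> J \<Longrightarrow> \<exists>(a, b)\<in>I. a < s \<and> t < b"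
    and slopeJ: "\<And>s t. (s, t) \<in> J \<Longrightarrow> q * (t - s) < h t - h s"
    using J(1,2) by (auto simp: disjoint_intervals_def K2_def)
  define lI where "lI = (\<Sum>(s, t)\<in>I. t - s)"
  define lJ where "lJ = (\<Sum>(s, t)\<in>J. t - s)"
  have lI: "lI < m + \<epsilon>" using measure_Union_intervals_le[OF I(2) IU fU] U(4) by (simp add: lI_def)
  have lJ: "m - 2 * \<epsilon> < lJ"
  proof -
    have "m \<le> measure lborel ((E - V) \<union> (E \<inter> V - (\<Union>(s, t)\<in>J. {s..t})) \<union> (\<Union>(s, t)\<in>J. {s..t}))"
      unfolding m_def using V E E' fmeasurable_Union_intervals[OF J(2)]
      by (intro measure_mono_fmeasurable fmeasurable.Un fmeasurable_Diff fmeasurable_Int_fmeasurable) auto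
    also have "\<dots> \<le> measure lborel ((E - V) \<union> (E \<inter> V - (\<Union>(s, t)\<in>J. {s..t}))) + measure lborel (\<Union>(s, t)\<in>J. {s..t})"
      using V E fmeasurable_Union_intervals[OF J(2)] by (intro measure_Un_le) (auto simp: fmeasurable_def)
    also have "measure lborel ((E - V) \<union> (E \<inter> V - (\<Union>(s, t)\<in>J. {s..t}))) \<le> measure lborel (E - V) + measure lborel (E \<inter> V - (\<Union>(s, t)\<in>J. {s..t}))"
      using V E fmeasurable_Union_intervals[OF J(2)] by (intro measure_Un_le) (auto simp: fmeasurable_def)
    finally show ?thesis using EV J(3) unfolding lJ_def measure_disjoint_intervals[OF J(2)] by simp
  qed
  define JJ where "JJ = (\<lambda>(a, b). {(s, t)\<in>J. a < s \<and> t < b})"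
  have gaps: "\<exists>G. finite G \<and> (\<forall>(s, t)\<in>G. fst i \<le> s \<and> s \<le> t \<and> t \<le> snd i) \<and>
    disjoint_family_on (\<lambda>(s, t). {s<..<t}) G \<and>
    (\<forall>\<phi> :: real \<Rightarrow> real. (\<Sum>(s, t)\<in>JJ i. \<phi> t - \<phi> s) + (\<Sum>(s, t)\<in>G. \<phi> t - \<phi> s) = \<phi> (snd i) - \<phi> (fst i))"
    if "i \<in> I" for i
  proof (rule interval_gaps)
    have "JJ i \<subseteq> J" by (auto simp: JJ_def split: prod.splits)
    then show "disjoint_intervals (JJ i)" using J(2) finite_subset[of "JJ i" J] disjoint_family_on_mono[OF _ disJ]
      unfolding disjoint_intervals_def by blast
    show "fst i \<le> snd i" using ltI[of "fst i" "snd i"] that by simp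
  qed (auto simp: JJ_def split: prod.splits)
  define P where "P = (\<lambda>i G. finite G \<and> (\<forall>(s, t)\<in>G. fst i \<le> s \<and> s \<le> t \<and> t \<le> snd i) \<and>
    disjoint_family_on (\<lambda>(s, t). {s<..<t}) G \<and>
    (\<forall>\<phi> :: real \<Rightarrow> real. (\<Sum>(s, t)\<in>JJ i. \<phi> t - \<phi> s) + (\<Sum>(s, t)\<in>G. \<phi> t - \<phi> s) = \<phi> (snd i) - \<phi> (fst i)))"
  have "\<forall>i\<in>I. \<exists>G. P i G" unfolding P_def using gaps by blast
  from bchoice[OF this] obtain G where PG: "\<And>i. i \<in> I \<Longrightarrow> P i (G i)" by blast
  have finG: "\<And>i. i \<in> I \<Longrightarrow> finite (G i)"
    and G: "\<And>i s t. i \<in> I \<Longrightarrow> (s, t) \<in> G i \<Longrightarrow> fst i \<le> s \<and> s \<le> t \<and> t \<le> snd i"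
    and disG: "\<And>i. i \<in> I \<Longrightarrow> disjoint_family_on (\<lambda>(s, t). {s<..<t}) (G i)"
    and sumG: "\<And>i \<phi>. i \<in> I \<Longrightarrow> (\<Sum>(s, t)\<in>JJ i. \<phi> t - \<phi> s) + (\<Sum>(s, t)\<in>G i. \<phi> t - \<phi> s) = \<phi> (snd i) - (\<phi> (fst i) :: real)"
    using PG unfolding P_def by blast+
  have disI': "{fst i..snd i} \<inter> {fst j..snd j} = {}" if "i \<in> I" "j \<in> I" "i \<noteq> j" for i j
    using disjoint_family_onD[OF disI that] by (simp add: split_beta)
  define R where "R = (\<Union>i\<in>I. G i)"
  have total: "(\<Sum>(s, t)\<in>J. \<phi> t - \<phi> s) + (\<Sum>(s, t)\<in>R. \<phi> t - \<phi> s) = (\<Sum>(a, b)\<in>I. \<phi> b - \<phi> a)" for \<phi> :: "real \<Rightarrow> real"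
  proof -
    have Jeq: "J = (\<Union>i\<in>I. JJ i)" using JI by (fastforce simp: JJ_def)
    have disJJ: "JJ i \<inter> JJ j = {}" if "i \<in> I" "j \<in> I" "i \<noteq> j" for i j
    proof -
      have "s \<in> {fst i..snd i} \<inter> {fst j..snd j}" if "(s, t) \<in> JJ i" "(s, t) \<in> JJ j" for s t
        using that ltJ[of s t] by (auto simp: JJ_def split: prod.splits)
      then show ?thesis using disI'[OF that] by fast
    qed
    have "\<forall>i\<in>I. finite (JJ i)" using finJ by (auto simp: Jeq intro: finite_subset[rotated])
    then have "(\<Sum>p\<in>(\<Union>i\<in>I. JJ i). (case p of (s, t) \<Rightarrow> \<phi> t - \<phi> s)) = (\<Sum>i\<in>I. \<Sum>(s, t)\<in>JJ i. \<phi> t - \<phi> s)"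
      using finI disJJ by (intro sum.UNION_disjoint) auto
    then have 1: "(\<Sum>(s, t)\<in>J. \<phi> t - \<phi> s) = (\<Sum>i\<in>I. \<Sum>(s, t)\<in>JJ i. \<phi> t - \<phi> s)"
      unfolding Jeq .
    have "G i \<inter> G j = {}" if "i \<in> I" "j \<in> I" "i \<noteq> j" for i j
    proof -
      have "s \<in> {fst i..snd i} \<inter> {fst j..snd j}" if "(s, t) \<in> G i" "(s, t) \<in> G j" for s t
        using that G \<open>i \<in> I\<close> \<open>j \<in> I\<close> by fastforce
      then show ?thesis using disI'[OF that] by fast
    qed
    then have 2: "(\<Sum>(s, t)\<in>R. \<phi> t - \<phi> s) = (\<Sum>i\<in>I. \<Sum>(s, t)\<in>G i. \<phi> t - \<phi> s)"
      unfolding R_def using finI finG by (intro sum.UNION_disjoint) auto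
    have "(\<Sum>(a, b)\<in>I. \<phi> b - \<phi> a) = (\<Sum>i\<in>I. \<phi> (snd i) - \<phi> (fst i))" by (simp add: split_beta)
    also have "\<dots> = (\<Sum>i\<in>I. (\<Sum>(s, t)\<in>JJ i. \<phi> t - \<phi> s) + (\<Sum>(s, t)\<in>G i. \<phi> t - \<phi> s))"
      by (intro sum.cong sumG[symmetric]) auto
    finally show ?thesis by (simp add: 1 2 sum.distrib)
  qed
  have "(\<Sum>(s, t)\<in>R. \<bar>h t - h s\<bar>) < e"
  proof (rule d)
    show "finite R" using finI finG by (auto simp: R_def)
    fix s t assume "(s, t) \<in> R"
    then obtain i where "i \<in> I" "(s, t) \<in> G i" by (auto simp: R_def)
    moreover have "fst i \<in> {u<..<v}" "snd i \<in> {u<..<v}"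
      using IU[of "fst i" "snd i"] U(3) ltI[of "fst i" "snd i"] \<open>i \<in> I\<close> by (auto simp: subset_eq)
    ultimately show "u \<le> s \<and> s \<le> t \<and> t \<le> v" using G[of i s t] by auto
  next
    show "disjoint_family_on (\<lambda>(s, t). {s<..<t}) R"
      unfolding disjoint_family_on_def
    proof (intro ballI impI)
      fix g g' assume g: "g \<in> R" "g' \<in> R" "g \<noteq> g'"
      then obtain i j where ij: "i \<in> I" "g \<in> G i" "j \<in> I" "g' \<in> G j" by (auto simp: R_def)
      show "(case g of (s, t) \<Rightarrow> {s<..<t}) \<inter> (case g' of (s, t) \<Rightarrow> {s<..<t}) = {}"
      proof (cases "i = j")
        case True
        then show ?thesis using disjoint_family_onD[OF disG] ij g by blast
      next
        case False
        have "(case g of (s, t) \<Rightarrow> {s<..<t}) \<subseteq> {fst i..snd i}" using G[OF ij(1), of "fst g" "snd g"] ij(2) by (auto split: prod.splits)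
        moreover have "(case g' of (s, t) \<Rightarrow> {s<..<t}) \<subseteq> {fst j..snd j}" using G[OF ij(3), of "fst g'" "snd g'"] ij(4) by (auto split: prod.splits)
        ultimately show ?thesis using disI'[OF ij(1,3) False] by blast
      qed
    qed
  next
    have "(\<Sum>(s, t)\<in>R. t - s) = lI - lJ" using total[of "\<lambda>x. x"] by (simp add: lI_def lJ_def)
    then show "(\<Sum>(s, t)\<in>R. t - s) < d" using lI lJ \<epsilon> by simp
  qed
  moreover have "\<bar>\<Sum>(s, t)\<in>R. h t - h s\<bar> \<le> (\<Sum>(s, t)\<in>R. \<bar>h t - h s\<bar>)"
    by (rule order_trans[OF sum_abs]) (simp add: split_beta)
  moreover have "(\<Sum>(s, t)\<in>I. h t - h s) \<le> p * lI"
    unfolding lI_def sum_distrib_left using slopeI by (intro sum_mono) (force intro: less_imp_le)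
  moreover have "q * lJ \<le> (\<Sum>(s, t)\<in>J. h t - h s)"
    unfolding lJ_def sum_distrib_left using slopeJ by (intro sum_mono) (force intro: less_imp_le)
  ultimately have "q * lJ < p * lI + e" using total[of h] by linarith
  then have "(q - p) * lJ < p * (lI - lJ) + e" by (simp add: algebra_simps)
  moreover have "p * (lI - lJ) \<le> \<bar>p\<bar> * (3 * \<epsilon>)"
  proof -
    have "0 \<le> (\<Sum>(s, t)\<in>R. t - s)"
    proof (intro sum_nonneg)
      fix g assume "g \<in> R"
      then obtain i where "i \<in> I" "(fst g, snd g) \<in> G i" by (auto simp: R_def)
      then show "0 \<le> (case g of (s, t) \<Rightarrow> t - s)" using G[of i "fst g" "snd g"] by (simp add: split_beta)
    qed
    then have "0 \<le> lI - lJ" using total[of "\<lambda>x. x"] by (simp add: lI_def lJ_def)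
    moreover have "lI - lJ \<le> 3 * \<epsilon>" using lI lJ by simp
    ultimately show ?thesis by (intro mult_mono) auto
  qed
  moreover have "(q - p) * (m * 3 / 4) \<le> (q - p) * lJ" using lJ \<epsilon>(3) \<open>p < q\<close> by (intro mult_left_mono) auto
  moreover have "(q - p) * (m * 3 / 4) = (q - p) * m * (3 / 4)" by simp
  moreover have "(q - p) * m > 0" using m \<open>p < q\<close> by simp
  moreover have "\<bar>p\<bar> * (3 * \<epsilon>) \<le> (q - p) * m / 4" using \<epsilon>4 by (simp add: mult.commute mult.left_commute)
  ultimately show False unfolding e_def by linarith
qed

text \<open>Adding weights one by one, the first total that reaches \<open>c\<close> exceeds it by at most one weight.\<close>

lemma sum_subset_between:
  fixes w :: "'a \<Rightarrow> real"
  assumes "0 \<le> c" "finite I" "\<And>i. i \<in> I \<Longrightarrow> w i \<le> c" "c \<le> sum w I"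
  shows "\<exists>J\<subseteq>I. c \<le> sum w J \<and> sum w J \<le> 2 * c"
  using assms(2-)
proof (induction I rule: finite_induct)
  case empty
  then show ?case using assms(1) by (intro exI[of _ "{}"]) auto
next
  case (insert i I)
  show ?case
  proof (cases "c \<le> sum w I")
    case True
    then obtain J where "J \<subseteq> I" "c \<le> sum w J" "sum w J \<le> 2 * c" using insert by blast
    then show ?thesis by (intro exI[of _ J]) auto
  next
    case False
    then have "sum w (insert i I) \<le> 2 * c" using insert.prems(1)[of i] insert.hyps by simp
    then show ?thesis using insert.prems(2) by blast
  qed
qed

text \<open>On a set of positive measure with infinite upper slopes there would be disjoint intervals of
arbitrarily large slope \<open>k\<close> whose total length lies between fixed bounds \<open>w\<close> and \<open>2 * w\<close>. As
\<open>2 * w\<close> is within the tolerance of absolute continuity, the increment over them is less than 1,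
although it is at least \<open>k * w\<close>.\<close>

lemma abs_cont_slopes_bounded:
  assumes ac: "abs_cont h"
  shows "{u<..<v} \<inter> {x. \<forall>k::nat. \<exists>\<^sub>F y in at x. real k < slope h x y} \<in> null_sets lborel" (is "?E \<in> _")
proof (rule ccontr)
  assume nonnull: "?E \<notin> null_sets lborel"
  define E where "E = ?E"
  define m where "m = measure lborel E"
  have "{x. \<forall>k::nat. \<exists>\<^sub>F y in at x. real k < slope h x y} = (\<Inter>k::nat. {x. \<exists>\<^sub>F y in at x. real k < slope h x y})"
    by auto
  then have E[measurable]: "E \<in> sets borel" unfolding E_def
    by (auto intro!: sets.Int sets.countable_INT borel_frequently_slope_greater abs_cont_imp_isCont[OF ac])
  have E': "E \<in> fmeasurable lborel"
    by (rule fmeasurable_lborel_bounded[OF _ E]) (auto simp: E_def intro: bounded_subset[of "{u<..<v}"])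
  then have fE: "emeasure lborel E < \<infinity>" by (simp add: fmeasurable_def)
  have "emeasure lborel E \<noteq> 0" using nonnull E by (simp add: null_sets_def E_def[symmetric])
  then have m: "m > 0" unfolding m_def using emeasure_eq_measure2[OF E'] by (auto simp: zero_less_measure_iff)
  obtain d where "d > 0" and d: "\<And>I. finite I \<Longrightarrow> (\<And>s t. (s, t) \<in> I \<Longrightarrow> u \<le> s \<and> s \<le> t \<and> t \<le> v) \<Longrightarrow>
       disjoint_family_on (\<lambda>(s, t). {s<..<t}) I \<Longrightarrow> (\<Sum>(s, t)\<in>I. t - s) < d \<Longrightarrow>
       (\<Sum>(s, t)\<in>I. \<bar>h t - h s\<bar>) < 1"
    using abs_contD[OF ac zero_less_one] by blast
  define w where "w = min (d / 3) (m / 2)"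
  have w: "w > 0" "2 * w < d" "w \<le> m / 2" using \<open>d > 0\<close> m by (auto simp: w_def min_def)
  obtain k :: nat where k: "1 / w \<le> real k" using real_arch_simple by blast
  define K where "K = {(s, t). s < t \<and> {s..t} \<subseteq> {u<..<v} \<and> t - s < w \<and> real k * (t - s) < h t - h s}"
  have cover: "\<exists>(s, t)\<in>K. s \<le> x \<and> x \<le> t \<and> t - s < \<delta>" if "x \<in> E" "\<delta> > 0" for x \<delta>
  proof -
    have "\<exists>\<^sub>F y in at x. real k < slope h x y" "x \<in> {u<..<v}" "min \<delta> w > 0" using that w by (auto simp: E_def)
    from short_interval_slope_greater[OF this(1) open_greaterThanLessThan this(2,3)]
    obtain s t where st: "s < t" "s \<le> x" "x \<le> t" "t - s < min \<delta> w" "{s..t} \<subseteq> {u<..<v}" "real k * (t - s) < h t - h s"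
      by blast
    then have "(s, t) \<in> K" by (simp add: K_def)
    then show ?thesis using st by auto
  qed
  have "E \<in> sets lborel" "\<And>s t. (s, t) \<in> K \<Longrightarrow> s < t" "m / 2 > 0" using E m by (auto simp: K_def)
  from Vitali_finite[OF this(1) fE this(3) this(2) cover]
  obtain I where I: "I \<subseteq> K" "disjoint_intervals I" "measure lborel (E - (\<Union>(s, t)\<in>I. {s..t})) < m / 2" by blast
  have "m \<le> measure lborel ((E - (\<Union>(s, t)\<in>I. {s..t})) \<union> (\<Union>(s, t)\<in>I. {s..t}))"
    unfolding m_def using E E' fmeasurable_Union_intervals[OF I(2)]
    by (intro measure_mono_fmeasurable fmeasurable.Un fmeasurable_Diff) auto
  also have "\<dots> \<le> measure lborel (E - (\<Union>(s, t)\<in>I. {s..t})) + measure lborel (\<Union>(s, t)\<in>I. {s..t})"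
    using E fmeasurable_Union_intervals[OF I(2)] by (intro measure_Un_le) (auto simp: fmeasurable_def)
  finally have "m / 2 \<le> (\<Sum>(s, t)\<in>I. t - s)" using I(3) unfolding measure_disjoint_intervals[OF I(2)] by simp
  then have "w \<le> (\<Sum>(s, t)\<in>I. t - s)" using w by simp
  moreover have "(case i of (s, t) \<Rightarrow> t - s) \<le> w" if "i \<in> I" for i using that I(1) by (auto simp: K_def)
  moreover have "finite I" using I(2) by (simp add: disjoint_intervals_def)
  ultimately obtain J where J: "J \<subseteq> I" "w \<le> (\<Sum>(s, t)\<in>J. t - s)" "(\<Sum>(s, t)\<in>J. t - s) \<le> 2 * w"
    using sum_subset_between[of w I "\<lambda>(s, t). t - s"] w(1) by (meson less_imp_le)
  have JK: "s < t \<and> {s..t} \<subseteq> {u<..<v} \<and> real k * (t - s) < h t - h s" if "(s, t) \<in> J" for s t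
    using that J(1) I(1) by (auto simp: K_def)
  have "(\<Sum>(s, t)\<in>J. \<bar>h t - h s\<bar>) < 1"
  proof (rule d)
    show "finite J" using J(1) \<open>finite I\<close> finite_subset by blast
    have "disjoint_family_on (\<lambda>(s, t). {s..t}) J"
      using I(2) J(1) by (auto simp: disjoint_intervals_def intro: disjoint_family_on_mono)
    then show "disjoint_family_on (\<lambda>(s, t). {s<..<t}) J" by (rule disjoint_family_on_bisimulation) (clarsimp simp: disjoint_iff, meson less_imp_le)
    show "(\<Sum>(s, t)\<in>J. t - s) < d" using J(3) w by simp
  next
    fix s t assume "(s, t) \<in> J"
    from JK[OF this] have "s \<in> {u<..<v}" "t \<in> {u<..<v}" "s < t"
      by (meson atLeastAtMost_iff less_imp_le order_refl subsetD)+
    then show "u \<le> s \<and> s \<le> t \<and> t \<le> v" by auto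
  qed
  moreover have "1 \<le> real k * w" using k w by (simp add: pos_divide_le_eq)
  moreover have "real k * w \<le> real k * (\<Sum>(s, t)\<in>J. t - s)" using J(2) by (intro mult_left_mono) auto
  moreover have "real k * (\<Sum>(s, t)\<in>J. t - s) \<le> (\<Sum>(s, t)\<in>J. \<bar>h t - h s\<bar>)"
    unfolding sum_distrib_left
  proof (rule sum_mono)
    fix i assume "i \<in> J"
    then show "real k * (case i of (s, t) \<Rightarrow> t - s) \<le> (case i of (s, t) \<Rightarrow> \<bar>h t - h s\<bar>)"
      using JK[of "fst i" "snd i"] by (auto simp: split_beta)
  qed
  ultimately show False by linarith
qed

text \<open>The lower and the upper limit of the slopes are finite by the first two assumptions, and a rational
pair strictly between them is excluded by the third.\<close>

lemma slopes_agree_imp_DERIV: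
  assumes lower: "\<not> (\<exists>\<^sub>F y in at x. slope h x y < c)"
    and upper: "\<not> (\<exists>\<^sub>F y in at x. k < slope h x y)"
    and agree: "\<And>p q. p \<in> \<rat> \<Longrightarrow> q \<in> \<rat> \<Longrightarrow> p < q \<Longrightarrow>
      \<not> ((\<exists>\<^sub>F y in at x. slope h x y < p) \<and> (\<exists>\<^sub>F y in at x. q < slope h x y))"
  shows "\<exists>D\<ge>c. (h has_real_derivative D) (at x)"
proof -
  define r where "r = (\<lambda>y. ereal (slope h x y))"
  define l where "l = Liminf (at x) r"
  define b where "b = Limsup (at x) r"
  have "ereal c \<le> l" unfolding l_def using lower
    by (intro Liminf_bounded) (auto simp: r_def not_frequently not_less)
  moreover have "b \<le> ereal k" unfolding b_def using upper
    by (intro Limsup_bounded) (auto simp: r_def not_frequently not_less)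
  moreover have "l \<le> b" unfolding l_def b_def by (rule Liminf_le_Limsup) simp
  moreover have "\<not> l < b"
  proof
    assume "l < b"
    then obtain q where q: "l < ereal (real_of_rat q)" "ereal (real_of_rat q) < b" using ereal_dense3 by blast
    then obtain p where p: "l < ereal (real_of_rat p)" "real_of_rat p < real_of_rat q"
      using ereal_dense3[OF q(1)] by auto
    have "\<exists>\<^sub>F y in at x. slope h x y < real_of_rat p"
    proof (rule ccontr)
      assume "\<not> ?thesis"
      then have "ereal (real_of_rat p) \<le> l" unfolding l_def
        by (intro Liminf_bounded) (auto simp: r_def not_frequently not_less)
      then show False using p by simp
    qed
    moreover have "\<exists>\<^sub>F y in at x. real_of_rat q < slope h x y"
    proof (rule ccontr)
      assume "\<not> ?thesis"
      then have "b \<le> ereal (real_of_rat q)" unfolding b_def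
        by (intro Limsup_bounded) (auto simp: r_def not_frequently not_less)
      then show False using q by simp
    qed
    ultimately show False using agree[of "real_of_rat p" "real_of_rat q"] p(2) by auto
  qed
  ultimately obtain D where D: "l = ereal D" "b = ereal D" "c \<le> D" by (cases l; cases b) auto
  have "(r \<longlongrightarrow> ereal D) (at x)"
    using D by (intro tendsto_iff_Liminf_eq_Limsup[THEN iffD2]) (auto simp: l_def b_def)
  then have "((\<lambda>y. slope h x y) \<longlongrightarrow> D) (at x)" by (simp add: r_def)
  then show ?thesis using D(3) by (auto simp: has_field_derivative_iff slope_def[abs_def])
qed

text \<open>Almost every point has arbitrarily short intervals of slope below \<open>L + \<eta>\<close>: otherwise all slopes
near it are at least \<open>L + \<eta>\<close>, and by the preceding lemmas \<open>h\<close> is differentiable there with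
too large a derivative, except on a null set. A Vitali family of such intervals bounds the increment up to
the gaps, whose contribution is small by absolute continuity.\<close>

lemma abs_cont_increment_le:
  assumes ac: "abs_cont h" and "u < v" and "L \<ge> 0"
    and DL: "AE x in lborel. \<forall>D. (h has_real_derivative D) (at x) \<longrightarrow> D \<le> L"
  shows "h v - h u \<le> L * (v - u)"
proof -
  have "h v - h u \<le> L * (v - u) + \<eta> * (v - u + 1)" if "\<eta> > 0" for \<eta>
  proof -
    obtain d where "d > 0" and d: "\<And>I. finite I \<Longrightarrow> (\<And>s t. (s, t) \<in> I \<Longrightarrow> u \<le> s \<and> s \<le> t \<and> t \<le> v) \<Longrightarrow>
         disjoint_family_on (\<lambda>(s, t). {s<..<t}) I \<Longrightarrow> (\<Sum>(s, t)\<in>I. t - s) < d \<Longrightarrow>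
         (\<Sum>(s, t)\<in>I. \<bar>h t - h s\<bar>) < \<eta>"
      using abs_contD[OF ac \<open>\<eta> > 0\<close>] by blast
    define F where "F = {u<..<v} \<inter> {x. \<exists>\<^sub>F y in at x. slope h x y < L + \<eta>}"
    have F[measurable]: "F \<in> sets borel" unfolding F_def
      by (intro sets.Int borel_frequently_slope_less abs_cont_imp_isCont[OF ac]) auto
    have F': "F \<in> fmeasurable lborel"
      by (rule fmeasurable_lborel_bounded[OF _ F]) (auto simp: F_def intro: bounded_subset[of "{u<..<v}"])
    then have fF: "emeasure lborel F < \<infinity>" by (simp add: fmeasurable_def)
    define K where "K = {(s, t). s < t \<and> {s..t} \<subseteq> {u<..<v} \<and> h t - h s < (L + \<eta>) * (t - s)}"
    have cover: "\<exists>(s, t)\<in>K. s \<le> x \<and> x \<le> t \<and> t - s < \<delta>" if "x \<in> F" "\<delta> > 0" for x \<delta>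
    proof -
      have "\<exists>\<^sub>F y in at x. slope h x y < L + \<eta>" "x \<in> {u<..<v}" using that by (auto simp: F_def)
      from short_interval_slope_less[OF this(1) open_greaterThanLessThan this(2) \<open>\<delta> > 0\<close>]
      obtain s t where st: "s < t" "s \<le> x" "x \<le> t" "t - s < \<delta>" "{s..t} \<subseteq> {u<..<v}" "h t - h s < (L + \<eta>) * (t - s)"
        by blast
      then have "(s, t) \<in> K" by (simp add: K_def)
      then show ?thesis using st by auto
    qed
    have "F \<in> sets lborel" "\<And>s t. (s, t) \<in> K \<Longrightarrow> s < t" using F by (auto simp: K_def)
    from Vitali_finite[OF this(1) fF \<open>d > 0\<close> this(2) cover]
    obtain I where I: "I \<subseteq> K" "disjoint_intervals I" "measure lborel (F - (\<Union>(s, t)\<in>I. {s..t})) < d" by blast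
    have IK: "s < t \<and> {s..t} \<subseteq> {u<..<v} \<and> h t - h s < (L + \<eta>) * (t - s)" if "(s, t) \<in> I" for s t
      using that I(1) by (auto simp: K_def)
    have Iuv: "u \<le> s \<and> t \<le> v" if "(s, t) \<in> I" for s t
    proof -
      have "s \<in> {u<..<v}" "t \<in> {u<..<v}" using IK[OF that] by (meson atLeastAtMost_iff less_imp_le order_refl subsetD)+
      then show ?thesis by auto
    qed
    have "\<exists>G. finite G \<and> (\<forall>(s, t)\<in>G. u \<le> s \<and> s \<le> t \<and> t \<le> v) \<and>
      disjoint_family_on (\<lambda>(s, t). {s<..<t}) G \<and>
      (\<forall>\<phi> :: real \<Rightarrow> real. (\<Sum>(s, t)\<in>I. \<phi> t - \<phi> s) + (\<Sum>(s, t)\<in>G. \<phi> t - \<phi> s) = \<phi> v - \<phi> u)"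
      by (rule interval_gaps[OF I(2) less_imp_le[OF \<open>u < v\<close>]]) (use Iuv in auto)
    then obtain G where G: "finite G" "\<And>s t. (s, t) \<in> G \<Longrightarrow> u \<le> s \<and> s \<le> t \<and> t \<le> v"
        "disjoint_family_on (\<lambda>(s, t). {s<..<t}) G"
        "\<And>\<phi>. (\<Sum>(s, t)\<in>I. \<phi> t - \<phi> s) + (\<Sum>(s, t)\<in>G. \<phi> t - \<phi> s) = \<phi> v - (\<phi> u :: real)"
      by (elim exE conjE) (rule that; auto)
    have null: "{u<..<v} - F \<in> null_sets lborel"
    proof -
      have A: "AE x in lborel. x \<notin> {u<..<v} \<inter> {x. \<exists>\<^sub>F y in at x. slope h x y < p} \<inter> {x. \<exists>\<^sub>F y in at x. q < slope h x y}"
        if "p < q" for p q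
        using abs_cont_slopes_agree[OF ac that] by (rule AE_not_in)
      have "AE x in lborel. \<forall>p\<in>\<rat>. \<forall>q\<in>\<rat>. p < q \<longrightarrow> x \<notin> {u<..<v} \<inter> {x. \<exists>\<^sub>F y in at x. slope h x y < p} \<inter> {x. \<exists>\<^sub>F y in at x. q < slope h x y}"
        by (intro AE_ball_countable[THEN iffD2] ballI countable_rat AE_impI A)
      moreover have "AE x in lborel. x \<notin> {u<..<v} \<inter> {x. \<forall>k::nat. \<exists>\<^sub>F y in at x. real k < slope h x y}"
        using abs_cont_slopes_bounded[OF ac] by (rule AE_not_in)
      ultimately have "AE x in lborel. x \<notin> {u<..<v} - F"
        using DL
      proof eventually_elim
        case (elim x)
        show ?case
        proof
          assume x: "x \<in> {u<..<v} - F"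
          obtain k :: nat where "\<not> (\<exists>\<^sub>F y in at x. real k < slope h x y)" using elim(2) x by auto
          moreover have "\<not> (\<exists>\<^sub>F y in at x. slope h x y < L + \<eta>)" using x by (auto simp: F_def)
          ultimately obtain D where "D \<ge> L + \<eta>" "(h has_real_derivative D) (at x)"
            using slopes_agree_imp_DERIV[of h x "L + \<eta>" "real k"] elim(1) x by auto
          then show False using elim(3) \<open>\<eta> > 0\<close> by fastforce
        qed
      qed
      then show ?thesis using F by (subst AE_iff_null_sets) auto
    qed
    have "v - u = measure lborel {u<..<v}" using \<open>u < v\<close> by simp
    also have "\<dots> \<le> measure lborel (({u<..<v} - F) \<union> ((F - (\<Union>(s, t)\<in>I. {s..t})) \<union> (\<Union>(s, t)\<in>I. {s..t})))"
      using F F' fmeasurable_Union_intervals[OF I(2)] null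
      by (intro measure_mono_fmeasurable fmeasurable.Un fmeasurable_Diff) 
         (auto simp: fmeasurable_lborel_bounded)
    also have "\<dots> \<le> measure lborel ({u<..<v} - F) + measure lborel ((F - (\<Union>(s, t)\<in>I. {s..t})) \<union> (\<Union>(s, t)\<in>I. {s..t}))"
      using F fmeasurable_Union_intervals[OF I(2)] by (intro measure_Un_le) (auto simp: fmeasurable_def)
    also have "measure lborel ((F - (\<Union>(s, t)\<in>I. {s..t})) \<union> (\<Union>(s, t)\<in>I. {s..t})) \<le>
        measure lborel (F - (\<Union>(s, t)\<in>I. {s..t})) + measure lborel (\<Union>(s, t)\<in>I. {s..t})"
      using F fmeasurable_Union_intervals[OF I(2)] by (intro measure_Un_le) (auto simp: fmeasurable_def)
    also have "measure lborel ({u<..<v} - F) = 0" using null by (simp add: measure_def null_setsD1)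
    finally have "v - u < d + (\<Sum>(s, t)\<in>I. t - s)"
      using I(3) unfolding measure_disjoint_intervals[OF I(2)] by simp
    then have "(\<Sum>(s, t)\<in>G. t - s) < d" using G(4)[of "\<lambda>x. x"] by simp
    from d[OF G(1,2,3) this] have "(\<Sum>(s, t)\<in>G. \<bar>h t - h s\<bar>) < \<eta>" .
    moreover have "(\<Sum>(s, t)\<in>G. h t - h s) \<le> (\<Sum>(s, t)\<in>G. \<bar>h t - h s\<bar>)" by (intro sum_mono) (auto simp: split_beta)
    moreover have "(\<Sum>(s, t)\<in>I. h t - h s) \<le> (L + \<eta>) * (\<Sum>(s, t)\<in>I. t - s)"
      unfolding sum_distrib_left
    proof (rule sum_mono)
      fix i assume "i \<in> I"
      then show "(case i of (s, t) \<Rightarrow> h t - h s) \<le> (L + \<eta>) * (case i of (s, t) \<Rightarrow> t - s)"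
        using IK[of "fst i" "snd i"] by (auto simp: split_beta)
    qed
    moreover have "(L + \<eta>) * (\<Sum>(s, t)\<in>I. t - s) \<le> (L + \<eta>) * (v - u)"
    proof (intro mult_left_mono)
      have "0 \<le> (\<Sum>(s, t)\<in>G. t - s)" by (intro sum_nonneg) (use G(2) in auto)
      then show "(\<Sum>(s, t)\<in>I. t - s) \<le> v - u" using G(4)[of "\<lambda>x. x"] by simp
    qed (use \<open>L \<ge> 0\<close> \<open>\<eta> > 0\<close> in auto)
    ultimately have "h v - h u \<le> (L + \<eta>) * (v - u) + \<eta>" using G(4)[of h] by linarith
    then show ?thesis by (simp add: algebra_simps)
  qed
  then have *: "h v - h u \<le> L * (v - u) + \<eta> * (v - u + 1)" if "\<eta> > 0" for \<eta> using that by blast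
  have "h v - h u \<le> L * (v - u) + e" if "e > 0" for e
    using *[of "e / (v - u + 1)"] that \<open>u < v\<close> by simp
  then show ?thesis by (rule field_le_epsilon)
qed

text \<open>The one-sided estimate is applied to \<open>h\<close> and to \<open>- h\<close>. For points where
\<open>h\<close> has no derivative the condition on \<open>D\<close> is vacuous, so the unspecified value of \<open>deriv h\<close> never matters.\<close>

lemma abs_cont_imp_lipschitz:
  assumes ac: "abs_cont h" and "ess_norm (deriv h) \<le> ennreal L" and "L \<ge> 0"
  shows "L-lipschitz_on UNIV h"
proof -
  have "AE x in lebesgue. ennreal \<bar>deriv h x\<bar> \<le> esssup lebesgue (\<lambda>x. ennreal \<bar>deriv h x\<bar>)"
    by (rule esssup_AE)
  then have "AE x in lebesgue. \<bar>deriv h x\<bar> \<le> L"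
  proof eventually_elim
    case (elim x)
    then have "ennreal \<bar>deriv h x\<bar> \<le> ennreal L" using assms(2) unfolding ess_norm_def by (rule order_trans)
    then show ?case using \<open>L \<ge> 0\<close> by simp
  qed
  then have AE: "AE x in lborel. \<bar>deriv h x\<bar> \<le> L" by (simp add: AE_completion_iff)
  have *: "\<bar>h y - h x\<bar> \<le> L * (y - x)" if "x < y" for x y
  proof -
    have "AE x in lborel. \<forall>D. (h has_real_derivative D) (at x) \<longrightarrow> D \<le> L"
      using AE by eventually_elim (auto dest!: DERIV_imp_deriv)
    from abs_cont_increment_le[OF ac that \<open>L \<ge> 0\<close> this] have "h y - h x \<le> L * (y - x)" .
    moreover have "AE x in lborel. \<forall>D. ((\<lambda>x. - h x) has_real_derivative D) (at x) \<longrightarrow> D \<le> L"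
      using AE
    proof eventually_elim
      case (elim x)
      show ?case
      proof (intro allI impI)
        fix D assume "((\<lambda>x. - h x) has_real_derivative D) (at x)"
        from DERIV_minus[OF this] have "deriv h x = - D" by (simp add: DERIV_imp_deriv)
        then show "D \<le> L" using elim by simp
      qed
    qed
    from abs_cont_increment_le[OF abs_cont_uminus[OF ac] that \<open>L \<ge> 0\<close> this] have "h x - h y \<le> L * (y - x)" by simp
    ultimately show ?thesis by linarith
  qed
  show ?thesis
  proof (rule lipschitz_onI)
    fix x y show "dist (h x) (h y) \<le> L * dist x y"
      using *[of x y] *[of y x] by (cases "x < y"; cases "y < x") (auto simp: dist_real_def abs_minus_commute)
  qed (use \<open>L \<ge> 0\<close> in simp)
qed

lemma continuous_le_ess_norm:
  assumes "continuous_on UNIV h"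
  shows "ennreal \<bar>h x\<bar> \<le> ess_norm h"
proof (rule ccontr)
  assume "\<not> ?thesis"
  then have lt: "ess_norm h < ennreal \<bar>h x\<bar>" by simp
  then obtain c where c: "ess_norm h = ennreal c" "c \<ge> 0" by (cases "ess_norm h") auto
  define U where "U = {y. c < \<bar>h y\<bar>}"
  have "open U" unfolding U_def using assms by (intro open_Collect_less continuous_intros)
  moreover have "x \<in> U" using lt c by (simp add: U_def ennreal_less_iff)
  moreover have "AE y in lebesgue. y \<notin> U"
    using esssup_AE[of "\<lambda>x. ennreal \<bar>h x\<bar>" lebesgue]
    by eventually_elim (use c in \<open>auto simp: U_def ess_norm_def[symmetric]\<close>)
  then have "negligible U" using \<open>open U\<close>
    by (simp add: negligible_iff_null_sets AE_iff_null_sets)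
  ultimately show False using open_not_negligible by blast
qed

section \<open>Stein's equation\<close>

abbreviation (input) \<phi> :: "real \<Rightarrow> real" where "\<phi> \<equiv> std_normal_density"

definition lower_integral :: "(real \<Rightarrow> real) \<Rightarrow> real \<Rightarrow> real" where
  "lower_integral g x = (\<integral>t. indicator {..x} t *\<^sub>R g t \<partial>lborel)"

lemma integrable_indicator_scaleR:
  "integrable lborel g \<Longrightarrow> A \<in> sets borel \<Longrightarrow> integrable lborel (\<lambda>t. indicator A t *\<^sub>R (g t :: real))"
  by (rule integrable_mult_indicator) auto

lemma lower_integral_diff:
  assumes "integrable lborel g" "u \<le> y"
  shows "lower_integral g y = lower_integral g u + (\<integral>t. indicator {u..y} t *\<^sub>R g t \<partial>lborel)"
proof -
  have "lower_integral g y = (\<integral>t. indicator {..u} t *\<^sub>R g t + indicator {u..y} t *\<^sub>R g t \<partial>lborel)"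
    unfolding lower_integral_def
  proof (rule integral_cong_AE)
    have "AE t in lborel. t \<noteq> u" by (rule AE_lborel_singleton)
    then show "AE t in lborel. indicator {..y} t *\<^sub>R g t = indicator {..u} t *\<^sub>R g t + indicator {u..y} t *\<^sub>R g t"
      by eventually_elim (use assms(2) in \<open>auto split: split_indicator\<close>)
  qed (use assms(1) in measurable)
  then show ?thesis
    unfolding lower_integral_def using assms(1) by (simp add: integrable_indicator_scaleR Bochner_Integration.integral_add del: real_scaleR_def)
qed

lemma DERIV_lower_integral:
  assumes g: "integrable lborel g" and cont: "continuous_on UNIV g"
  shows "(lower_integral g has_real_derivative g x) (at x)"
proof -
  have "((\<lambda>y. integral {x - 1..y} g) has_real_derivative g x) (at x within {x - 1..x + 1})"
    using cont by (intro integral_has_real_derivative continuous_on_subset[OF cont]) auto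
  then have "((\<lambda>y. integral {x - 1..y} g) has_real_derivative g x) (at x)"
    by (simp add: at_within_Icc_at)
  then have "((\<lambda>y. lower_integral g (x - 1) + integral {x - 1..y} g) has_real_derivative g x) (at x)"
    by (auto intro!: derivative_eq_intros)
  then show ?thesis
  proof (rule has_field_derivative_transform_within_open)
    fix y assume "y \<in> {x - 1<..}"
    then show "lower_integral g (x - 1) + integral {x - 1..y} g = lower_integral g y"
      using lower_integral_diff[OF g, of "x - 1" y] set_borel_integral_eq_integral(2)[of "{x - 1..y}" g]
        integrable_indicator_scaleR[OF g, of "{x - 1..y}"]
      by (simp add: set_lebesgue_integral_def set_integrable_def)
  qed auto
qed

lemma lower_integral_at_top:
  "integrable lborel g \<Longrightarrow> (lower_integral g \<longlongrightarrow> (\<integral>t. g t \<partial>lborel)) at_top"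
  unfolding lower_integral_def[abs_def] by (rule tendsto_integral_at_top) auto

lemma lower_integral_at_bot:
  assumes g: "integrable lborel g" shows "(lower_integral g \<longlongrightarrow> 0) at_bot"
proof -
  have "((\<lambda>x. \<integral>t. indicator {..- x} t *\<^sub>R g t \<partial>lborel) \<longlongrightarrow> integral\<^sup>L lborel (\<lambda>t::real. 0)) at_top"
  proof (rule integral_dominated_convergence_at_top[where w = "\<lambda>t. norm (g t)" and
        s = "\<lambda>x t. indicator {..- x} t *\<^sub>R g t" and f = "\<lambda>t. 0" and M = lborel])
    show "AE t in lborel. ((\<lambda>x. indicator {..- x} t *\<^sub>R g t) \<longlongrightarrow> 0) at_top"
    proof (intro AE_I2 tendsto_eventually)
      fix t show "eventually (\<lambda>x. indicator {..- x} t *\<^sub>R g t = 0) at_top"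
        using eventually_gt_at_top[of "- t"] by eventually_elim (auto split: split_indicator)
    qed
    show "\<forall>\<^sub>F i in at_top. AE x in lborel. norm (indicator {..- i} x *\<^sub>R g x) \<le> norm (g x)"
      by (intro always_eventually allI AE_I2) (auto split: split_indicator)
  qed (use g in auto)
  then show ?thesis by (simp add: filterlim_at_bot_mirror lower_integral_def[abs_def])
qed

lemma DERIV_std_normal_density: "(\<phi> has_real_derivative - x * \<phi> x) (at x)"
  unfolding std_normal_density_def[abs_def] by (auto intro!: derivative_eq_intros simp: field_simps)

lemmas [derivative_intros] = DERIV_std_normal_density[THEN DERIV_chain2]

lemma continuous_on_std_normal_density: "continuous_on S \<phi>"
  unfolding std_normal_density_def[abs_def] by (intro continuous_intros) auto

lemma std_normal_density_at_top: "(\<phi> \<longlongrightarrow> 0) at_top"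
proof -
  have "filterlim (\<lambda>x::real. x\<^sup>2) at_top at_top" by (intro filterlim_pow_at_top filterlim_ident) auto
  then have "filterlim (\<lambda>x::real. (1 / 2) * x\<^sup>2) at_top at_top" by (intro filterlim_tendsto_pos_mult_at_top[OF tendsto_const]) auto
  then have "filterlim (\<lambda>x::real. - ((1 / 2) * x\<^sup>2)) at_bot at_top" by (simp add: filterlim_uminus_at_bot)
  from filterlim_compose[OF exp_at_bot this] have "((\<lambda>x::real. exp (- ((1 / 2) * x\<^sup>2))) \<longlongrightarrow> 0) at_top" .
  from tendsto_mult_right[OF this, of "1 / sqrt (2 * pi)"] show ?thesis
    by (simp add: std_normal_density_def[abs_def])
qed

lemma std_normal_density_at_bot: "(\<phi> \<longlongrightarrow> 0) at_bot"
proof -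
  have "\<phi> (- x) = \<phi> x" for x by (simp add: std_normal_density_def)
  then show ?thesis using std_normal_density_at_top by (simp add: filterlim_at_bot_mirror)
qed

lemma Mills_aux_limit:
  assumes "(\<phi> \<longlongrightarrow> 0) F" shows "((\<lambda>x. x * \<phi> x / (1 + x\<^sup>2)) \<longlongrightarrow> 0) F"
proof (rule tendsto_rabs_zero_cancel, rule real_tendsto_sandwich[OF _ _ tendsto_const assms])
  have "\<bar>x * \<phi> x / (1 + x\<^sup>2)\<bar> \<le> \<phi> x" for x
  proof -
    have "\<bar>x\<bar> \<le> 1 + x\<^sup>2" using zero_le_power2[of "\<bar>x\<bar> - 1 / 2"] by (simp add: power2_eq_square algebra_simps abs_mult_self_eq)
    then have "\<bar>x\<bar> * \<phi> x \<le> (1 + x\<^sup>2) * \<phi> x" by (intro mult_right_mono) auto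
    moreover have "0 < 1 + x\<^sup>2" by (simp add: add_pos_nonneg)
    ultimately show ?thesis by (simp add: abs_mult pos_divide_le_eq mult.commute)
  qed
  then show "\<forall>\<^sub>F x in F. \<bar>x * \<phi> x / (1 + x\<^sup>2)\<bar> \<le> \<phi> x" by simp
qed auto

lemma DERIV_Mills_aux:
  "((\<lambda>x. x * \<phi> x / (1 + x\<^sup>2)) has_real_derivative 2 * \<phi> x / (1 + x\<^sup>2)\<^sup>2 - \<phi> x) (at x)"
proof -
  have "1 + x\<^sup>2 \<noteq> 0" by (metis add_pos_nonneg less_irrefl zero_le_power2 zero_less_one)
  then show ?thesis
    by (auto intro!: derivative_eq_intros)
       (simp add: divide_simps, simp add: power2_eq_square algebra_simps)
qed

text \<open>The difference of the two sides decreases, with derivative \<open>- 2 * \<phi> x / (1 + x\<^sup>2)\<^sup>2\<close>, to its limit 0 at infinity.\<close>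

lemma Mills_ratio_upper_tail: "x * \<phi> x / (1 + x\<^sup>2) \<le> 1 - lower_integral \<phi> x"
proof -
  define v where "v = (\<lambda>x. 1 - lower_integral \<phi> x - x * \<phi> x / (1 + x\<^sup>2))"
  have "(v has_real_derivative 0 - \<phi> x - (2 * \<phi> x / (1 + x\<^sup>2)\<^sup>2 - \<phi> x)) (at x)" for x
    unfolding v_def by (intro DERIV_diff DERIV_const DERIV_lower_integral DERIV_Mills_aux continuous_on_std_normal_density) auto
  then have D: "(v has_real_derivative - 2 * \<phi> x / (1 + x\<^sup>2)\<^sup>2) (at x)" for x by simp
  have "(v \<longlongrightarrow> 1 - (\<integral>t. \<phi> t \<partial>lborel) - 0) at_top"
    unfolding v_def by (intro tendsto_intros lower_integral_at_top Mills_aux_limit std_normal_density_at_top) auto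
  then have lim: "(v \<longlongrightarrow> 0) at_top" by simp
  have "v y \<le> v x" if "x \<le> y" for y
    using that by (rule DERIV_nonpos_imp_nonincreasing) (use D in \<open>auto intro!: exI divide_nonneg_nonneg\<close>)
  then have "0 \<le> v x" by (intro tendsto_upperbound[OF lim] eventually_mono[OF eventually_ge_at_top[of x]]) auto
  then show ?thesis by (simp add: v_def)
qed

lemma Mills_ratio_lower_tail: "- x * \<phi> x / (1 + x\<^sup>2) \<le> lower_integral \<phi> x"
proof -
  define v where "v = (\<lambda>x. lower_integral \<phi> x + x * \<phi> x / (1 + x\<^sup>2))"
  have "(v has_real_derivative \<phi> x + (2 * \<phi> x / (1 + x\<^sup>2)\<^sup>2 - \<phi> x)) (at x)" for x
    unfolding v_def by (intro DERIV_add DERIV_lower_integral DERIV_Mills_aux continuous_on_std_normal_density) auto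
  then have D: "(v has_real_derivative 2 * \<phi> x / (1 + x\<^sup>2)\<^sup>2) (at x)" for x by simp
  have "(v \<longlongrightarrow> 0 + 0) at_bot"
    unfolding v_def by (intro tendsto_intros lower_integral_at_bot Mills_aux_limit std_normal_density_at_bot) auto
  then have lim: "(v \<longlongrightarrow> 0) at_bot" by simp
  have "v y \<le> v x" if "y \<le> x" for y
    using that by (rule DERIV_nonneg_imp_nondecreasing) (use D in \<open>auto intro!: exI divide_nonneg_nonneg\<close>)
  then have "0 \<le> v x" by (intro tendsto_upperbound[OF lim] eventually_mono[OF eventually_le_at_bot[of x]]) auto
  then show ?thesis by (simp add: v_def)
qed

text \<open>Monotonicity of \<open>g\<close> gives \<open>s x \<le> a * P x\<close> by comparing \<open>g\<close> with \<open>g x\<close> to the left of \<open>x\<close>, and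
\<open>s x \<le> - a * (1 - P x)\<close> by comparing to the right, where \<open>a = g x - m\<close> and \<open>P\<close> is the normal
distribution function. One of the two bounds is nonpositive, which is the first claim. In
the second claim only the case that \<open>x\<close> and \<open>a\<close> have the same sign needs work, and there the
bounds combine with the Mills ratio. Divided by the density, the two expressions are the
solution \<open>F\<close> of Stein's equation for \<open>g\<close> and the derivative of \<open>x * F x\<close>.\<close>

lemma Stein_operator_mono:
  assumes mono: "mono g" and int: "integrable lborel (\<lambda>t. \<phi> t * g t)"
  defines "m \<equiv> (\<integral>t. \<phi> t * g t \<partial>lborel)"
  defines "s \<equiv> lower_integral (\<lambda>t. \<phi> t * (g t - m))"
  shows "s x \<le> 0" "(1 + x\<^sup>2) * s x + x * (g x - m) * \<phi> x \<le> 0"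
proof -
  define a where "a = g x - m"
  define P where "P = lower_integral \<phi> x"
  have int': "integrable lborel (\<lambda>t. \<phi> t * (g t - m))"
    using int by (simp add: right_diff_distrib)
  have below: "s x \<le> a * P"
  proof -
    have "s x \<le> (\<integral>t. indicator {..x} t *\<^sub>R (a * \<phi> t) \<partial>lborel)"
      unfolding s_def lower_integral_def
    proof (intro integral_mono integrable_indicator_scaleR int')
      fix t show "indicator {..x} t *\<^sub>R (\<phi> t * (g t - m)) \<le> indicator {..x} t *\<^sub>R (a * \<phi> t)"
        using monoD[OF mono, of t x] by (auto split: split_indicator simp: a_def mult.commute intro!: mult_left_mono)
    qed auto
    also have "\<dots> = a * P" by (simp add: P_def lower_integral_def mult.left_commute)
    finally show ?thesis .
  qed
  have above: "s x \<le> - a * (1 - P)"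
  proof -
    have "0 = (\<integral>t. \<phi> t * (g t - m) \<partial>lborel)" using int by (simp add: right_diff_distrib m_def)
    also have "\<dots> = (\<integral>t. indicator {..x} t *\<^sub>R (\<phi> t * (g t - m)) + indicator {x<..} t *\<^sub>R (\<phi> t * (g t - m)) \<partial>lborel)"
      by (intro Bochner_Integration.integral_cong) (auto split: split_indicator)
    also have "\<dots> = s x + (\<integral>t. indicator {x<..} t *\<^sub>R (\<phi> t * (g t - m)) \<partial>lborel)"
      unfolding s_def lower_integral_def by (intro Bochner_Integration.integral_add integrable_indicator_scaleR int') auto
    finally have "s x = - (\<integral>t. indicator {x<..} t *\<^sub>R (\<phi> t * (g t - m)) \<partial>lborel)" by simp
    moreover have "(\<integral>t. indicator {x<..} t *\<^sub>R (a * \<phi> t) \<partial>lborel) \<le> (\<integral>t. indicator {x<..} t *\<^sub>R (\<phi> t * (g t - m)) \<partial>lborel)"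
    proof (intro integral_mono integrable_indicator_scaleR int')
      fix t show "indicator {x<..} t *\<^sub>R (a * \<phi> t) \<le> indicator {x<..} t *\<^sub>R (\<phi> t * (g t - m))"
        using monoD[OF mono, of x t] by (auto split: split_indicator simp: a_def mult.commute intro!: mult_left_mono)
    qed auto
    moreover have "(\<integral>t. indicator {x<..} t *\<^sub>R (a * \<phi> t) \<partial>lborel) = a * (1 - P)"
    proof -
      have "(\<integral>t. \<phi> t \<partial>lborel) = (\<integral>t. indicator {..x} t *\<^sub>R \<phi> t + indicator {x<..} t *\<^sub>R \<phi> t \<partial>lborel)"
        by (intro Bochner_Integration.integral_cong) (auto split: split_indicator)
      also have "\<dots> = P + (\<integral>t. indicator {x<..} t *\<^sub>R \<phi> t \<partial>lborel)"
        unfolding P_def lower_integral_def by (intro Bochner_Integration.integral_add integrable_indicator_scaleR) auto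
      finally show ?thesis by (simp add: mult.left_commute)
    qed
    ultimately show ?thesis by simp
  qed
  have P: "x * \<phi> x / (1 + x\<^sup>2) \<le> 1 - P" "- x * \<phi> x / (1 + x\<^sup>2) \<le> P"
    unfolding P_def by (rule Mills_ratio_upper_tail Mills_ratio_lower_tail)+
  have P01: "0 \<le> P" "0 \<le> 1 - P"
  proof -
    show "0 \<le> P" unfolding P_def lower_integral_def by (intro integral_nonneg_AE) (auto split: split_indicator)
    have "P \<le> (\<integral>t. \<phi> t \<partial>lborel)" unfolding P_def lower_integral_def
      by (intro integral_mono integrable_indicator_scaleR) (auto split: split_indicator)
    then show "0 \<le> 1 - P" by simp
  qed
  show "s x \<le> 0"
  proof (cases "a \<ge> 0")
    case True
    then show ?thesis using above mult_nonneg_nonneg[OF True P01(2)] by linarith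
  next
    case False
    then show ?thesis using below mult_nonpos_nonneg[of a P] P01(1) by linarith
  qed
  have pos: "0 < 1 + x\<^sup>2" by (simp add: add_pos_nonneg)
  have cancel: "(1 + x\<^sup>2) * - (a * (x * \<phi> x / (1 + x\<^sup>2))) = - (x * a * \<phi> x)"
    using nonzero_mult_div_cancel_left[of "1 + x\<^sup>2" "a * x * \<phi> x"] pos by (simp add: mult_ac)
  show "(1 + x\<^sup>2) * s x + x * (g x - m) * \<phi> x \<le> 0"
  proof (cases "x * a \<le> 0")
    case True
    then have "x * a * \<phi> x \<le> 0" using mult_nonpos_nonneg[of "x * a" "\<phi> x"] by simp
    moreover have "(1 + x\<^sup>2) * s x \<le> 0" using \<open>s x \<le> 0\<close> pos by (intro mult_nonneg_nonpos) auto
    ultimately show ?thesis by (simp add: a_def)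
  next
    case False
    then consider "x > 0" "a > 0" | "x < 0" "a < 0" by (auto simp: mult_le_0_iff not_le)
    then show ?thesis
    proof cases
      case 1
      then have "a * (x * \<phi> x / (1 + x\<^sup>2)) \<le> a * (1 - P)" using P(1) by (intro mult_left_mono) auto
      then have "s x \<le> - (a * (x * \<phi> x / (1 + x\<^sup>2)))" using above by simp
      then have "(1 + x\<^sup>2) * s x \<le> (1 + x\<^sup>2) * - (a * (x * \<phi> x / (1 + x\<^sup>2)))" using pos by (intro mult_left_mono) auto
      then show ?thesis unfolding cancel by (simp add: a_def)
    next
      case 2
      then have "a * P \<le> a * (- x * \<phi> x / (1 + x\<^sup>2))" using P(2) by (intro mult_left_mono_neg) auto
      then have "s x \<le> - (a * (x * \<phi> x / (1 + x\<^sup>2)))" using below by simp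
      then have "(1 + x\<^sup>2) * s x \<le> (1 + x\<^sup>2) * - (a * (x * \<phi> x / (1 + x\<^sup>2)))" using pos by (intro mult_left_mono) auto
      then show ?thesis unfolding cancel by (simp add: a_def)
    qed
  qed
qed

text \<open>This makes the constant \<open>- 1\<close> the solution of Stein's equation for \<open>h x = x\<close>.\<close>

lemma lower_integral_linear: "lower_integral (\<lambda>t. \<phi> t * t) x = - \<phi> x"
proof -
  have int: "integrable lborel (\<lambda>t. \<phi> t * t)" using integrable_std_normal_moment[of 1] by simp
  have "((\<lambda>x. lower_integral (\<lambda>t. \<phi> t * t) x + \<phi> x) has_real_derivative 0) (at x)" for x
    by (auto intro!: derivative_eq_intros DERIV_lower_integral[OF int] DERIV_std_normal_density continuous_intros continuous_on_std_normal_density)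
  then have const: "lower_integral (\<lambda>t. \<phi> t * t) x + \<phi> x = lower_integral (\<lambda>t. \<phi> t * t) y + \<phi> y" for y
    by (intro DERIV_isconst_all) blast
  have "((\<lambda>x. lower_integral (\<lambda>t. \<phi> t * t) x + \<phi> x) \<longlongrightarrow> 0 + 0) at_bot"
    by (intro tendsto_add lower_integral_at_bot int std_normal_density_at_bot)
  moreover have "(\<lambda>y. lower_integral (\<lambda>t. \<phi> t * t) y + \<phi> y) = (\<lambda>y. lower_integral (\<lambda>t. \<phi> t * t) x + \<phi> x)"
    by (rule ext) (rule const[symmetric])
  ultimately have "((\<lambda>y::real. lower_integral (\<lambda>t. \<phi> t * t) x + \<phi> x) \<longlongrightarrow> 0) at_bot" by simp
  from tendsto_unique[OF trivial_limit_at_bot_linorder tendsto_const this] show ?thesis by linarith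
qed

text \<open>If \<open>h\<close> has Lipschitz constant \<open>L\<close>, then \<open>L * x + h x\<close> and \<open>L * x - h x\<close> are nondecreasing, and
their Stein solutions are \<open>- L + F x\<close> and \<open>- L - F x\<close>. The comparison principle therefore bounds
\<open>F\<close> and the derivative \<open>J\<close> of \<open>x * F x\<close> by \<open>L\<close>. Since \<open>F1 x\<close> is \<open>x * F x + h x\<close> up to a
constant, it is Lipschitz with constant \<open>2 * L\<close>; working with Lipschitz constants avoids a second
derivative of \<open>F\<close>, which need not exist.\<close>

lemma Stein_solution:
  fixes h :: "real \<Rightarrow> real"
  assumes lip: "L-lipschitz_on UNIV h" and bdd: "\<And>x. \<bar>h x\<bar> \<le> C"
  defines "m \<equiv> (\<integral>t. \<phi> t * h t \<partial>lborel)"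
  obtains F F1 where "\<And>x. (F has_real_derivative F1 x) (at x)" "\<And>x. F1 x = x * F x + h x - m"
    "\<And>x. \<bar>F x\<bar> \<le> L" "\<And>x y. \<bar>F1 y - F1 x\<bar> \<le> 2 * L * \<bar>y - x\<bar>"
proof -
  have cont: "continuous_on UNIV h" using lip by (rule lipschitz_on_continuous_on)
  have [measurable]: "h \<in> borel_measurable borel" using cont by (rule borel_measurable_continuous_onI)
  have int: "integrable lborel (\<lambda>t. \<phi> t * h t)"
  proof (rule Bochner_Integration.integrable_bound)
    show "integrable lborel (\<lambda>t. C * \<phi> t)" by auto
    show "AE t in lborel. norm (\<phi> t * h t) \<le> norm (C * \<phi> t)"
    proof (rule AE_I2)
      fix t have "\<phi> t * \<bar>h t\<bar> \<le> \<phi> t * \<bar>C\<bar>" using bdd[of t] by (intro mult_left_mono) auto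
      then show "norm (\<phi> t * h t) \<le> norm (C * \<phi> t)" by (simp add: abs_mult mult.commute)
    qed
  qed auto
  have int1: "integrable lborel (\<lambda>t. \<phi> t * t)" using integrable_std_normal_moment[of 1] by simp
  have int0: "integrable lborel (\<lambda>t. \<phi> t * (h t - m))" using int by (simp add: right_diff_distrib)
  define s where "s = lower_integral (\<lambda>t. \<phi> t * (h t - m))"
  have key: "- L + c * (s x / \<phi> x) \<le> 0" 
      "- L + c * ((1 + x\<^sup>2) * (s x / \<phi> x) + x * (h x - m)) \<le> 0" if c: "c = 1 \<or> c = - 1" for c x
  proof -
    define g where "g = (\<lambda>t. L * t + c * h t)"
    have mono: "mono g"
    proof (rule monoI)
      fix x y :: real assume "x \<le> y"
      then have "\<bar>h x - h y\<bar> \<le> L * (y - x)" using lipschitz_onD[OF lip, of x y] by (auto simp: dist_real_def)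
      then show "g x \<le> g y" using c by (auto simp: g_def algebra_simps abs_le_iff)
    qed
    have geq: "(\<lambda>t. \<phi> t * g t) = (\<lambda>t. L * (\<phi> t * t) + c * (\<phi> t * h t))" by (auto simp: g_def algebra_simps)
    have intg: "integrable lborel (\<lambda>t. \<phi> t * g t)" unfolding geq using int int1 by auto
    have mg: "(\<integral>t. \<phi> t * g t \<partial>lborel) = c * m"
    proof -
      have "(\<integral>t. \<phi> t * t \<partial>lborel) = 0" using integral_std_normal_moment_odd[of 0] by simp
      then show ?thesis unfolding geq using int int1 by (simp add: m_def)
    qed
    have lg: "lower_integral (\<lambda>t. \<phi> t * (g t - c * m)) x = - L * \<phi> x + c * s x"
    proof -
      have "lower_integral (\<lambda>t. \<phi> t * (g t - c * m)) x =
        (\<integral>t. L * (indicator {..x} t *\<^sub>R (\<phi> t * t)) + c * (indicator {..x} t *\<^sub>R (\<phi> t * (h t - m))) \<partial>lborel)"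
        unfolding lower_integral_def by (intro Bochner_Integration.integral_cong) (auto simp: g_def algebra_simps)
      also have "\<dots> = L * lower_integral (\<lambda>t. \<phi> t * t) x + c * s x"
        unfolding lower_integral_def s_def
        using integrable_indicator_scaleR[OF int1, of "{..x}"] integrable_indicator_scaleR[OF int0, of "{..x}"]
        by (subst Bochner_Integration.integral_add) auto
      finally show ?thesis by (simp add: lower_integral_linear)
    qed
    have *: "- L * \<phi> x + c * s x \<le> 0" "(1 + x\<^sup>2) * (- L * \<phi> x + c * s x) + x * (g x - c * m) * \<phi> x \<le> 0"
      using Stein_operator_mono[OF mono intg, of x] unfolding mg lg .
    have pos: "\<phi> x > 0" by (rule normal_density_pos) simp
    define y where "y = s x / \<phi> x"
    have sx: "s x = y * \<phi> x" using pos by (simp add: y_def)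
    have nonpos: "w \<le> 0" if "w * \<phi> x \<le> 0" for w using that pos mult_pos_pos[of w "\<phi> x"] by linarith
    have "- L + c * y \<le> 0" by (rule nonpos) (use *(1) sx in \<open>simp add: algebra_simps\<close>)
    then show "- L + c * (s x / \<phi> x) \<le> 0" by (simp add: y_def)
    have eq: "(1 + x\<^sup>2) * (- L * \<phi> x + c * s x) + x * (g x - c * m) * \<phi> x =
        (- L + c * ((1 + x\<^sup>2) * y + x * (h x - m))) * \<phi> x"
      unfolding sx by (simp add: g_def algebra_simps power2_eq_square)
    have "- L + c * ((1 + x\<^sup>2) * y + x * (h x - m)) \<le> 0" by (rule nonpos) (use *(2) in \<open>simp only: eq\<close>)
    then show "- L + c * ((1 + x\<^sup>2) * (s x / \<phi> x) + x * (h x - m)) \<le> 0" by (simp add: y_def)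
  qed
  define F where "F = (\<lambda>x. s x / \<phi> x)"
  define F1 where "F1 = (\<lambda>x. x * F x + h x - m)"
  define J where "J = (\<lambda>x. (1 + x\<^sup>2) * F x + x * (h x - m))"
  have F: "\<bar>F x\<bar> \<le> L" for x using key(1)[of 1 x] key(1)[of "- 1" x] by (simp add: F_def abs_le_iff)
  have J: "\<bar>J x\<bar> \<le> L" for x using key(2)[of 1 x] key(2)[of "- 1" x] by (simp add: J_def F_def abs_le_iff)
  have DF: "(F has_real_derivative F1 x) (at x)" for x
  proof -
    have pos: "\<phi> x > 0" by (rule normal_density_pos) simp
    have "(s has_real_derivative \<phi> x * (h x - m)) (at x)" unfolding s_def
      by (intro DERIV_lower_integral int0 continuous_intros continuous_on_std_normal_density cont)
    from DERIV_divide[OF this DERIV_std_normal_density] pos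
    have "(F has_real_derivative (\<phi> x * (h x - m) * \<phi> x - s x * (- x * \<phi> x)) / (\<phi> x * \<phi> x)) (at x)"
      by (simp add: F_def)
    moreover have "(\<phi> x * (h x - m) * \<phi> x - s x * (- x * \<phi> x)) / (\<phi> x * \<phi> x) = F1 x"
      using pos by (simp add: F1_def F_def field_simps)
    ultimately show ?thesis by simp
  qed
  have "((\<lambda>x. x * F x) has_real_derivative J x) (at x)" for x
    by (auto intro!: derivative_eq_intros DF simp: J_def F1_def power2_eq_square algebra_simps)
  then have xF: "\<bar>y * F y - x * F x\<bar> \<le> L * \<bar>y - x\<bar>" for x y
    using field_differentiable_bound[of UNIV "\<lambda>x. x * F x" J L y x] J by auto
  show thesis
  proof (rule that[of F F1])
    fix x y
    have "\<bar>h y - h x\<bar> \<le> L * \<bar>y - x\<bar>" using lipschitz_onD[OF lip, of y x] by (simp add: dist_real_def)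
    then show "\<bar>F1 y - F1 x\<bar> \<le> 2 * L * \<bar>y - x\<bar>" using xF[of y x] unfolding F1_def by linarith
  qed (use DF F in \<open>auto simp: F1_def\<close>)
qed

lemma quadratic_remainder_bound:
  fixes F F1 :: "real \<Rightarrow> real"
  assumes D: "\<And>x. (F has_real_derivative F1 x) (at x)" and lip: "\<And>x y. \<bar>F1 y - F1 x\<bar> \<le> 2 * L * \<bar>y - x\<bar>"
  shows "\<bar>F y - F x - (y - x) * F1 x\<bar> \<le> L * (y - x)\<^sup>2"
proof -
  have *: "c * (F y - F x - (y - x) * F1 x) - L * (y - x)\<^sup>2 \<le> 0" if c: "c = 1 \<or> c = - 1" for c
  proof -
    define k where "k = (\<lambda>t. c * (F t - F x - (t - x) * F1 x) - L * (t - x)\<^sup>2)"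
    have Dk: "(k has_real_derivative c * (F1 t - F1 x) - 2 * L * (t - x)) (at t)" for t
      unfolding k_def by (auto intro!: derivative_eq_intros D simp: algebra_simps)
    have b: "\<bar>c * (F1 t - F1 x)\<bar> \<le> 2 * L * \<bar>t - x\<bar>" for t using lip[where x = x and y = t] c by (auto simp: abs_minus_commute)
    have "k y \<le> k x"
    proof (cases "x \<le> y")
      case True
      then show ?thesis
      proof (rule DERIV_nonpos_imp_nonincreasing)
        fix t assume "x \<le> t" "t \<le> y"
        then show "\<exists>z. (k has_real_derivative z) (at t) \<and> z \<le> 0"
          using Dk[of t] b[of t] by (intro exI[of _ "c * (F1 t - F1 x) - 2 * L * (t - x)"]) (auto simp: algebra_simps abs_le_iff)
      qed
    next
      case False
      then have "y \<le> x" by simp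
      then show ?thesis
      proof (rule DERIV_nonneg_imp_nondecreasing)
        fix t assume "y \<le> t" "t \<le> x"
        then show "\<exists>z. (k has_real_derivative z) (at t) \<and> 0 \<le> z"
          using Dk[of t] b[of t] by (intro exI[of _ "c * (F1 t - F1 x) - 2 * L * (t - x)"]) (auto simp: algebra_simps abs_le_iff)
      qed
    qed
    then show ?thesis by (simp add: k_def)
  qed
  show ?thesis using *[of 1] *[of "- 1"] by (simp add: abs_le_iff)
qed

section \<open>Normal approximation of sums of independent variables\<close>

lemma (in prob_space) expectation_indep_mult:
  fixes f g :: "real \<Rightarrow> real"
  assumes ind: "indep_var borel X borel Y"
    and [measurable]: "f \<in> borel_measurable borel" "g \<in> borel_measurable borel"
    and "integrable M (\<lambda>\<omega>. f (X \<omega>))" "integrable M (\<lambda>\<omega>. g (Y \<omega>))"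
  shows "expectation (\<lambda>\<omega>. f (X \<omega>) * g (Y \<omega>)) = expectation (\<lambda>\<omega>. f (X \<omega>)) * expectation (\<lambda>\<omega>. g (Y \<omega>))"
    "integrable M (\<lambda>\<omega>. f (X \<omega>) * g (Y \<omega>))"
proof -
  have "indep_var borel (f \<circ> X) borel (g \<circ> Y)" using ind by (rule indep_var_compose) auto
  then have "indep_var borel (\<lambda>\<omega>. f (X \<omega>)) borel (\<lambda>\<omega>. g (Y \<omega>))" by (simp add: comp_def)
  then show "expectation (\<lambda>\<omega>. f (X \<omega>) * g (Y \<omega>)) = expectation (\<lambda>\<omega>. f (X \<omega>)) * expectation (\<lambda>\<omega>. g (Y \<omega>))"
    "integrable M (\<lambda>\<omega>. f (X \<omega>) * g (Y \<omega>))"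
    using assms by (auto intro: indep_var_lebesgue_integral indep_var_integrable)
qed

text \<open>Let \<open>Y = W - \<xi>\<^sub>i / \<surd>n\<close>, which is independent of \<open>\<xi>\<^sub>i\<close>. Expanding \<open>F W\<close> about \<open>Y\<close> and using mean 0 and
variance 1, \<open>\<surd>n * E (\<xi>\<^sub>i * F W)\<close> equals \<open>E (F1 Y)\<close> up to \<open>L * E \<bar>\<xi>\<^sub>i\<bar>\<^sup>3 / \<surd>n\<close>. Replacing \<open>F1 Y\<close>
by \<open>F1 W\<close> costs another \<open>2 * L * E \<bar>\<xi>\<^sub>i\<bar> / \<surd>n\<close>, and \<open>E \<bar>\<xi>\<^sub>i\<bar> \<le> 1\<close>. Averaging over \<open>i\<close> bounds
\<open>E (F1 W - W * F W)\<close>, which is \<open>E (h W)\<close> minus the normal expectation of \<open>h\<close>.\<close>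

lemma (in prob_space) Stein_bound:
  fixes \<xi> :: "nat \<Rightarrow> 'a \<Rightarrow> real"
  assumes n: "n \<ge> 1" and indep: "indep_vars (\<lambda>_. borel) \<xi> {..<n}"
    and int3: "\<And>i. i < n \<Longrightarrow> integrable M (\<lambda>\<omega>. \<bar>\<xi> i \<omega>\<bar> ^ 3)"
    and mean: "\<And>i. i < n \<Longrightarrow> expectation (\<xi> i) = 0"
    and var: "\<And>i. i < n \<Longrightarrow> expectation (\<lambda>\<omega>. (\<xi> i \<omega>)\<^sup>2) = 1"
    and third: "\<And>i. i < n \<Longrightarrow> expectation (\<lambda>\<omega>. \<bar>\<xi> i \<omega>\<bar> ^ 3) \<le> \<beta>"
    and lip: "L-lipschitz_on UNIV h" and bdd: "\<And>x. \<bar>h x\<bar> \<le> C"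
  shows "\<bar>expectation (\<lambda>\<omega>. h ((\<Sum>i<n. \<xi> i \<omega>) / sqrt n)) - (\<integral>t. \<phi> t * h t \<partial>lborel)\<bar> \<le> L / sqrt n * (2 + \<beta>)"
proof -
  define s where "s = sqrt (real n)"
  have s: "s > 0" "s * s = real n" using n by (auto simp: s_def)
  define m where "m = (\<integral>t. \<phi> t * h t \<partial>lborel)"
  have L: "L \<ge> 0" using lip by (rule lipschitz_on_nonneg)
  obtain F F1 where F: "\<And>x. (F has_real_derivative F1 x) (at x)" "\<And>x. F1 x = x * F x + h x - m"
    "\<And>x. \<bar>F x\<bar> \<le> L" "\<And>x y. \<bar>F1 y - F1 x\<bar> \<le> 2 * L * \<bar>y - x\<bar>"
    using Stein_solution[OF lip bdd] unfolding m_def by blast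
  have "continuous_on UNIV h" using lip by (rule lipschitz_on_continuous_on)
  then have [measurable]: "h \<in> borel_measurable borel" by (rule borel_measurable_continuous_onI)
  have "continuous_on UNIV F" using F(1) DERIV_isCont by (intro continuous_at_imp_continuous_on) blast
  then have [measurable]: "F \<in> borel_measurable borel" by (rule borel_measurable_continuous_onI)
  have "F1 = (\<lambda>x. x * F x + h x - m)" using F(2) by auto
  then have [measurable]: "F1 \<in> borel_measurable borel" by simp
  have \<xi>[measurable]: "\<xi> i \<in> borel_measurable M" if "i < n" for i using indep that by (auto simp: indep_vars_def)
  have intF: "integrable M (\<lambda>\<omega>. F (Y \<omega>))" if "Y \<in> borel_measurable M" for Y
    using that F(3) by (intro integrable_const_bound[where B = L]) auto
  have inth: "integrable M (\<lambda>\<omega>. h (Y \<omega>))" if "Y \<in> borel_measurable M" for Y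
    using that bdd by (intro integrable_const_bound[where B = C]) auto
  have intYF: "integrable M (\<lambda>\<omega>. Y \<omega> * F (Y' \<omega>))" if "integrable M Y" "Y' \<in> borel_measurable M" for Y Y'
  proof (rule Bochner_Integration.integrable_bound)
    show "integrable M (\<lambda>\<omega>. L * Y \<omega>)" using that by simp
    show "AE x in M. norm (Y x * F (Y' x)) \<le> norm (L * Y x)"
    proof (rule AE_I2)
      fix x have "\<bar>Y x\<bar> * \<bar>F (Y' x)\<bar> \<le> \<bar>Y x\<bar> * L" using F(3) by (intro mult_left_mono) auto
      then show "norm (Y x * F (Y' x)) \<le> norm (L * Y x)" using L by (simp add: abs_mult mult.commute)
    qed
  qed (use that in measurable)
  have intF1: "integrable M (\<lambda>\<omega>. F1 (Y \<omega>))" if "integrable M Y" for Y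
    using intYF[OF that] inth[of Y] that unfolding F(2) by auto
  have int1: "integrable M (\<xi> i)" if "i < n" for i
  proof (rule Bochner_Integration.integrable_bound)
    show "integrable M (\<lambda>\<omega>. 1 + \<bar>\<xi> i \<omega>\<bar> ^ 3)" using int3[OF that] by auto
    have "\<bar>x\<bar> \<le> 1 + \<bar>x\<bar> ^ 3" for x :: real
    proof (cases "1 \<le> \<bar>x\<bar>")
      case True
      then show ?thesis using power_increasing[of 1 3 "\<bar>x\<bar>"] by simp
    next
      case False
      then show ?thesis using zero_le_power[of "\<bar>x\<bar>" 3] by linarith
    qed
    then show "AE x in M. norm (\<xi> i x) \<le> norm (1 + \<bar>\<xi> i x\<bar> ^ 3)" by (auto simp: abs_of_nonneg)
  qed (use that in simp)
  have int2: "integrable M (\<lambda>\<omega>. (\<xi> i \<omega>)\<^sup>2)" if "i < n" for i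
  proof (rule Bochner_Integration.integrable_bound)
    show "integrable M (\<lambda>\<omega>. 1 + \<bar>\<xi> i \<omega>\<bar> ^ 3)" using int3[OF that] by auto
    have "x\<^sup>2 \<le> 1 + \<bar>x\<bar> ^ 3" for x :: real
    proof (cases "1 \<le> \<bar>x\<bar>")
      case True
      then show ?thesis using power_increasing[of 2 3 "\<bar>x\<bar>"] by simp
    next
      case False
      then have "\<bar>x\<bar>\<^sup>2 \<le> 1" by (intro power_le_one) auto
      then show ?thesis using zero_le_power[of "\<bar>x\<bar>" 3] by (simp only: power2_abs) linarith
    qed
    then show "AE x in M. norm ((\<xi> i x)\<^sup>2) \<le> norm (1 + \<bar>\<xi> i x\<bar> ^ 3)" by (auto simp: abs_of_nonneg)
  qed (use that in simp)
  have abs1: "expectation (\<lambda>\<omega>. \<bar>\<xi> i \<omega>\<bar>) \<le> 1" if "i < n" for i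
  proof -
    have "expectation (\<lambda>\<omega>. \<bar>\<xi> i \<omega>\<bar>) \<le> expectation (\<lambda>\<omega>. (1 + (\<xi> i \<omega>)\<^sup>2) / 2)"
    proof (rule integral_mono)
      fix \<omega> show "\<bar>\<xi> i \<omega>\<bar> \<le> (1 + (\<xi> i \<omega>)\<^sup>2) / 2"
        using zero_le_power2[of "\<bar>\<xi> i \<omega>\<bar> - 1"] by (simp add: power2_diff)
    qed (use int1[OF that] int2[OF that] in auto)
    also have "\<dots> = 1" using int2[OF that] var[OF that] by (simp add: prob_space)
    finally show ?thesis .
  qed
  define W where "W = (\<lambda>\<omega>. (\<Sum>i<n. \<xi> i \<omega>) / s)"
  have W[measurable]: "W \<in> borel_measurable M" unfolding W_def using \<xi> by simp
  have intW: "integrable M W" unfolding W_def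
    by (intro integrable_divide Bochner_Integration.integrable_sum int1) auto
  have each: "\<bar>s * expectation (\<lambda>\<omega>. \<xi> i \<omega> * F (W \<omega>)) - expectation (\<lambda>\<omega>. F1 (W \<omega>))\<bar> \<le> L / s * (2 + \<beta>)"
    if i: "i < n" for i
  proof -
    note [measurable] = \<xi>[OF i]
    define R where "R = (\<lambda>\<omega>. \<Sum>j\<in>{..<n} - {i}. \<xi> j \<omega>)"
    define Y where "Y = (\<lambda>\<omega>. R \<omega> / s)"
    have intR: "integrable M R" unfolding R_def by (intro Bochner_Integration.integrable_sum int1) auto
    then have [measurable]: "R \<in> borel_measurable M" by auto
    have intY: "integrable M Y" unfolding Y_def using intR by auto
    then have [measurable]: "Y \<in> borel_measurable M" by auto
    have WY: "W \<omega> = Y \<omega> + \<xi> i \<omega> / s" for \<omega>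
      using i sum.remove[of "{..<n}" i "\<lambda>j. \<xi> j \<omega>"] by (simp add: W_def Y_def R_def add_divide_distrib)
    have ind: "indep_var borel (\<xi> i) borel R" unfolding R_def
      by (rule indep_vars_sum) (use indep i in \<open>auto simp: insert_absorb\<close>)
    have "expectation (\<lambda>\<omega>. (\<lambda>x. x) (\<xi> i \<omega>) * (\<lambda>r. F (r / s)) (R \<omega>)) = expectation (\<lambda>\<omega>. (\<lambda>x. x) (\<xi> i \<omega>)) * expectation (\<lambda>\<omega>. (\<lambda>r. F (r / s)) (R \<omega>))"
      by (rule expectation_indep_mult(1)[OF ind]) (use int1[OF i] intF[of Y] in \<open>auto simp: Y_def\<close>)
    then have e1: "expectation (\<lambda>\<omega>. \<xi> i \<omega> * F (Y \<omega>)) = 0" using mean[OF i] by (simp add: Y_def)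
    have "expectation (\<lambda>\<omega>. (\<lambda>x. x\<^sup>2) (\<xi> i \<omega>) * (\<lambda>r. F1 (r / s)) (R \<omega>)) = expectation (\<lambda>\<omega>. (\<lambda>x. x\<^sup>2) (\<xi> i \<omega>)) * expectation (\<lambda>\<omega>. (\<lambda>r. F1 (r / s)) (R \<omega>))"
      by (rule expectation_indep_mult(1)[OF ind]) (use int2[OF i] intF1[OF intY] in \<open>auto simp: Y_def\<close>)
    moreover have "integrable M (\<lambda>\<omega>. (\<lambda>x. x\<^sup>2) (\<xi> i \<omega>) * (\<lambda>r. F1 (r / s)) (R \<omega>))"
      by (rule expectation_indep_mult(2)[OF ind]) (use int2[OF i] intF1[OF intY] in \<open>auto simp: Y_def\<close>)
    ultimately have e2: "expectation (\<lambda>\<omega>. (\<xi> i \<omega>)\<^sup>2 * F1 (Y \<omega>)) = expectation (\<lambda>\<omega>. F1 (Y \<omega>))"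
      and int2F1: "integrable M (\<lambda>\<omega>. (\<xi> i \<omega>)\<^sup>2 * F1 (Y \<omega>))" using var[OF i] by (auto simp: Y_def)
    have "\<bar>s * expectation (\<lambda>\<omega>. \<xi> i \<omega> * F (W \<omega>)) - expectation (\<lambda>\<omega>. F1 (Y \<omega>))\<bar> =
        \<bar>expectation (\<lambda>\<omega>. s * (\<xi> i \<omega> * F (W \<omega>)) - s * (\<xi> i \<omega> * F (Y \<omega>)) - (\<xi> i \<omega>)\<^sup>2 * F1 (Y \<omega>))\<bar>"
      using e1 e2 int2F1 intYF[OF int1[OF i]] by simp
    also have "\<dots> \<le> expectation (\<lambda>\<omega>. \<bar>s * (\<xi> i \<omega> * F (W \<omega>)) - s * (\<xi> i \<omega> * F (Y \<omega>)) - (\<xi> i \<omega>)\<^sup>2 * F1 (Y \<omega>)\<bar>)"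
      by (rule integral_abs_bound)
    also have "\<dots> \<le> expectation (\<lambda>\<omega>. L / s * \<bar>\<xi> i \<omega>\<bar> ^ 3)"
    proof (rule integral_mono)
      fix \<omega>
      have "s * (\<xi> i \<omega> * F (W \<omega>)) - s * (\<xi> i \<omega> * F (Y \<omega>)) - (\<xi> i \<omega>)\<^sup>2 * F1 (Y \<omega>) =
          s * \<xi> i \<omega> * (F (W \<omega>) - F (Y \<omega>) - (W \<omega> - Y \<omega>) * F1 (Y \<omega>))"
        using s(1) by (simp add: WY power2_eq_square algebra_simps)
      then have "\<bar>s * (\<xi> i \<omega> * F (W \<omega>)) - s * (\<xi> i \<omega> * F (Y \<omega>)) - (\<xi> i \<omega>)\<^sup>2 * F1 (Y \<omega>)\<bar> =
          s * \<bar>\<xi> i \<omega>\<bar> * \<bar>F (W \<omega>) - F (Y \<omega>) - (W \<omega> - Y \<omega>) * F1 (Y \<omega>)\<bar>"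
        using s(1) by (simp add: abs_mult)
      also have "\<dots> \<le> s * \<bar>\<xi> i \<omega>\<bar> * (L * (W \<omega> - Y \<omega>)\<^sup>2)"
        using s(1) by (intro mult_left_mono quadratic_remainder_bound F) auto
      also have "\<dots> = L / s * \<bar>\<xi> i \<omega>\<bar> ^ 3"
        using s(1) by (simp add: WY power2_eq_square power3_eq_cube field_simps)
      finally show "\<bar>s * (\<xi> i \<omega> * F (W \<omega>)) - s * (\<xi> i \<omega> * F (Y \<omega>)) - (\<xi> i \<omega>)\<^sup>2 * F1 (Y \<omega>)\<bar> \<le> L / s * \<bar>\<xi> i \<omega>\<bar> ^ 3" .
    qed (use int3[OF i] int2F1 intYF[OF int1[OF i]] in auto)
    also have "\<dots> \<le> L / s * \<beta>" using third[OF i] L s(1) by (simp add: mult_left_mono divide_right_mono)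
    finally have A: "\<bar>s * expectation (\<lambda>\<omega>. \<xi> i \<omega> * F (W \<omega>)) - expectation (\<lambda>\<omega>. F1 (Y \<omega>))\<bar> \<le> L / s * \<beta>" .
    have "\<bar>expectation (\<lambda>\<omega>. F1 (W \<omega>)) - expectation (\<lambda>\<omega>. F1 (Y \<omega>))\<bar> = \<bar>expectation (\<lambda>\<omega>. F1 (W \<omega>) - F1 (Y \<omega>))\<bar>"
      using intF1[OF intW] intF1[OF intY] by simp
    also have "\<dots> \<le> expectation (\<lambda>\<omega>. \<bar>F1 (W \<omega>) - F1 (Y \<omega>)\<bar>)" by (rule integral_abs_bound)
    also have "\<dots> \<le> expectation (\<lambda>\<omega>. 2 * L / s * \<bar>\<xi> i \<omega>\<bar>)"
    proof (rule integral_mono)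
      fix \<omega> show "\<bar>F1 (W \<omega>) - F1 (Y \<omega>)\<bar> \<le> 2 * L / s * \<bar>\<xi> i \<omega>\<bar>"
        using F(4)[of "W \<omega>" "Y \<omega>"] s(1) by (simp add: WY abs_divide)
    qed (use int1[OF i] intF1[OF intW] intF1[OF intY] in auto)
    also have "\<dots> \<le> 2 * L / s * 1" 
      unfolding integral_mult_right_zero using abs1[OF i] L s(1) by (intro mult_left_mono) auto
    finally have "\<bar>expectation (\<lambda>\<omega>. F1 (W \<omega>)) - expectation (\<lambda>\<omega>. F1 (Y \<omega>))\<bar> \<le> 2 * L / s" by simp
    moreover have "L / s * (2 + \<beta>) = 2 * L / s + L / s * \<beta>" by (simp add: algebra_simps)
    ultimately show ?thesis using A by linarith
  qed
  have "expectation (\<lambda>\<omega>. h (W \<omega>)) - m = expectation (\<lambda>\<omega>. F1 (W \<omega>)) - expectation (\<lambda>\<omega>. W \<omega> * F (W \<omega>))"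
  proof -
    have "expectation (\<lambda>\<omega>. F1 (W \<omega>)) - expectation (\<lambda>\<omega>. W \<omega> * F (W \<omega>)) = expectation (\<lambda>\<omega>. F1 (W \<omega>) - W \<omega> * F (W \<omega>))"
      using intF1[OF intW] intYF[OF intW W] by simp
    also have "\<dots> = expectation (\<lambda>\<omega>. h (W \<omega>) - m)" by (simp add: F(2))
    also have "\<dots> = expectation (\<lambda>\<omega>. h (W \<omega>)) - m" using inth[OF W] by (simp add: prob_space)
    finally show ?thesis by simp
  qed
  also have "expectation (\<lambda>\<omega>. W \<omega> * F (W \<omega>)) = (\<Sum>i<n. expectation (\<lambda>\<omega>. \<xi> i \<omega> * F (W \<omega>))) / s"
  proof -
    have "expectation (\<lambda>\<omega>. W \<omega> * F (W \<omega>)) = expectation (\<lambda>\<omega>. (\<Sum>i<n. \<xi> i \<omega> * F (W \<omega>)) / s)"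
      by (simp add: W_def sum_distrib_right)
    then show ?thesis using intYF[OF int1 W] by (simp add: Bochner_Integration.integral_sum)
  qed
  finally have diff: "expectation (\<lambda>\<omega>. h (W \<omega>)) - m =
      expectation (\<lambda>\<omega>. F1 (W \<omega>)) - (\<Sum>i<n. expectation (\<lambda>\<omega>. \<xi> i \<omega> * F (W \<omega>))) / s" .
  have "real n * ((\<Sum>i<n. expectation (\<lambda>\<omega>. \<xi> i \<omega> * F (W \<omega>))) / s) = s * (\<Sum>i<n. expectation (\<lambda>\<omega>. \<xi> i \<omega> * F (W \<omega>)))"
    unfolding s(2)[symmetric] using s(1) by simp
  then have "real n * (expectation (\<lambda>\<omega>. h (W \<omega>)) - m) =
      - (\<Sum>i<n. s * expectation (\<lambda>\<omega>. \<xi> i \<omega> * F (W \<omega>)) - expectation (\<lambda>\<omega>. F1 (W \<omega>)))"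
    unfolding diff by (simp add: sum_subtractf sum_distrib_left right_diff_distrib)
  then have "\<bar>real n * (expectation (\<lambda>\<omega>. h (W \<omega>)) - m)\<bar> =
      \<bar>- (\<Sum>i<n. s * expectation (\<lambda>\<omega>. \<xi> i \<omega> * F (W \<omega>)) - expectation (\<lambda>\<omega>. F1 (W \<omega>)))\<bar>"
    by (rule arg_cong)
  then have "real n * \<bar>expectation (\<lambda>\<omega>. h (W \<omega>)) - m\<bar> =
      \<bar>\<Sum>i<n. s * expectation (\<lambda>\<omega>. \<xi> i \<omega> * F (W \<omega>)) - expectation (\<lambda>\<omega>. F1 (W \<omega>))\<bar>"
    by (simp only: abs_mult abs_minus_cancel abs_of_nat)
  also have "\<dots> \<le> (\<Sum>i<n. \<bar>s * expectation (\<lambda>\<omega>. \<xi> i \<omega> * F (W \<omega>)) - expectation (\<lambda>\<omega>. F1 (W \<omega>))\<bar>)"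
    by (rule sum_abs)
  also have "\<dots> \<le> (\<Sum>i<n. L / s * (2 + \<beta>))" by (rule sum_mono) (simp add: each del: times_divide_eq_left)
  finally have "real n * \<bar>expectation (\<lambda>\<omega>. h (W \<omega>)) - m\<bar> \<le> real n * (L / s * (2 + \<beta>))" by simp
  then have "\<bar>expectation (\<lambda>\<omega>. h (W \<omega>)) - m\<bar> \<le> L / s * (2 + \<beta>)"
    by (rule mult_left_le_imp_le) (use n in simp)
  then show ?thesis by (simp add: W_def m_def s_def)
qed

section \<open>One-parameter exponential families\<close>

text \<open>Witnesses for the derivatives, instead of iterates of \<open>deriv\<close>, make closure under arithmetic
operations a matter of the derivative rules.\<close>

definition thrice_differentiable_on :: "real set \<Rightarrow> (real \<Rightarrow> real) \<Rightarrow> bool" where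
  "thrice_differentiable_on U g \<longleftrightarrow> (\<exists>g1 g2. \<forall>t\<in>U. (g has_real_derivative g1 t) (at t) \<and>
     (g1 has_real_derivative g2 t) (at t) \<and> g2 field_differentiable (at t))"

lemma Ck_on_3_imp_thrice_differentiable:
  assumes "Ck_on 3 U g" shows "thrice_differentiable_on U g"
proof -
  have "((deriv ^^ j) g has_real_derivative (deriv ^^ Suc j) g t) (at t)" if "j < 3" "t \<in> U" for j t
    using assms that by (simp add: Ck_on_def DERIV_deriv_iff_field_differentiable)
  from this[of 0] this[of 1] this[of 2] show ?thesis
    unfolding thrice_differentiable_on_def
    by (intro exI[of _ "deriv g"] exI[of _ "(deriv ^^ 2) g"])
       (auto simp: numeral_2_eq_2 field_differentiable_def)
qed

lemma thrice_differentiable_imp_deriv: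
  assumes "thrice_differentiable_on U g" "open U" "t \<in> U"
  shows "(g has_real_derivative deriv g t) (at t)"
    and "(deriv g has_real_derivative (deriv ^^ 2) g t) (at t)"
    and "(deriv ^^ 2) g field_differentiable (at t)"
proof -
  obtain g1 g2 where g: "\<And>t. t \<in> U \<Longrightarrow> (g has_real_derivative g1 t) (at t)"
    "\<And>t. t \<in> U \<Longrightarrow> (g1 has_real_derivative g2 t) (at t)" "\<And>t. t \<in> U \<Longrightarrow> g2 field_differentiable (at t)"
    using assms(1) by (auto simp: thrice_differentiable_on_def)
  have 1: "deriv g t = g1 t" if "t \<in> U" for t using g(1)[OF that] by (rule DERIV_imp_deriv)
  have 2: "(deriv g has_real_derivative g2 t) (at t)" if "t \<in> U" for t
    using g(2)[OF that] by (rule has_field_derivative_transform_within_open[OF _ assms(2) that]) (simp add: 1)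
  have 3: "(deriv ^^ 2) g t = g2 t" if "t \<in> U" for t using 2[OF that] by (simp add: numeral_2_eq_2 DERIV_imp_deriv)
  show "(g has_real_derivative deriv g t) (at t)" using g(1) 1 assms(3) by simp
  show "(deriv g has_real_derivative (deriv ^^ 2) g t) (at t)" using 2 3 assms(3) by simp
  obtain c where "(g2 has_real_derivative c) (at t)" using g(3)[OF assms(3)] by (auto simp: field_differentiable_def)
  then have "((deriv ^^ 2) g has_real_derivative c) (at t)"
    by (rule has_field_derivative_transform_within_open[OF _ assms(2,3)]) (simp add: 3)
  then show "(deriv ^^ 2) g field_differentiable (at t)" by (auto simp: field_differentiable_def)
qed

lemma thrice_differentiable_ln:
  assumes "thrice_differentiable_on U u" "\<And>t. t \<in> U \<Longrightarrow> u t > 0"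
  shows "thrice_differentiable_on U (\<lambda>t. ln (u t))"
proof -
  obtain u1 u2 where u: "\<And>t. t \<in> U \<Longrightarrow> (u has_real_derivative u1 t) (at t)"
    "\<And>t. t \<in> U \<Longrightarrow> (u1 has_real_derivative u2 t) (at t)" "\<And>t. t \<in> U \<Longrightarrow> u2 field_differentiable (at t)"
    using assms(1) by (auto simp: thrice_differentiable_on_def)
  have diff: "u field_differentiable (at t)" "u1 field_differentiable (at t)" if "t \<in> U" for t
    using u that by (auto simp: field_differentiable_def)
  show ?thesis unfolding thrice_differentiable_on_def
  proof (intro exI ballI conjI)
    fix t assume t: "t \<in> U"
    then have pos: "u t > 0" "u t \<noteq> 0" using assms(2)[OF t] by auto
    show "((\<lambda>t. ln (u t)) has_real_derivative u1 t / u t) (at t)"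
      using pos u(1)[OF t] by (auto intro!: derivative_eq_intros)
    show "((\<lambda>t. u1 t / u t) has_real_derivative (u2 t * u t - u1 t * u1 t) / (u t * u t)) (at t)"
      using pos u(1,2)[OF t] by (intro DERIV_divide)
    show "(\<lambda>t. (u2 t * u t - u1 t * u1 t) / (u t * u t)) field_differentiable (at t)"
      using pos u(3)[OF t] diff[OF t]
      by (intro field_differentiable_divide field_differentiable_diff field_differentiable_mult) auto
  qed
qed

lemma thrice_differentiable_affine:
  assumes "thrice_differentiable_on U g" "thrice_differentiable_on U h"
  shows "thrice_differentiable_on U (\<lambda>t. c * g t + d * h t + e)"
proof -
  obtain g1 g2 h1 h2 where gh: "\<forall>t\<in>U. (g has_real_derivative g1 t) (at t) \<and>
     (g1 has_real_derivative g2 t) (at t) \<and> g2 field_differentiable (at t)"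
    "\<forall>t\<in>U. (h has_real_derivative h1 t) (at t) \<and>
     (h1 has_real_derivative h2 t) (at t) \<and> h2 field_differentiable (at t)"
    using assms unfolding thrice_differentiable_on_def by blast
  show ?thesis unfolding thrice_differentiable_on_def
    using gh by (intro exI[of _ "\<lambda>t. c * g1 t + d * h1 t"] exI[of _ "\<lambda>t. c * g2 t + d * h2 t"])
      (auto intro!: derivative_eq_intros field_differentiable_add field_differentiable_mult)
qed

locale regular_exp_family =
  fixes a b :: ereal and k A T S :: "real \<Rightarrow> real" and B :: "real set" and \<mu> :: "real measure"
    and f :: "real \<Rightarrow> real \<Rightarrow> real" and \<Theta> :: "real set" and D :: "real \<Rightarrow> real"
  assumes f_def: "f = exp_family k A T S B" and Theta_def: "\<Theta> = einterval a b"
    and D_def: "D = (\<lambda>\<theta>. deriv A \<theta> / deriv k \<theta>)"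
    and ab: "a < b" and B: "B \<in> sets \<mu>" and family: "pdf_family \<mu> \<Theta> f"
    and k': "\<And>\<theta>. \<theta> \<in> \<Theta> \<Longrightarrow> deriv k \<theta> \<noteq> 0"
    and R1: "cond_R1 f \<Theta>" and R2: "cond_R2 \<mu> f \<Theta>" and R4: "cond_R4 \<mu> f \<Theta>"
begin

lemma open_Theta: "open \<Theta>" by (simp add: Theta_def)

lemma f_in: "x \<in> B \<Longrightarrow> f \<theta> x = exp (k \<theta> * T x - A \<theta> + S x)"
  and f_out: "x \<notin> B \<Longrightarrow> f \<theta> x = 0"
  by (simp_all add: f_def exp_family_def)

lemma f_pos: "x \<in> B \<Longrightarrow> 0 < f \<theta> x"
  by (simp add: f_in)

lemma ln_f_in: "x \<in> B \<Longrightarrow> ln (f \<theta> x) = k \<theta> * T x - A \<theta> + S x"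
  by (simp add: f_in)

lemma f_nonneg: "0 \<le> f \<theta> x" by (simp add: f_def exp_family_def)

lemma f_measurable[measurable]: "\<theta> \<in> \<Theta> \<Longrightarrow> f \<theta> \<in> borel_measurable \<mu>"
  using family by (simp add: pdf_family_def)

lemma nn_integral_f: "\<theta> \<in> \<Theta> \<Longrightarrow> (\<integral>\<^sup>+x. ennreal (f \<theta> x) \<partial>\<mu>) = 1"
  using family by (simp add: pdf_family_def)

lemma integrable_f: "\<theta> \<in> \<Theta> \<Longrightarrow> integrable \<mu> (f \<theta>)"
  by (rule integrableI_nonneg) (auto simp: nn_integral_f f_nonneg)

lemma integral_f: "\<theta> \<in> \<Theta> \<Longrightarrow> (\<integral>x. f \<theta> x \<partial>\<mu>) = 1"
  by (subst integral_eq_nn_integral) (auto simp: nn_integral_f f_nonneg)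

lemma Theta_two_points: obtains \<theta> \<theta>' where "\<theta> \<in> \<Theta>" "\<theta>' \<in> \<Theta>" "\<theta> < \<theta>'"
proof -
  obtain \<theta> where 1: "a < ereal \<theta>" "ereal \<theta> < b" using ereal_dense2[OF ab] by blast
  obtain \<theta>' where "ereal \<theta> < ereal \<theta>'" "ereal \<theta>' < b" using ereal_dense2[OF 1(2)] by blast
  then show thesis using 1 by (intro that[of \<theta> \<theta>']) (auto simp: Theta_def einterval_def intro: less_trans)
qed

text \<open>If \<open>T\<close> were constant on \<open>B\<close>, then all densities would be proportional, hence equal because
they are normalized, against identifiability.\<close>

lemma T_not_constant: obtains x y where "x \<in> B" "y \<in> B" "T x \<noteq> T y"
proof (cases "\<exists>x\<in>B. \<exists>y\<in>B. T x \<noteq> T y")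
  case True
  then show ?thesis using that by blast
next
  case False
  then obtain c where c: "\<And>x. x \<in> B \<Longrightarrow> T x = c" by metis
  obtain \<theta> \<theta>' where \<theta>: "\<theta> \<in> \<Theta>" "\<theta>' \<in> \<Theta>" "\<theta> < \<theta>'" by (rule Theta_two_points)
  define r where "r = exp ((k \<theta> * c - A \<theta>) - (k \<theta>' * c - A \<theta>'))"
  have f: "f \<theta> x = r * f \<theta>' x" for x
    by (cases "x \<in> B") (auto simp: f_in f_out c r_def algebra_simps simp flip: exp_add)
  have "(\<integral>x. f \<theta> x \<partial>\<mu>) = r * (\<integral>x. f \<theta>' x \<partial>\<mu>)" unfolding f by simp
  then have "r = 1" using integral_f \<theta> by simp
  then have "f \<theta> x = f \<theta>' x" for x using f by simp
  then show ?thesis using R1 \<theta> unfolding cond_R1_def by (metis less_irrefl)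
qed

text \<open>The density is smooth in the parameter, hence so is \<open>k t * T x - A t\<close> for every \<open>x\<close> in \<open>B\<close>. Two
points at which \<open>T\<close> differs let one solve for \<open>k\<close> and then for \<open>A\<close>.\<close>

lemma thrice_differentiable_k_A: "thrice_differentiable_on \<Theta> k" "thrice_differentiable_on \<Theta> A"
proof -
  have ln_f: "thrice_differentiable_on \<Theta> (\<lambda>t. k t * T x - A t + S x)" if "x \<in> B" for x
  proof -
    have "thrice_differentiable_on \<Theta> (\<lambda>t. f t x)"
      using R2 by (intro Ck_on_3_imp_thrice_differentiable) (simp add: cond_R2_def)
    from thrice_differentiable_ln[OF this] show ?thesis using that by (simp add: ln_f_in f_in)
  qed
  obtain x y where xy: "x \<in> B" "y \<in> B" "T x \<noteq> T y" by (rule T_not_constant)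
  define c where "c = 1 / (T x - T y)"
  have "k = (\<lambda>t. c * (k t * T x - A t + S x) + (- c) * (k t * T y - A t + S y) + - c * (S x - S y))"
  proof
    fix t
    have "k t = c * (k t * (T x - T y))" using xy(3) by (simp add: c_def)
    then show "k t = c * (k t * T x - A t + S x) + (- c) * (k t * T y - A t + S y) + - c * (S x - S y)"
      by (simp add: algebra_simps)
  qed
  then show k: "thrice_differentiable_on \<Theta> k"
    using thrice_differentiable_affine[OF ln_f[OF xy(1)] ln_f[OF xy(2)], of c "- c" "- c * (S x - S y)"] by argo
  have "A = (\<lambda>t. T x * k t + (- 1) * (k t * T x - A t + S x) + S x)" by (auto simp: algebra_simps)
  then show "thrice_differentiable_on \<Theta> A"
    using thrice_differentiable_affine[OF k ln_f[OF xy(1)], of "T x" "- 1" "S x"] by argo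
qed

lemmas DERIV_k = thrice_differentiable_imp_deriv[OF thrice_differentiable_k_A(1) open_Theta]
lemmas DERIV_A = thrice_differentiable_imp_deriv[OF thrice_differentiable_k_A(2) open_Theta]

text \<open>The derivative of \<open>D\<close> on \<open>\<Theta>\<close>, by the quotient rule.\<close>

definition D1 :: "real \<Rightarrow> real" where
  "D1 t = ((deriv ^^ 2) A t * deriv k t - deriv A t * (deriv ^^ 2) k t) / (deriv k t * deriv k t)"

lemma DERIV_D: "t \<in> \<Theta> \<Longrightarrow> (D has_real_derivative D1 t) (at t)"
  unfolding D_def D1_def using k'[of t] by (intro DERIV_divide DERIV_k DERIV_A)

lemma DERIV_deriv_D: assumes "t \<in> \<Theta>" shows "(D1 has_real_derivative (deriv ^^ 2) D t) (at t)"
proof -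
  have "deriv k field_differentiable (at t)" "deriv A field_differentiable (at t)"
    using DERIV_k(2)[OF assms] DERIV_A(2)[OF assms] by (auto simp: field_differentiable_def)
  then have "D1 field_differentiable (at t)"
    unfolding D1_def[abs_def] using assms k' DERIV_k DERIV_A
    by (intro field_differentiable_divide field_differentiable_diff field_differentiable_mult) auto
  then have D1: "(D1 has_real_derivative deriv D1 t) (at t)" by (simp add: DERIV_deriv_iff_field_differentiable)
  then have "(deriv D has_real_derivative deriv D1 t) (at t)"
    by (rule has_field_derivative_transform_within_open[OF _ open_Theta assms])
       (simp add: DERIV_imp_deriv[OF DERIV_D])
  then have "(deriv ^^ 2) D t = deriv D1 t" by (simp add: numeral_2_eq_2 DERIV_imp_deriv)
  then show ?thesis using D1 by simp
qed

text \<open>Outside \<open>B\<close> the statistic \<open>T\<close> is arbitrary; cutting it off makes it measurable.\<close>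

definition T0 :: "real \<Rightarrow> real" where "T0 x = indicator B x * T x"

lemma DERIV_f:
  assumes "t \<in> \<Theta>"
  shows "((\<lambda>t. f t x) has_real_derivative (deriv k t * T0 x - deriv A t) * f t x) (at t)"
proof (cases "x \<in> B")
  case True
  then show ?thesis unfolding T0_def f_in[OF True]
    using DERIV_k(1)[OF assms] DERIV_A(1)[OF assms] by (auto intro!: derivative_eq_intros)
next
  case False
  then show ?thesis by (simp add: f_out)
qed

lemma deriv_f: "t \<in> \<Theta> \<Longrightarrow> deriv (\<lambda>t. f t x) t = (deriv k t * T0 x - deriv A t) * f t x"
  by (rule DERIV_imp_deriv[OF DERIV_f])

lemma deriv2_f:
  assumes "t \<in> \<Theta>"
  shows "(deriv ^^ 2) (\<lambda>t. f t x) t =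
    ((deriv ^^ 2) k t * T0 x - (deriv ^^ 2) A t) * f t x + (deriv k t * T0 x - deriv A t)\<^sup>2 * f t x"
proof -
  have "((\<lambda>t. (deriv k t * T0 x - deriv A t) * f t x) has_real_derivative
      ((deriv ^^ 2) k t * T0 x - (deriv ^^ 2) A t) * f t x + (deriv k t * T0 x - deriv A t)\<^sup>2 * f t x) (at t)"
    using DERIV_k(2)[OF assms] DERIV_A(2)[OF assms] DERIV_f[OF assms, of x]
    by (auto intro!: derivative_eq_intros simp: power2_eq_square algebra_simps)
  then have "(deriv (\<lambda>t. f t x) has_real_derivative
      ((deriv ^^ 2) k t * T0 x - (deriv ^^ 2) A t) * f t x + (deriv k t * T0 x - deriv A t)\<^sup>2 * f t x) (at t)"
    by (rule has_field_derivative_transform_within_open[OF _ open_Theta assms]) (simp add: deriv_f)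
  then show ?thesis by (simp add: numeral_2_eq_2 DERIV_imp_deriv)
qed

lemma integrable_deriv_f:
  assumes "t \<in> \<Theta>" "j \<le> 3" shows "integrable \<mu> (\<lambda>x. (deriv ^^ j) (\<lambda>t. f t x) t)"
  using R2 assms by (simp add: cond_R2_def)

text \<open>These integrals are the first and second derivatives of the constant \<open>\<integral> f = 1\<close>.\<close>

lemma integral_deriv_f:
  assumes t: "t \<in> \<Theta>" and "j < 2" shows "(\<integral>x. (deriv ^^ Suc j) (\<lambda>t. f t x) t \<partial>\<mu>) = 0"
proof -
  have step: "(\<integral>x. (deriv ^^ Suc j) (\<lambda>t. f t x) t \<partial>\<mu>) = 0"
    if "\<And>s. s \<in> \<Theta> \<Longrightarrow> (\<integral>x. (deriv ^^ j) (\<lambda>t. f t x) s \<partial>\<mu>) = c" "j < 3" "t \<in> \<Theta>" for c t j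
  proof -
    have "((\<lambda>s. \<integral>x. (deriv ^^ j) (\<lambda>t. f t x) s \<partial>\<mu>) has_real_derivative (\<integral>x. (deriv ^^ Suc j) (\<lambda>t. f t x) t \<partial>\<mu>)) (at t)"
      using R2 that(2,3) unfolding cond_R2_def by blast
    then have "((\<lambda>s. c) has_real_derivative (\<integral>x. (deriv ^^ Suc j) (\<lambda>t. f t x) t \<partial>\<mu>)) (at t)"
      by (rule has_field_derivative_transform_within_open[OF _ open_Theta that(3)]) (rule that(1))
    then show ?thesis using DERIV_unique[OF _ DERIV_const] by blast
  qed
  have first: "(\<integral>x. (deriv ^^ Suc 0) (\<lambda>t. f t x) t \<partial>\<mu>) = 0" if "t \<in> \<Theta>" for t
    by (rule step[where c = 1]) (use that integral_f in auto)
  show ?thesis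
  proof (cases "j = 0")
    case True
    then show ?thesis using first[OF t] by simp
  next
    case False
    then have "j = Suc 0" using assms by simp
    then show ?thesis using step[of "Suc 0" 0 t, OF first _ t] by simp
  qed
qed

text \<open>On \<open>B\<close> the statistic can be recovered from the score \<open>f' / f = k' * T - A'\<close>, which is measurable.\<close>

lemma T0_measurable[measurable]: "T0 \<in> borel_measurable \<mu>"
proof -
  obtain \<theta> \<theta>' where \<theta>: "\<theta> \<in> \<Theta>" "\<theta>' \<in> \<Theta>" "\<theta> < \<theta>'" by (rule Theta_two_points)
  have [measurable]: "(\<lambda>x. deriv (\<lambda>t. f t x) \<theta>) \<in> borel_measurable \<mu>"
    using integrable_deriv_f[OF \<theta>(1), of 1] by auto
  note [measurable] = f_measurable[OF \<theta>(1)] B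
  have "T0 = (\<lambda>x. indicator B x * ((deriv (\<lambda>t. f t x) \<theta> / f \<theta> x + deriv A \<theta>) / deriv k \<theta>))"
  proof
    fix x
    show "T0 x = indicator B x * ((deriv (\<lambda>t. f t x) \<theta> / f \<theta> x + deriv A \<theta>) / deriv k \<theta>)"
      using k'[OF \<theta>(1)] f_pos[of x \<theta>] by (cases "x \<in> B") (auto simp: T0_def deriv_f[OF \<theta>(1)])
  qed
  also have "\<dots> \<in> borel_measurable \<mu>" by measurable
  finally show ?thesis .
qed

lemma integrable_T0_f: assumes "\<theta> \<in> \<Theta>" shows "integrable \<mu> (\<lambda>x. T0 x * f \<theta> x)"
proof -
  have "integrable \<mu> (\<lambda>x. (deriv (\<lambda>t. f t x) \<theta> + deriv A \<theta> * f \<theta> x) / deriv k \<theta>)"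
    using integrable_deriv_f[OF assms, of 1] integrable_f[OF assms] by auto
  moreover have "(deriv (\<lambda>t. f t x) \<theta> + deriv A \<theta> * f \<theta> x) / deriv k \<theta> = T0 x * f \<theta> x" for x
    using k'[OF assms] by (simp add: deriv_f[OF assms] field_simps)
  ultimately show ?thesis by simp
qed

lemma integral_T0_f: assumes "\<theta> \<in> \<Theta>" shows "(\<integral>x. T0 x * f \<theta> x \<partial>\<mu>) = D \<theta>"
proof -
  have "0 = (\<integral>x. deriv k \<theta> * (T0 x * f \<theta> x) - deriv A \<theta> * f \<theta> x \<partial>\<mu>)"
    using integral_deriv_f[OF assms, of 0] by (simp add: deriv_f[OF assms] algebra_simps)
  also have "\<dots> = deriv k \<theta> * (\<integral>x. T0 x * f \<theta> x \<partial>\<mu>) - deriv A \<theta>"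
    using integrable_T0_f[OF assms] integrable_f[OF assms] by (simp add: integral_f[OF assms])
  finally show ?thesis using k'[OF assms] by (simp add: D_def field_simps)
qed

lemma score_second_moment:
  assumes "\<theta> \<in> \<Theta>"
  shows "integrable \<mu> (\<lambda>x. (deriv k \<theta> * T0 x - deriv A \<theta>)\<^sup>2 * f \<theta> x)" (is "integrable \<mu> ?g")
    and "(\<integral>x. (deriv k \<theta> * T0 x - deriv A \<theta>)\<^sup>2 * f \<theta> x \<partial>\<mu>) = (deriv ^^ 2) A \<theta> - (deriv ^^ 2) k \<theta> * D \<theta>"
proof -
  have eq: "?g x = (deriv ^^ 2) (\<lambda>t. f t x) \<theta> - ((deriv ^^ 2) k \<theta> * (T0 x * f \<theta> x) - (deriv ^^ 2) A \<theta> * f \<theta> x)" for x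
    by (simp add: deriv2_f[OF assms] algebra_simps)
  note int = integrable_deriv_f[OF assms, of 2] integrable_T0_f[OF assms] integrable_f[OF assms]
  show "integrable \<mu> ?g" unfolding eq using int by auto
  have "(\<integral>x. ?g x \<partial>\<mu>) = (\<integral>x. (deriv ^^ 2) (\<lambda>t. f t x) \<theta> \<partial>\<mu>) - ((deriv ^^ 2) k \<theta> * D \<theta> - (deriv ^^ 2) A \<theta>)"
    unfolding eq using int by (simp add: integral_T0_f[OF assms] integral_f[OF assms])
  then show "(\<integral>x. ?g x \<partial>\<mu>) = (deriv ^^ 2) A \<theta> - (deriv ^^ 2) k \<theta> * D \<theta>"
    using integral_deriv_f[OF assms, of 1] by (simp add: numeral_2_eq_2)
qed

lemma deriv_ln_f:
  assumes "\<theta> \<in> \<Theta>" shows "deriv (\<lambda>t. ln (f t x)) \<theta> = indicator B x * (deriv k \<theta> * T0 x - deriv A \<theta>)"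
proof (cases "x \<in> B")
  case True
  have "((\<lambda>t. ln (f t x)) has_real_derivative deriv k \<theta> * T x - deriv A \<theta>) (at \<theta>)"
    unfolding ln_f_in[OF True] using DERIV_k(1)[OF assms] DERIV_A(1)[OF assms] by (auto intro!: derivative_eq_intros)
  then show ?thesis using True by (simp add: DERIV_imp_deriv T0_def)
next
  case False
  then show ?thesis by (simp add: f_out)
qed

lemma fisher_info_eq:
  assumes "\<theta> \<in> \<Theta>" shows "fisher_info \<mu> f \<theta> = (deriv ^^ 2) A \<theta> - (deriv ^^ 2) k \<theta> * D \<theta>"
proof -
  note [measurable] = f_measurable[OF assms] B
  have "fisher_info \<mu> f \<theta> = (\<integral>x. f \<theta> x *\<^sub>R (indicator B x * (deriv k \<theta> * T0 x - deriv A \<theta>))\<^sup>2 \<partial>\<mu>)"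
    unfolding fisher_info_def deriv_ln_f[OF assms]
    by (subst integral_density) (auto simp: f_nonneg)
  also have "\<dots> = (\<integral>x. (deriv k \<theta> * T0 x - deriv A \<theta>)\<^sup>2 * f \<theta> x \<partial>\<mu>)"
    by (intro Bochner_Integration.integral_cong) (auto split: split_indicator simp: f_out)
  finally show ?thesis by (simp add: score_second_moment(2)[OF assms])
qed

lemma fisher_info_pos: "\<theta> \<in> \<Theta> \<Longrightarrow> 0 < fisher_info \<mu> f \<theta>"
  using R4 by (simp add: cond_R4_def)

lemma fisher_info_eq_D1: assumes "\<theta> \<in> \<Theta>" shows "fisher_info \<mu> f \<theta> = deriv k \<theta> * D1 \<theta>"
  using k'[OF assms] by (simp add: fisher_info_eq[OF assms] D1_def D_def field_simps)

lemma D1_nonzero: "\<theta> \<in> \<Theta> \<Longrightarrow> D1 \<theta> \<noteq> 0"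
  using fisher_info_pos[of \<theta>] fisher_info_eq_D1[of \<theta>] by auto

lemma between_Theta: assumes "x \<in> \<Theta>" "y \<in> \<Theta>" "x \<le> z" "z \<le> y" shows "z \<in> \<Theta>"
proof -
  have "a < ereal z" by (rule less_le_trans[of _ "ereal x"]) (use assms in \<open>simp_all add: Theta_def einterval_def\<close>)
  moreover have "ereal z < b" by (rule le_less_trans[of _ "ereal y"]) (use assms in \<open>simp_all add: Theta_def einterval_def\<close>)
  ultimately show ?thesis by (simp add: Theta_def einterval_def)
qed

lemma inj_on_D: "inj_on D \<Theta>"
proof (rule linorder_inj_onI)
  fix x y assume xy: "x < y" "x \<in> \<Theta>" "y \<in> \<Theta>"
  show "D x \<noteq> D y"
  proof
    assume eq: "D x = D y"
    have "\<exists>l z. x < z \<and> z < y \<and> (D has_real_derivative l) (at z) \<and> D y - D x = (y - x) * l"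
    proof (rule MVT[OF xy(1)])
      show "continuous_on {x..y} D"
      proof (intro continuous_at_imp_continuous_on ballI)
        fix z assume "z \<in> {x..y}"
        then have "z \<in> \<Theta>" using between_Theta[OF xy(2,3)] by simp
        then show "isCont D z" by (rule DERIV_isCont[OF DERIV_D])
      qed
      show "D differentiable at z" if "x < z" "z < y" for z
        using that DERIV_D[OF between_Theta[OF xy(2,3), of z]] by (auto simp: real_differentiable_def)
    qed
    then obtain l z where z: "x < z" "z < y" "(D has_real_derivative l) (at z)" "D y - D x = (y - x) * l" by blast
    have "z \<in> \<Theta>" using between_Theta[OF xy(2,3)] z by simp
    then have "l \<noteq> 0" using D1_nonzero DERIV_D[of z] z(3) DERIV_unique by blast
    then show False using eq z xy(1) by simp
  qed
qed auto

text \<open>Outside the range of \<open>D\<close> the value of \<open>inv_into\<close> is unspecified and depends on the argument in an uncontrolled way;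
the value 0 keeps the inverse measurable.\<close>

definition D_inv :: "real \<Rightarrow> real" where "D_inv y = (if y \<in> D ` \<Theta> then inv_into \<Theta> D y else 0)"

lemma D_inv: "\<theta> \<in> \<Theta> \<Longrightarrow> D_inv (D \<theta>) = \<theta>"
  by (simp add: D_inv_def inj_on_D)

text \<open>Sublevel sets are images of intervals under the continuous map \<open>D\<close>, hence intervals, up to the
complement of the range of \<open>D\<close>.\<close>

lemma D_inv_measurable[measurable]: "D_inv \<in> borel_measurable borel"
proof -
  have interval: "D ` (\<Theta> \<inter> {..c}) \<in> sets borel" "D ` \<Theta> \<in> sets borel" for c
  proof -
    have "continuous_on \<Theta> D" by (intro continuous_at_imp_continuous_on ballI DERIV_isCont[OF DERIV_D])
    moreover have "connected (\<Theta> \<inter> {..c})" "connected \<Theta>"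
      by (auto simp: is_interval_connected_1[symmetric] is_interval_1 intro: between_Theta)
    ultimately have "connected (D ` (\<Theta> \<inter> {..c}))" "connected (D ` \<Theta>)"
      by (auto intro!: connected_continuous_image intro: continuous_on_subset)
    then show "D ` (\<Theta> \<inter> {..c}) \<in> sets borel" "D ` \<Theta> \<in> sets borel"
      by (auto intro!: real_interval_borel_measurable simp: is_interval_connected_1)
  qed
  have "{y. D_inv y \<le> c} = D ` (\<Theta> \<inter> {..c}) \<union> (if 0 \<le> c then UNIV - D ` \<Theta> else {})" for c
  proof (rule set_eqI)
    fix y
    show "y \<in> {y. D_inv y \<le> c} \<longleftrightarrow> y \<in> D ` (\<Theta> \<inter> {..c}) \<union> (if 0 \<le> c then UNIV - D ` \<Theta> else {})"
    proof (cases "y \<in> D ` \<Theta>")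
      case True
      then obtain \<theta> where \<theta>: "\<theta> \<in> \<Theta>" "y = D \<theta>" by blast
      then have "y \<in> D ` (\<Theta> \<inter> {..c}) \<longleftrightarrow> \<theta> \<le> c" using inj_onD[OF inj_on_D] by blast
      then show ?thesis using True \<theta> by (simp add: D_inv)
    next
      case False
      then show ?thesis by (auto simp: D_inv_def)
    qed
  qed
  then have "{y. D_inv y \<le> c} \<in> sets borel" for c using interval by simp
  then show ?thesis by (intro borel_measurable_iff_le[THEN iffD2] allI) simp
qed

section \<open>The maximum likelihood estimator\<close>

lemma ln_f: "ln (f \<theta> x) = k \<theta> * T0 x - A \<theta> * indicator B x + indicator B x * S x"
  by (cases "x \<in> B") (simp_all add: ln_f_in f_out T0_def)

text \<open>The condition on the boundary behaviour is stated for \<open>n\<close> observations; applied to \<open>n\<close> copies of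
\<open>y\<close> it yields the same behaviour for a single observation.\<close>

lemma eventually_ln_f_less:
  assumes A2: "cond_A2 f B n a b" and "n \<ge> 1" and "y \<in> B"
  shows "eventually (\<lambda>\<theta>. ln (f (real_of_ereal \<theta>) y) < ln (f \<theta>\<^sub>1 y)) (at_right a)"
    and "eventually (\<lambda>\<theta>. ln (f (real_of_ereal \<theta>) y) < ln (f \<theta>\<^sub>1 y)) (at_left b)"
proof -
  have l: "loglik f n (\<lambda>_. y) \<theta> = real n * ln (f \<theta> y)" for \<theta> by (simp add: loglik_def)
  have "filterlim (\<lambda>\<theta>. loglik f n (\<lambda>_. y) (real_of_ereal \<theta>)) at_bot (at_right a) \<and>
        filterlim (\<lambda>\<theta>. loglik f n (\<lambda>_. y) (real_of_ereal \<theta>)) at_bot (at_left b)"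
    using A2[unfolded cond_A2_def, THEN spec, of "\<lambda>_. y"] \<open>y \<in> B\<close> by simp
  then have "eventually (\<lambda>\<theta>. real n * ln (f (real_of_ereal \<theta>) y) < real n * ln (f \<theta>\<^sub>1 y)) (at_right a)"
    "eventually (\<lambda>\<theta>. real n * ln (f (real_of_ereal \<theta>) y) < real n * ln (f \<theta>\<^sub>1 y)) (at_left b)"
    unfolding l filterlim_at_bot_dense by blast+
  moreover have "real n > 0" using \<open>n \<ge> 1\<close> by simp
  ultimately show "eventually (\<lambda>\<theta>. ln (f (real_of_ereal \<theta>) y) < ln (f \<theta>\<^sub>1 y)) (at_right a)"
    "eventually (\<lambda>\<theta>. ln (f (real_of_ereal \<theta>) y) < ln (f \<theta>\<^sub>1 y)) (at_left b)"
    by (simp_all only: mult_less_cancel_left_pos)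
qed

lemma continuous_on_Theta: "continuous_on \<Theta> k" "continuous_on \<Theta> A"
  using DERIV_isCont[OF DERIV_k(1)] DERIV_isCont[OF DERIV_A(1)]
  by (auto intro!: continuous_at_imp_continuous_on)

text \<open>The log-likelihood falls below its value at \<open>\<theta>\<^sub>1\<close> near both ends of the parameter interval, so its
maximum over a compact subinterval is global. One observation in the support suffices, since
the others contribute 0.\<close>

lemma is_arg_max_loglik_exists:
  assumes A2: "cond_A2 f B n a b" and n: "n \<ge> 1" and i: "i < n" "x i \<in> B"
  shows "\<exists>\<theta>. is_arg_max (loglik f n x) (\<lambda>\<theta>. \<theta> \<in> \<Theta>) \<theta>"
proof -
  obtain \<theta>\<^sub>1 where \<theta>\<^sub>1: "\<theta>\<^sub>1 \<in> \<Theta>" using Theta_two_points by blast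
  then have a1: "a < ereal \<theta>\<^sub>1" "ereal \<theta>\<^sub>1 < b" by (auto simp: Theta_def einterval_def)
  define G where "G = {j. j < n \<and> x j \<in> B}"
  have less: "loglik f n x \<theta> < loglik f n x \<theta>\<^sub>1" if "\<forall>j\<in>G. ln (f \<theta> (x j)) < ln (f \<theta>\<^sub>1 (x j))" for \<theta>
    unfolding loglik_def
  proof (rule sum_strict_mono_ex1)
    show "\<forall>j\<in>{..<n}. ln (f \<theta> (x j)) \<le> ln (f \<theta>\<^sub>1 (x j))"
    proof
      fix j assume "j \<in> {..<n}"
      then show "ln (f \<theta> (x j)) \<le> ln (f \<theta>\<^sub>1 (x j))"
        using that by (cases "x j \<in> B") (auto simp: G_def f_out less_imp_le)
    qed
    show "\<exists>j\<in>{..<n}. ln (f \<theta> (x j)) < ln (f \<theta>\<^sub>1 (x j))" using that i by (auto simp: G_def)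
  qed simp
  have G: "finite G" "\<And>j. j \<in> G \<Longrightarrow> x j \<in> B" by (simp_all add: G_def)
  define P where "P = (\<lambda>\<theta>. \<forall>j\<in>G. ln (f (real_of_ereal \<theta>) (x j)) < ln (f \<theta>\<^sub>1 (x j)))"
  have "eventually P (at_right a)" "eventually P (at_left b)"
    unfolding P_def by (rule eventually_ball_finite[OF G(1)], simp add: eventually_ln_f_less[OF A2 n] G(2))+
  then have "\<exists>c>a. \<forall>y>a. y < c \<longrightarrow> P y" "\<exists>d<b. \<forall>y>d. y < b \<longrightarrow> P y"
    by (simp_all only: eventually_at_right[OF a1(1)] eventually_at_left[OF a1(2)])
  then obtain c d where c: "c > a" "\<And>y. a < y \<Longrightarrow> y < c \<Longrightarrow> P y"
    and d: "d < b" "\<And>y. d < y \<Longrightarrow> y < b \<Longrightarrow> P y" by blast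
  obtain c' where c': "a < ereal c'" "ereal c' < min c (ereal \<theta>\<^sub>1)"
    using ereal_dense2[of a "min c (ereal \<theta>\<^sub>1)"] c(1) a1 by auto
  obtain d' where d': "max d (ereal \<theta>\<^sub>1) < ereal d'" "ereal d' < b"
    using ereal_dense2[of "max d (ereal \<theta>\<^sub>1)" b] d(1) a1 by auto
  have cd: "c' < \<theta>\<^sub>1" "\<theta>\<^sub>1 < d'" "ereal c' < c" "d < ereal d'" using c' d' by auto
  have cdT: "c' \<in> \<Theta>" "d' \<in> \<Theta>"
    using c' d' a1 less_trans[of "ereal c'" "ereal \<theta>\<^sub>1" b] less_trans[of a "ereal \<theta>\<^sub>1" "ereal d'"] cd
    by (simp_all add: Theta_def einterval_def)
  have sub: "{c'..d'} \<subseteq> \<Theta>"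
    by (rule subsetI, rule between_Theta[OF cdT]) simp_all
  have "continuous_on {c'..d'} (loglik f n x)"
    unfolding loglik_def ln_f using continuous_on_Theta[THEN continuous_on_subset, OF sub]
    by (intro continuous_intros)
  moreover have "compact {c'..d'}" "{c'..d'} \<noteq> {}" using cd by auto
  ultimately obtain \<theta> where \<theta>: "\<theta> \<in> {c'..d'}" "\<And>t. t \<in> {c'..d'} \<Longrightarrow> loglik f n x t \<le> loglik f n x \<theta>"
    using continuous_attains_sup[of "{c'..d'}" "loglik f n x"] by blast
  have "loglik f n x t \<le> loglik f n x \<theta>" if t: "t \<in> \<Theta>" for t
  proof -
    have tab: "a < ereal t" "ereal t < b" using t by (auto simp: Theta_def einterval_def)
    have \<theta>1: "loglik f n x \<theta>\<^sub>1 \<le> loglik f n x \<theta>" using \<theta>(2)[of \<theta>\<^sub>1] cd by auto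
    consider "t < c'" | "t > d'" | "t \<in> {c'..d'}" by fastforce
    then show ?thesis
    proof cases
      case 1
      then have "ereal t < c" using cd(3) less_trans[of "ereal t" "ereal c'" c] by simp
      then show ?thesis using less[of t] c(2)[OF tab(1)] \<theta>1 by (simp add: P_def)
    next
      case 2
      then have "d < ereal t" using cd(4) less_trans[of d "ereal d'" "ereal t"] by simp
      then show ?thesis using less[of t] d(2)[OF _ tab(2)] \<theta>1 by (simp add: P_def)
    next
      case 3
      then show ?thesis by (rule \<theta>(2))
    qed
  qed
  then show ?thesis using \<theta>(1) sub by (intro exI[of _ \<theta>]) (auto simp: is_arg_max_def not_less)
qed

lemma is_arg_max_loglik_imp_D:
  assumes max: "is_arg_max (loglik f n x) (\<lambda>\<theta>. \<theta> \<in> \<Theta>) \<theta>" and i: "i < n" "x i \<in> B"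
  shows "\<theta> \<in> \<Theta>" "D \<theta> = (\<Sum>i<n. T0 (x i)) / (\<Sum>i<n. indicator B (x i))"
proof -
  define s where "s = (\<Sum>i<n. T0 (x i))"
  define m where "m = (\<Sum>i<n. indicator B (x i) :: real)"
  have "indicator B (x i) \<le> m" unfolding m_def by (rule member_le_sum) (use i in auto)
  then have m: "m > 0" using i by simp
  show \<theta>: "\<theta> \<in> \<Theta>" using max by (simp add: is_arg_max_def)
  have le: "loglik f n x t \<le> loglik f n x \<theta>" if "t \<in> \<Theta>" for t
    using max that by (auto simp: is_arg_max_def not_less)
  have "loglik f n x = (\<lambda>t. k t * s - A t * m + (\<Sum>i<n. indicator B (x i) * S (x i)))"
    by (rule ext) (simp only: loglik_def ln_f s_def m_def sum_distrib_left sum.distrib sum_subtractf)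
  then have "(loglik f n x has_real_derivative deriv k \<theta> * s - deriv A \<theta> * m) (at \<theta>)"
    using DERIV_k(1)[OF \<theta>] DERIV_A(1)[OF \<theta>] by (auto intro!: derivative_eq_intros)
  moreover obtain e where "e > 0" "ball \<theta> e \<subseteq> \<Theta>" using open_Theta \<theta> openE by blast
  moreover from this have "\<forall>y. \<bar>\<theta> - y\<bar> < e \<longrightarrow> loglik f n x y \<le> loglik f n x \<theta>"
    using le by (auto simp: ball_def dist_real_def)
  ultimately have "deriv k \<theta> * s - deriv A \<theta> * m = 0" using DERIV_local_max by blast
  then show "D \<theta> = (\<Sum>i<n. T0 (x i)) / (\<Sum>i<n. indicator B (x i))"
    using m k'[OF \<theta>] by (simp add: D_def s_def[symmetric] m_def[symmetric] field_simps)
qed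

definition mle_no_data :: real where "mle_no_data = (SOME \<theta>. is_arg_max (\<lambda>_. 0 :: real) (\<lambda>\<theta>. \<theta> \<in> \<Theta>) \<theta>)"

text \<open>This formula holds for all data, also for those outside the support. Although these have
probability zero, measurability of the estimator requires controlling its values there. If no
observation lies in the support, the log-likelihood vanishes identically and the estimator is
the fixed value chosen by \<open>SOME\<close>.\<close>

lemma mle_eq:
  assumes A2: "cond_A2 f B n a b" and n: "n \<ge> 1"
  shows "mle f \<Theta> n x = (if (\<Sum>i<n. indicator B (x i) :: real) = 0 then mle_no_data
    else D_inv ((\<Sum>i<n. T0 (x i)) / (\<Sum>i<n. indicator B (x i))))"
proof (cases "\<exists>i<n. x i \<in> B")
  case True
  then obtain i where i: "i < n" "x i \<in> B" by blast
  have "(indicator B (x i) :: real) \<le> (\<Sum>i<n. indicator B (x i))" by (rule member_le_sum) (use i in auto)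
  then have m: "(\<Sum>i<n. indicator B (x i) :: real) \<noteq> 0" using i by simp
  have "is_arg_max (loglik f n x) (\<lambda>\<theta>. \<theta> \<in> \<Theta>) (mle f \<Theta> n x)"
    unfolding mle_def arg_max_on_def arg_max_def
    by (rule someI_ex) (rule is_arg_max_loglik_exists[where x = x and i = i, OF A2 n i])
  from is_arg_max_loglik_imp_D[of n x, OF this i] show ?thesis using m D_inv by metis
next
  case False
  then have "loglik f n x = (\<lambda>_. 0)" by (auto simp: loglik_def f_out)
  moreover have "(\<Sum>i<n. indicator B (x i) :: real) = 0" using False by (intro sum.neutral) auto
  ultimately show ?thesis by (simp add: mle_def arg_max_on_def arg_max_def mle_no_data_def)
qed

lemma mle_score_equation:
  assumes A2: "cond_A2 f B n a b" and n: "n \<ge> 1" and x: "\<And>i. i < n \<Longrightarrow> x i \<in> B"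
  shows "mle f \<Theta> n x \<in> \<Theta>" "D (mle f \<Theta> n x) = (\<Sum>i<n. T0 (x i)) / real n"
proof -
  have max: "is_arg_max (loglik f n x) (\<lambda>\<theta>. \<theta> \<in> \<Theta>) (mle f \<Theta> n x)"
    unfolding mle_def arg_max_on_def arg_max_def
    by (rule someI_ex) (rule is_arg_max_loglik_exists[where x = x and i = 0, OF A2 n], use n x in auto)
  have 0: "0 < n" "x 0 \<in> B" using n x by auto
  show "mle f \<Theta> n x \<in> \<Theta>" by (rule is_arg_max_loglik_imp_D(1)[of n x, OF max 0])
  have "(\<Sum>i<n. indicator B (x i) :: real) = real n" using x by simp
  then show "D (mle f \<Theta> n x) = (\<Sum>i<n. T0 (x i)) / real n"
    using is_arg_max_loglik_imp_D(2)[of n x, OF max 0] by simp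
qed

lemma mle_measurable:
  assumes A2: "cond_A2 f B n a b" and n: "n \<ge> 1" and X: "\<And>i. i < n \<Longrightarrow> X i \<in> measurable M \<mu>"
  shows "(\<lambda>\<omega>. mle f \<Theta> n (\<lambda>i. X i \<omega>)) \<in> borel_measurable M"
proof -
  note [measurable] = B
  have [measurable]: "(\<lambda>\<omega>. \<Sum>i<n. T0 (X i \<omega>)) \<in> borel_measurable M"
    "(\<lambda>\<omega>. \<Sum>i<n. indicator B (X i \<omega>) :: real) \<in> borel_measurable M"
    by (intro borel_measurable_sum measurable_compose[OF X]; simp)+
  show ?thesis unfolding mle_eq[OF A2 n] by measurable
qed

lemma Taylor_D:
  assumes "\<theta> \<in> \<Theta>" "\<theta>\<^sub>0 \<in> \<Theta>"
  shows "\<exists>t\<in>\<Theta>. \<bar>t - \<theta>\<^sub>0\<bar> \<le> \<bar>\<theta> - \<theta>\<^sub>0\<bar> \<and>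
    D \<theta> = D \<theta>\<^sub>0 + D1 \<theta>\<^sub>0 * (\<theta> - \<theta>\<^sub>0) + (deriv ^^ 2) D t / 2 * (\<theta> - \<theta>\<^sub>0)\<^sup>2"
proof -
  define diff where "diff = (\<lambda>m::nat. if m = 0 then D else if m = 1 then D1 else (deriv ^^ 2) D)"
  have D: "(diff m has_real_derivative diff (Suc m) t) (at t)" if "m < 2" "t \<in> \<Theta>" for m t
    using that DERIV_D[of t] DERIV_deriv_D[of t] by (auto simp: diff_def less_2_cases_iff)
  have sum: "(\<Sum>m<2. diff m \<theta>\<^sub>0 / fact m * (\<theta> - \<theta>\<^sub>0) ^ m) = D \<theta>\<^sub>0 + D1 \<theta>\<^sub>0 * (\<theta> - \<theta>\<^sub>0)"
    by (simp add: diff_def numeral_2_eq_2)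
  consider "\<theta> = \<theta>\<^sub>0" | "\<theta>\<^sub>0 < \<theta>" | "\<theta> < \<theta>\<^sub>0" by linarith
  then show ?thesis
  proof cases
    case 1
    then show ?thesis using assms by (intro bexI[of _ \<theta>]) auto
  next
    case 2
    have "\<forall>m t. m < 2 \<and> \<theta>\<^sub>0 \<le> t \<and> t \<le> \<theta> \<longrightarrow> (diff m has_real_derivative diff (Suc m) t) (at t)"
      using D between_Theta[OF assms(2,1)] by blast
    from Taylor_up[OF _ _ this order_refl 2, of D] obtain t where
      t: "\<theta>\<^sub>0 < t" "t < \<theta>" "D \<theta> = (\<Sum>m<2. diff m \<theta>\<^sub>0 / fact m * (\<theta> - \<theta>\<^sub>0) ^ m) + diff 2 t / fact 2 * (\<theta> - \<theta>\<^sub>0)\<^sup>2"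
      by (auto simp: diff_def)
    then show ?thesis unfolding sum using between_Theta[OF assms(2,1), of t]
      by (intro bexI[of _ t]) (auto simp: diff_def)
  next
    case 3
    have "\<forall>m t. m < 2 \<and> \<theta> \<le> t \<and> t \<le> \<theta>\<^sub>0 \<longrightarrow> (diff m has_real_derivative diff (Suc m) t) (at t)"
      using D between_Theta[OF assms] by blast
    from Taylor_down[OF _ _ this 3 order_refl, of D] obtain t where
      t: "\<theta> < t" "t < \<theta>\<^sub>0" "D \<theta> = (\<Sum>m<2. diff m \<theta>\<^sub>0 / fact m * (\<theta> - \<theta>\<^sub>0) ^ m) + diff 2 t / fact 2 * (\<theta> - \<theta>\<^sub>0)\<^sup>2"
      by (auto simp: diff_def)
    then show ?thesis unfolding sum using between_Theta[OF assms, of t]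
      by (intro bexI[of _ t]) (auto simp: diff_def)
  qed
qed

text \<open>Since \<open>k' * D' = I\<close> at \<open>\<theta>\<^sub>0\<close>, the second argument of \<open>h\<close> is the first one plus
\<open>\<surd>n * k' / \<surd>I\<close> times the quadratic Taylor remainder of \<open>D\<close>. This is used within distance \<open>\<epsilon>\<close> of
\<open>\<theta>\<^sub>0\<close>. Farther away the trivial bound \<open>2 * H\<close> is multiplied by \<open>(\<theta> - \<theta>\<^sub>0)\<^sup>2 / \<epsilon>\<^sup>2 \<ge> 1\<close>, unless
\<open>D\<close> is the identity, when the two arguments coincide.\<close>

lemma linearization_error:
  assumes \<theta>: "\<theta> \<in> \<Theta>" and \<theta>\<^sub>0: "\<theta>\<^sub>0 \<in> \<Theta>" and \<epsilon>: "\<epsilon> > 0"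
    and lip: "L-lipschitz_on UNIV h" and ess: "\<And>x. ennreal \<bar>h x\<bar> \<le> H"
  defines "I \<equiv> fisher_info \<mu> f \<theta>\<^sub>0"
  shows "ennreal \<bar>h (sqrt (real n * I) * (\<theta> - \<theta>\<^sub>0)) - h (sqrt (real n) * deriv k \<theta>\<^sub>0 * (D \<theta> - D \<theta>\<^sub>0) / sqrt I)\<bar>
    \<le> ennreal ((\<theta> - \<theta>\<^sub>0)\<^sup>2) *
       (2 * (H / ennreal (\<epsilon>\<^sup>2)) * (if \<exists>\<theta>\<in>\<Theta>. D \<theta> \<noteq> \<theta> then 1 else 0)
        + ennreal L * ennreal (sqrt (real n) * \<bar>deriv k \<theta>\<^sub>0\<bar>) / ennreal (2 * sqrt I)
            * (SUP \<theta>\<in>{\<theta>\<in>\<Theta>. \<bar>\<theta> - \<theta>\<^sub>0\<bar> \<le> \<epsilon>}. ennreal \<bar>(deriv ^^ 2) D \<theta>\<bar>))"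
    (is "ennreal \<bar>h ?U - h ?W\<bar> \<le> ennreal ?\<Delta> * (?K1 * ?ind + ?K2 * ?S)")
proof -
  have I: "I > 0" unfolding I_def using \<theta>\<^sub>0 by (rule fisher_info_pos)
  have L: "L \<ge> 0" using lip by (rule lipschitz_on_nonneg)
  define r where "r = sqrt I"
  have r: "r > 0" "r * r = I" using I by (simp_all add: r_def)
  have D1: "deriv k \<theta>\<^sub>0 * D1 \<theta>\<^sub>0 = r * r" using fisher_info_eq_D1[OF \<theta>\<^sub>0] r by (simp add: I_def)
  have U: "?U = sqrt n * r * (\<theta> - \<theta>\<^sub>0)" and W: "?W = sqrt n * deriv k \<theta>\<^sub>0 * (D \<theta> - D \<theta>\<^sub>0) / r"
    by (simp_all add: r_def real_sqrt_mult)
  show ?thesis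
  proof (cases "\<bar>\<theta> - \<theta>\<^sub>0\<bar> \<le> \<epsilon>")
    case True
    obtain t where t: "t \<in> \<Theta>" "\<bar>t - \<theta>\<^sub>0\<bar> \<le> \<bar>\<theta> - \<theta>\<^sub>0\<bar>"
      "D \<theta> = D \<theta>\<^sub>0 + D1 \<theta>\<^sub>0 * (\<theta> - \<theta>\<^sub>0) + (deriv ^^ 2) D t / 2 * (\<theta> - \<theta>\<^sub>0)\<^sup>2"
      using Taylor_D[OF \<theta> \<theta>\<^sub>0] by blast
    have "?W = sqrt n * ((deriv k \<theta>\<^sub>0 * D1 \<theta>\<^sub>0) * (\<theta> - \<theta>\<^sub>0) + deriv k \<theta>\<^sub>0 * (deriv ^^ 2) D t / 2 * ?\<Delta>) / r"
      unfolding W unfolding t(3) by (simp add: algebra_simps)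
    also have "\<dots> = ?U + sqrt n * (deriv k \<theta>\<^sub>0 * (deriv ^^ 2) D t / 2 * ?\<Delta>) / r"
      unfolding D1 U using r(1) by (simp add: field_simps)
    finally have UW: "?U - ?W = - (sqrt n * (deriv k \<theta>\<^sub>0 * (deriv ^^ 2) D t / 2 * ?\<Delta>) / r)" by simp
    define c where "c = L * (sqrt n * \<bar>deriv k \<theta>\<^sub>0\<bar>) / (2 * r)"
    have c: "c \<ge> 0" "?K2 = ennreal c"
    proof -
      have "ennreal c = ennreal (L * (sqrt n * \<bar>deriv k \<theta>\<^sub>0\<bar>)) / ennreal (2 * r)"
        unfolding c_def using L r(1) by (intro divide_ennreal[symmetric]) auto
      also have "ennreal (L * (sqrt n * \<bar>deriv k \<theta>\<^sub>0\<bar>)) = ennreal L * ennreal (sqrt n * \<bar>deriv k \<theta>\<^sub>0\<bar>)"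
        using L by (intro ennreal_mult) auto
      finally show "?K2 = ennreal c" unfolding r_def by (rule sym)
    qed (use L r(1) in \<open>simp add: c_def\<close>)
    have abs: "L * \<bar>?U - ?W\<bar> = ?\<Delta> * (c * \<bar>(deriv ^^ 2) D t\<bar>)"
      unfolding UW c_def using r(1) by (simp add: abs_mult)
    have "\<bar>h ?U - h ?W\<bar> \<le> L * \<bar>?U - ?W\<bar>" using lipschitz_onD[OF lip, of ?U ?W] by (simp add: dist_real_def)
    also have "\<dots> = ?\<Delta> * (c * \<bar>(deriv ^^ 2) D t\<bar>)" by (rule abs)
    finally have "ennreal \<bar>h ?U - h ?W\<bar> \<le> ennreal (?\<Delta> * (c * \<bar>(deriv ^^ 2) D t\<bar>))"
      by (rule ennreal_leI)
    also have "\<dots> = ennreal ?\<Delta> * (?K2 * ennreal \<bar>(deriv ^^ 2) D t\<bar>)"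
      unfolding c(2) using c(1) by (simp add: ennreal_mult)
    also have "\<dots> \<le> ennreal ?\<Delta> * (?K2 * ?S)"
      using t(1,2) True by (intro mult_left_mono SUP_upper) auto
    also have "\<dots> \<le> ennreal ?\<Delta> * (?K1 * ?ind + ?K2 * ?S)"
      by (intro mult_left_mono) auto
    finally show ?thesis .
  next
    case False
    show ?thesis
    proof (cases "\<exists>\<theta>\<in>\<Theta>. D \<theta> \<noteq> \<theta>")
      case True
      have "1 \<le> ?\<Delta> / \<epsilon>\<^sup>2" using False \<epsilon> abs_le_square_iff[of \<epsilon> "\<theta> - \<theta>\<^sub>0"] by simp
      have "ennreal \<bar>h ?U - h ?W\<bar> \<le> ennreal (\<bar>h ?U\<bar> + \<bar>h ?W\<bar>)" by (intro ennreal_leI abs_triangle_ineq4)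
      also have "\<dots> = ennreal \<bar>h ?U\<bar> + ennreal \<bar>h ?W\<bar>" by simp
      also have "\<dots> \<le> H + H" using ess by (intro add_mono)
      also have "\<dots> = 1 * (2 * H)" by (simp add: mult_2)
      also have "\<dots> \<le> ennreal (?\<Delta> / \<epsilon>\<^sup>2) * (2 * H)" using \<open>1 \<le> ?\<Delta> / \<epsilon>\<^sup>2\<close> by (intro mult_right_mono) (auto simp: ennreal_1[symmetric] simp del: ennreal_1 intro: ennreal_leI)
      also have "\<dots> = ennreal ?\<Delta> * ?K1"
        using \<epsilon> by (simp add: divide_ennreal[symmetric] divide_ennreal_def mult_ac)
      also have "\<dots> \<le> ennreal ?\<Delta> * (?K1 * ?ind + ?K2 * ?S)"
        using True by (intro mult_left_mono) auto
      finally show ?thesis .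
    next
      case False
      then have id: "\<And>\<theta>. \<theta> \<in> \<Theta> \<Longrightarrow> D \<theta> = \<theta>" by blast
      have "((\<lambda>\<theta>. \<theta>) has_real_derivative D1 \<theta>\<^sub>0) (at \<theta>\<^sub>0)"
        by (rule has_field_derivative_transform_within_open[OF DERIV_D[OF \<theta>\<^sub>0] open_Theta \<theta>\<^sub>0]) (rule id)
      then have "D1 \<theta>\<^sub>0 = 1" using DERIV_unique DERIV_ident by blast
      then have "deriv k \<theta>\<^sub>0 = r * r" using D1 by simp
      then have "?U = ?W" unfolding U W using r(1) id[OF \<theta>] id[OF \<theta>\<^sub>0] by simp
      then show ?thesis by simp
    qed
  qed
qed

end

section \<open>Normal approximation of the maximum likelihood estimator\<close>

lemma (in prob_space) ennreal_expectation_diff_le: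
  assumes "integrable M f" "integrable M g"
  shows "ennreal \<bar>expectation f - expectation g\<bar> \<le> (\<integral>\<^sup>+\<omega>. ennreal \<bar>f \<omega> - g \<omega>\<bar> \<partial>M)"
proof -
  have "\<bar>expectation f - expectation g\<bar> = \<bar>expectation (\<lambda>\<omega>. f \<omega> - g \<omega>)\<bar>" using assms by simp
  also have "\<dots> \<le> expectation (\<lambda>\<omega>. \<bar>f \<omega> - g \<omega>\<bar>)" by (rule integral_abs_bound)
  finally have "ennreal \<bar>expectation f - expectation g\<bar> \<le> ennreal (expectation (\<lambda>\<omega>. \<bar>f \<omega> - g \<omega>\<bar>))" by (rule ennreal_leI)
  also have "\<dots> = (\<integral>\<^sup>+\<omega>. ennreal \<bar>f \<omega> - g \<omega>\<bar> \<partial>M)" using assms by (intro nn_integral_eq_integral[symmetric]) auto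
  finally show ?thesis .
qed

locale mle_sample = regular_exp_family a b k A T S B \<mu> f \<Theta> D + prob_space M
  for a b k A T S B \<mu> f \<Theta> D and M :: "'m measure" +
  fixes X :: "nat \<Rightarrow> 'm \<Rightarrow> real" and n :: nat and \<theta>\<^sub>0 :: real
  assumes theta0: "\<theta>\<^sub>0 \<in> \<Theta>" and n: "n \<ge> 1"
    and indep: "indep_vars (\<lambda>_. \<mu>) X {..<n}"
    and ident: "\<And>i. i < n \<Longrightarrow> distributed M \<mu> (X i) (\<lambda>x. ennreal (f \<theta>\<^sub>0 x))"
    and A2: "cond_A2 f B n a b"
begin

definition I :: real where "I = fisher_info \<mu> f \<theta>\<^sub>0"

lemma I_pos: "I > 0" unfolding I_def using theta0 by (rule fisher_info_pos)

definition \<xi> :: "nat \<Rightarrow> 'm \<Rightarrow> real" where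
  "\<xi> i \<omega> = deriv k \<theta>\<^sub>0 * (T0 (X i \<omega>) - D \<theta>\<^sub>0) / sqrt I"

lemma X_measurable: "i < n \<Longrightarrow> X i \<in> measurable M \<mu>"
  using distributed_measurable[OF ident] by simp

lemma AE_X_in_B: "AE \<omega> in M. \<forall>i\<in>{..<n}. X i \<omega> \<in> B"
proof (rule AE_finite_allI)
  fix i assume i: "i \<in> {..<n}"
  have "x \<in> B" if "0 < f \<theta>\<^sub>0 x" for x using that f_out[of x \<theta>\<^sub>0] by (cases "x \<in> B") auto
  then have "AE x in density \<mu> (\<lambda>x. ennreal (f \<theta>\<^sub>0 x)). x \<in> B"
    using f_measurable[OF theta0] by (subst AE_density) auto
  moreover have "distr M \<mu> (X i) = density \<mu> (\<lambda>x. ennreal (f \<theta>\<^sub>0 x))"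
    using distributed_distr_eq_density[OF ident, of i] i by simp
  ultimately have "AE x in distr M \<mu> (X i). x \<in> B" by (simp only:)
  moreover have "{x \<in> space \<mu>. x \<in> B} = B" using sets.sets_into_space[OF B] by blast
  ultimately show "AE \<omega> in M. X i \<omega> \<in> B" using i B
    by (subst (asm) AE_distr_iff[OF X_measurable]) auto
qed simp

lemma indep_\<xi>: "indep_vars (\<lambda>_. borel) \<xi> {..<n}"
  unfolding \<xi>_def[abs_def] using T0_measurable by (intro indep_vars_compose2[OF indep]) auto

lemma sample_integral:
  assumes "i < n" "g \<in> borel_measurable \<mu>"
  shows "integrable M (\<lambda>\<omega>. g (X i \<omega>)) \<longleftrightarrow> integrable \<mu> (\<lambda>x. f \<theta>\<^sub>0 x * g x)"
    and "expectation (\<lambda>\<omega>. g (X i \<omega>)) = (\<integral>x. f \<theta>\<^sub>0 x * g x \<partial>\<mu>)"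
  using distributed_integrable[OF ident[OF assms(1)] assms(2)] distributed_integral[OF ident[OF assms(1)] assms(2)]
  by (simp_all add: f_nonneg)

lemma mean_\<xi>: assumes "i < n" shows "expectation (\<xi> i) = 0"
proof -
  have "expectation (\<xi> i) = (\<integral>x. f \<theta>\<^sub>0 x * (deriv k \<theta>\<^sub>0 * (T0 x - D \<theta>\<^sub>0) / sqrt I) \<partial>\<mu>)"
    unfolding \<xi>_def using T0_measurable by (intro sample_integral(2)[OF assms, of "\<lambda>x. deriv k \<theta>\<^sub>0 * (T0 x - D \<theta>\<^sub>0) / sqrt I"]) auto
  also have "\<dots> = (\<integral>x. (T0 x * f \<theta>\<^sub>0 x - D \<theta>\<^sub>0 * f \<theta>\<^sub>0 x) * (deriv k \<theta>\<^sub>0 / sqrt I) \<partial>\<mu>)"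
    by (intro Bochner_Integration.integral_cong) (auto simp: algebra_simps diff_divide_distrib)
  also have "\<dots> = 0"
    using integrable_T0_f[OF theta0] integrable_f[OF theta0] by (simp add: integral_T0_f theta0 integral_f)
  finally show ?thesis .
qed

text \<open>The variance of the score is the Fisher information, and \<open>\<xi>\<close> is the score divided by \<open>\<surd>I\<close>.\<close>

lemma var_\<xi>: assumes "i < n" shows "expectation (\<lambda>\<omega>. (\<xi> i \<omega>)\<^sup>2) = 1"
proof -
  have "expectation (\<lambda>\<omega>. (\<xi> i \<omega>)\<^sup>2) = (\<integral>x. f \<theta>\<^sub>0 x * (deriv k \<theta>\<^sub>0 * (T0 x - D \<theta>\<^sub>0) / sqrt I)\<^sup>2 \<partial>\<mu>)"
    unfolding \<xi>_def using T0_measurable by (intro sample_integral(2)[OF assms, of "\<lambda>x. (deriv k \<theta>\<^sub>0 * (T0 x - D \<theta>\<^sub>0) / sqrt I)\<^sup>2"]) auto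
  also have "\<dots> = (\<integral>x. (deriv k \<theta>\<^sub>0 * T0 x - deriv A \<theta>\<^sub>0)\<^sup>2 * f \<theta>\<^sub>0 x / I \<partial>\<mu>)"
  proof (rule Bochner_Integration.integral_cong)
    fix x
    have "deriv k \<theta>\<^sub>0 * (T0 x - D \<theta>\<^sub>0) = deriv k \<theta>\<^sub>0 * T0 x - deriv A \<theta>\<^sub>0"
      using k'[OF theta0] by (simp add: D_def field_simps)
    then show "f \<theta>\<^sub>0 x * (deriv k \<theta>\<^sub>0 * (T0 x - D \<theta>\<^sub>0) / sqrt I)\<^sup>2 = (deriv k \<theta>\<^sub>0 * T0 x - deriv A \<theta>\<^sub>0)\<^sup>2 * f \<theta>\<^sub>0 x / I"
      using I_pos by (simp add: power_divide)
  qed simp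
  also have "\<dots> = 1" using I_pos score_second_moment(2)[OF theta0] fisher_info_eq[OF theta0] by (simp add: I_def)
  finally show ?thesis .
qed

text \<open>The integrals may be infinite, and \<open>T\<close> may fail to be measurable, but along the sample it agrees with \<open>T0\<close> almost surely.\<close>

lemma third_moment_T0:
  assumes "i < n"
  shows "(\<integral>\<^sup>+\<omega>. ennreal (\<bar>T0 (X i \<omega>) - D \<theta>\<^sub>0\<bar> ^ 3) \<partial>M) = (\<integral>\<^sup>+\<omega>. ennreal (\<bar>T (X 0 \<omega>) - D \<theta>\<^sub>0\<bar> ^ 3) \<partial>M)"
proof -
  have *: "(\<integral>\<^sup>+\<omega>. ennreal (\<bar>T0 (X j \<omega>) - D \<theta>\<^sub>0\<bar> ^ 3) \<partial>M) = (\<integral>\<^sup>+x. ennreal (f \<theta>\<^sub>0 x) * ennreal (\<bar>T0 x - D \<theta>\<^sub>0\<bar> ^ 3) \<partial>\<mu>)"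
    if "j < n" for j
    using T0_measurable by (intro distributed_nn_integral[OF ident[OF that], symmetric]) auto
  have "(\<integral>\<^sup>+\<omega>. ennreal (\<bar>T (X 0 \<omega>) - D \<theta>\<^sub>0\<bar> ^ 3) \<partial>M) = (\<integral>\<^sup>+\<omega>. ennreal (\<bar>T0 (X 0 \<omega>) - D \<theta>\<^sub>0\<bar> ^ 3) \<partial>M)"
  proof (rule nn_integral_cong_AE)
    show "AE \<omega> in M. ennreal (\<bar>T (X 0 \<omega>) - D \<theta>\<^sub>0\<bar> ^ 3) = ennreal (\<bar>T0 (X 0 \<omega>) - D \<theta>\<^sub>0\<bar> ^ 3)"
      using AE_X_in_B
    proof eventually_elim
      case (elim \<omega>)
      then have "X 0 \<omega> \<in> B" using n by simp
      then show ?case by (simp add: T0_def)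
    qed
  qed
  then show ?thesis using *[OF assms] *[of 0] n by simp
qed

lemma third_moment_\<xi>:
  assumes i: "i < n" and \<beta>: "(\<integral>\<^sup>+\<omega>. ennreal (\<bar>T (X 0 \<omega>) - D \<theta>\<^sub>0\<bar> ^ 3) \<partial>M) = ennreal \<beta>" "\<beta> \<ge> 0"
  shows "integrable M (\<lambda>\<omega>. \<bar>\<xi> i \<omega>\<bar> ^ 3)"
    "expectation (\<lambda>\<omega>. \<bar>\<xi> i \<omega>\<bar> ^ 3) = \<bar>deriv k \<theta>\<^sub>0\<bar> ^ 3 * \<beta> / I powr (3 / 2)"
proof -
  note [measurable] = T0_measurable X_measurable[OF i]
  have int: "integrable M (\<lambda>\<omega>. \<bar>T0 (X i \<omega>) - D \<theta>\<^sub>0\<bar> ^ 3)"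
    by (rule integrableI_nonneg) (auto simp: third_moment_T0[OF i] \<beta>)
  have e: "expectation (\<lambda>\<omega>. \<bar>T0 (X i \<omega>) - D \<theta>\<^sub>0\<bar> ^ 3) = \<beta>"
    by (subst integral_eq_nn_integral) (auto simp: third_moment_T0[OF i] \<beta>)
  have "sqrt I ^ 3 = I powr (3 / 2)" using I_pos
    by (simp add: powr_half_sqrt[symmetric] powr_powr flip: powr_realpow)
  then have eq: "\<bar>\<xi> i \<omega>\<bar> ^ 3 = \<bar>deriv k \<theta>\<^sub>0\<bar> ^ 3 / I powr (3 / 2) * \<bar>T0 (X i \<omega>) - D \<theta>\<^sub>0\<bar> ^ 3" for \<omega>
    using I_pos by (simp add: \<xi>_def abs_mult abs_divide power_mult_distrib power_divide)
  show "integrable M (\<lambda>\<omega>. \<bar>\<xi> i \<omega>\<bar> ^ 3)" unfolding eq using int by simp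
  show "expectation (\<lambda>\<omega>. \<bar>\<xi> i \<omega>\<bar> ^ 3) = \<bar>deriv k \<theta>\<^sub>0\<bar> ^ 3 * \<beta> / I powr (3 / 2)" unfolding eq by (simp add: e)
qed

text \<open>For a finite third moment this is Stein's bound. If it is infinite, then so is the right-hand side,
except for \<open>L = 0\<close>, where \<open>0 * \<infinity> = 0\<close> but \<open>h\<close> is constant.\<close>

lemma standardized_sum_bound:
  assumes lip: "L-lipschitz_on UNIV h" and bdd: "\<And>x. \<bar>h x\<bar> \<le> C"
  shows "ennreal \<bar>expectation (\<lambda>\<omega>. h ((\<Sum>i<n. \<xi> i \<omega>) / sqrt n)) - (\<integral>t. \<phi> t * h t \<partial>lborel)\<bar> \<le>
    ennreal L / ennreal (sqrt (real n)) *
         (2 + ennreal (\<bar>deriv k \<theta>\<^sub>0\<bar> ^ 3) * (\<integral>\<^sup>+\<omega>. ennreal (\<bar>T (X 0 \<omega>) - D \<theta>\<^sub>0\<bar> ^ 3) \<partial>M) / ennreal (I powr (3 / 2)))"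
    (is "ennreal ?l \<le> _ / ennreal ?s * (2 + ennreal ?k * ?b / ennreal ?I)")
proof -
  have L: "L \<ge> 0" using lip by (rule lipschitz_on_nonneg)
  have s: "?s > 0" using n by simp
  have Ip: "?I > 0" using I_pos by simp
  have k: "?k > 0" using k'[OF theta0] by simp
  consider "L = 0" | "L > 0" "?b = \<infinity>" | \<beta> where "?b = ennreal \<beta>" "\<beta> \<ge> 0" using L by (cases ?b) fastforce+
  then show ?thesis
  proof cases
    case 1
    then have "h x = h 0" for x using lipschitz_onD[OF lip, of x 0] by simp
    then have "h = (\<lambda>_. h 0)" by blast
    then obtain c where "h = (\<lambda>_. c)" by blast
    then have "?l = 0" by (simp add: prob_space)
    then show ?thesis by simp
  next
    case 2
    have "ennreal ?k * ?b / ennreal ?I = \<infinity>" using 2 k Ip by (simp add: ennreal_mult_top ennreal_top_divide)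
    then have "ennreal L / ennreal ?s * (2 + ennreal ?k * ?b / ennreal ?I) = ennreal (L / ?s) * \<infinity>" using L s by (simp add: divide_ennreal)
    also have "\<dots> = \<infinity>" using 2 s by (simp add: ennreal_mult_top)
    finally show ?thesis by simp
  next
    case 3
    have "?l \<le> L / ?s * (2 + ?k * \<beta> / ?I)"
      by (rule Stein_bound[OF n indep_\<xi> third_moment_\<xi>(1)[OF _ 3] mean_\<xi> var_\<xi> _ lip bdd])
         (simp_all add: third_moment_\<xi>(2)[OF _ 3])
    then have "ennreal ?l \<le> ennreal (L / ?s * (2 + ?k * \<beta> / ?I))" by (rule ennreal_leI)
    also have "\<dots> = ennreal (L / ?s) * ennreal (2 + ?k * \<beta> / ?I)"
      using L s k Ip 3(2) by (intro ennreal_mult) auto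
    also have "ennreal (2 + ?k * \<beta> / ?I) = 2 + ennreal (?k * \<beta> / ?I)"
      using k Ip 3(2) by (subst ennreal_plus) auto
    also have "ennreal (L / ?s) * (2 + ennreal (?k * \<beta> / ?I)) = ennreal L / ennreal ?s * (2 + ennreal ?k * ?b / ennreal ?I)"
      using L s k Ip 3 by (simp add: divide_ennreal[symmetric] ennreal_mult)
    finally show ?thesis .
  qed
qed

text \<open>Almost surely all observations lie in the support, so that the estimator satisfies the likelihood equation and
\<open>W\<close> is a multiple of \<open>D \<theta>\<^sub>n - D \<theta>\<^sub>0\<close>; the pointwise estimate is then integrated.\<close>

lemma linearized_mle_bound:
  assumes lip: "L-lipschitz_on UNIV h" and bdd: "\<And>x. \<bar>h x\<bar> \<le> C" and \<epsilon>: "\<epsilon> > 0"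
    and H: "\<And>x. ennreal \<bar>h x\<bar> \<le> H"
  defines "mle_X \<equiv> (\<lambda>\<omega>. mle f \<Theta> n (\<lambda>i. X i \<omega>))"
  shows "ennreal \<bar>expectation (\<lambda>\<omega>. h (sqrt (real n * I) * (mle_X \<omega> - \<theta>\<^sub>0))) -
      expectation (\<lambda>\<omega>. h ((\<Sum>i<n. \<xi> i \<omega>) / sqrt n))\<bar> \<le>
    (\<integral>\<^sup>+\<omega>. ennreal ((mle_X \<omega> - \<theta>\<^sub>0)\<^sup>2) \<partial>M) *
       (2 * (H / ennreal (\<epsilon>\<^sup>2)) * (if \<exists>\<theta>\<in>\<Theta>. D \<theta> \<noteq> \<theta> then 1 else 0)
        + ennreal L * ennreal (sqrt (real n) * \<bar>deriv k \<theta>\<^sub>0\<bar>) / ennreal (2 * sqrt I)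
            * (SUP \<theta>\<in>{\<theta>\<in>\<Theta>. \<bar>\<theta> - \<theta>\<^sub>0\<bar> \<le> \<epsilon>}. ennreal \<bar>(deriv ^^ 2) D \<theta>\<bar>))"
    (is "ennreal \<bar>expectation ?U - expectation ?W\<bar> \<le> _ * ?K")
proof -
  have [measurable]: "h \<in> borel_measurable borel"
    by (intro borel_measurable_continuous_onI lipschitz_on_continuous_on[OF lip])
  have [measurable]: "mle_X \<in> borel_measurable M" unfolding mle_X_def by (rule mle_measurable[OF A2 n X_measurable])
  have \<xi>m: "\<xi> i \<in> borel_measurable M" if "i < n" for i using indep_\<xi> that by (auto simp: indep_vars_def)
  have [measurable]: "(\<lambda>\<omega>. \<Sum>i<n. \<xi> i \<omega>) \<in> borel_measurable M" using \<xi>m by (intro borel_measurable_sum) auto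
  have "integrable M ?U" "integrable M ?W" using bdd by (auto intro!: integrable_const_bound[where B = C])
  then have "ennreal \<bar>expectation ?U - expectation ?W\<bar> \<le> (\<integral>\<^sup>+\<omega>. ennreal \<bar>?U \<omega> - ?W \<omega>\<bar> \<partial>M)"
    by (rule ennreal_expectation_diff_le)
  also have "\<dots> \<le> (\<integral>\<^sup>+\<omega>. ennreal ((mle_X \<omega> - \<theta>\<^sub>0)\<^sup>2) * ?K \<partial>M)"
  proof (rule nn_integral_mono_AE)
    show "AE \<omega> in M. ennreal \<bar>?U \<omega> - ?W \<omega>\<bar> \<le> ennreal ((mle_X \<omega> - \<theta>\<^sub>0)\<^sup>2) * ?K"
      using AE_X_in_B
    proof eventually_elim
      case (elim \<omega>)
      have inB: "\<And>i. i < n \<Longrightarrow> X i \<omega> \<in> B" using elim by simp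
      note m = mle_score_equation[where x = "\<lambda>i. X i \<omega>", OF A2 n inB]
      define s where "s = sqrt (real n)"
      have s: "s > 0" "s * s = real n" using n by (simp_all add: s_def)
      have "(\<Sum>i<n. \<xi> i \<omega>) = deriv k \<theta>\<^sub>0 * ((\<Sum>i<n. T0 (X i \<omega>)) - real n * D \<theta>\<^sub>0) / sqrt I"
        by (simp add: \<xi>_def sum_divide_distrib[symmetric] sum_distrib_left[symmetric] sum_subtractf)
      also have "(\<Sum>i<n. T0 (X i \<omega>)) = real n * D (mle_X \<omega>)" using m(2) n by (simp add: mle_X_def)
      finally have "(\<Sum>i<n. \<xi> i \<omega>) / s = s * deriv k \<theta>\<^sub>0 * (D (mle_X \<omega>) - D \<theta>\<^sub>0) / sqrt I"
        unfolding s(2)[symmetric] using s(1) I_pos by (simp add: field_simps)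
      then show ?case
        using linearization_error[OF _ theta0 \<epsilon> lip H, of "mle_X \<omega>" n] m(1)
        by (simp add: mle_X_def I_def s_def)
    qed
  qed
  also have "\<dots> = (\<integral>\<^sup>+\<omega>. ennreal ((mle_X \<omega> - \<theta>\<^sub>0)\<^sup>2) \<partial>M) * ?K"
    by (rule nn_integral_multc) measurable
  finally show ?thesis .
qed

end

theorem corollary3p2:
  fixes a b :: ereal
    and k A T S D h :: "real \<Rightarrow> real"
    and B \<Theta> :: "real set"
    and \<mu> :: "real measure"
    and f :: "real \<Rightarrow> real \<Rightarrow> real"
    and \<theta>\<^sub>0 \<epsilon> :: real
    and n :: nat
    and M :: "'m measure" and X :: "nat \<Rightarrow> 'm \<Rightarrow> real"
    and N :: "'z measure" and Z :: "'z \<Rightarrow> real"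
    and mle_X :: "'m \<Rightarrow> real"
  defines "\<Theta> \<equiv> einterval a b"
    and "f \<equiv> exp_family k A T S B"
    and "D \<equiv> (\<lambda>\<theta>. deriv A \<theta> / deriv k \<theta>)"
    and "mle_X \<equiv> (\<lambda>\<omega>. mle f \<Theta> n (\<lambda>i. X i \<omega>))"
  assumes mu: "dominating \<mu>" and B: "B \<in> sets \<mu>"
    and family: "pdf_family \<mu> \<Theta> f"
    and k': "\<And>\<theta>. \<theta> \<in> \<Theta> \<Longrightarrow> k field_differentiable (at \<theta>) \<and> deriv k \<theta> \<noteq> 0"
    and theta0: "\<theta>\<^sub>0 \<in> \<Theta>"
    and n: "n \<ge> 1"
    and M: "prob_space M"
    and indep: "prob_space.indep_vars M (\<lambda>_. \<mu>) X {..<n}"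
    and ident: "\<And>i. i < n \<Longrightarrow> distributed M \<mu> (X i) (\<lambda>x. ennreal (f \<theta>\<^sub>0 x))"
    and A1: "cond_A1 f B n a b" and A2: "cond_A2 f B n a b" and A3: "cond_A3 f B n a b"
    and R1: "cond_R1 f \<Theta>" and R2: "cond_R2 \<mu> f \<Theta>"
    and R3: "cond_R3 \<mu> f B \<Theta>" and R4: "cond_R4 \<mu> f \<Theta>"
    and N: "prob_space N" and Z: "distributed N lborel Z (\<lambda>z. ennreal (std_normal_density z))"
    and h: "abs_cont h" "bounded (range h)"
    and eps: "R3_radius \<mu> f B \<Theta> \<theta>\<^sub>0 \<epsilon>" "{\<theta>\<^sub>0 - \<epsilon><..<\<theta>\<^sub>0 + \<epsilon>} \<subseteq> \<Theta>"
  shows "ennreal \<bar>prob_space.expectation M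
                    (\<lambda>\<omega>. h (sqrt (real n * fisher_info \<mu> f \<theta>\<^sub>0) * (mle_X \<omega> - \<theta>\<^sub>0)))
                  - prob_space.expectation N (\<lambda>z. h (Z z))\<bar>
    \<le> ess_norm (deriv h) / ennreal (sqrt (real n)) *
         (2 + ennreal (\<bar>deriv k \<theta>\<^sub>0\<bar> ^ 3) * (\<integral>\<^sup>+\<omega>. ennreal (\<bar>T (X 0 \<omega>) - D \<theta>\<^sub>0\<bar> ^ 3) \<partial>M)
              / ennreal (\<bar>(deriv ^^ 2) A \<theta>\<^sub>0 - (deriv ^^ 2) k \<theta>\<^sub>0 * D \<theta>\<^sub>0\<bar> powr (3 / 2)))
      + (\<integral>\<^sup>+\<omega>. ennreal ((mle_X \<omega> - \<theta>\<^sub>0)\<^sup>2) \<partial>M) *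
         (2 * (ess_norm h / ennreal (\<epsilon>\<^sup>2)) * (if \<exists>\<theta>\<in>\<Theta>. D \<theta> \<noteq> \<theta> then 1 else 0)
          + ess_norm (deriv h) * ennreal (sqrt (real n) * \<bar>deriv k \<theta>\<^sub>0\<bar>)
              / ennreal (2 * sqrt \<bar>(deriv ^^ 2) A \<theta>\<^sub>0 - (deriv ^^ 2) k \<theta>\<^sub>0 * D \<theta>\<^sub>0\<bar>)
              * (SUP \<theta>\<in>{\<theta>\<in>\<Theta>. \<bar>\<theta> - \<theta>\<^sub>0\<bar> \<le> \<epsilon>}. ennreal \<bar>(deriv ^^ 2) D \<theta>\<bar>))"
    (is "ennreal \<bar>?EU - ?EZ\<bar> \<le> ?R1 + ?R2")
proof (cases "ess_norm (deriv h)")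
  case top
  have "ess_norm (deriv h) / ennreal (sqrt (real n)) = \<infinity>" using top by (simp add: ennreal_top_divide)
  then have "?R1 = \<infinity>" by (simp add: ennreal_top_mult)
  then show ?thesis by simp
next
  case (real L)
  interpret M: prob_space M by (rule M)
  interpret N: prob_space N by (rule N)
  have "a < b" using theta0 by (auto simp: \<Theta>_def einterval_def)
  interpret mle_sample a b k A T S B \<mu> f \<Theta> D M X n \<theta>\<^sub>0
    by unfold_locales (use B family k' theta0 n indep ident A2 R1 R2 R4 \<open>a < b\<close> in \<open>auto simp: \<Theta>_def f_def D_def\<close>)
  have I: "fisher_info \<mu> f \<theta>\<^sub>0 = I" "\<bar>(deriv ^^ 2) A \<theta>\<^sub>0 - (deriv ^^ 2) k \<theta>\<^sub>0 * D \<theta>\<^sub>0\<bar> = I"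
    using I_pos fisher_info_eq[OF theta0] by (simp_all add: I_def)
  have lip: "L-lipschitz_on UNIV h" using h(1) real by (intro abs_cont_imp_lipschitz) auto
  have cont: "continuous_on UNIV h" using lip by (rule lipschitz_on_continuous_on)
  have [measurable]: "h \<in> borel_measurable borel" using cont by (rule borel_measurable_continuous_onI)
  obtain C where C: "\<And>x. \<bar>h x\<bar> \<le> C" using h(2) by (auto simp: bounded_iff)
  define EW where "EW = M.expectation (\<lambda>\<omega>. h ((\<Sum>i<n. \<xi> i \<omega>) / sqrt n))"
  have "?EZ = (\<integral>t. \<phi> t * h t \<partial>lborel)"
    by (rule distributed_integral[OF Z, symmetric]) auto
  then have W: "ennreal \<bar>EW - ?EZ\<bar> \<le> ?R1"
    using standardized_sum_bound[OF lip C] unfolding I real by (simp add: EW_def)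
  have "\<epsilon> > 0" using eps(1) by (simp add: R3_radius_def)
  then have U: "ennreal \<bar>?EU - EW\<bar> \<le> ?R2"
    using linearized_mle_bound[OF lip C _ continuous_le_ess_norm[OF cont]] unfolding I real mle_X_def EW_def by simp
  have "ennreal \<bar>?EU - ?EZ\<bar> \<le> ennreal \<bar>EW - ?EZ\<bar> + ennreal \<bar>?EU - EW\<bar>"
    by (simp flip: ennreal_plus)
  also have "\<dots> \<le> ?R1 + ?R2" by (rule add_mono[OF W U])
  finally show ?thesis .
qed

end
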